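(* Let $p_0(x,t)=\sqrt{(B-At)^2+2W(x)}$ be the auxiliary pressure defined in the context. The productivity index for gas flow $J[p_0]$ evaluated on $p_0(x,t)$ is time independent and is given by $$J[p_0]=\frac{Q_0}{\frac1{|U|}\int_U2W(x)\,dx}.$$
   Context: $U\subset\mathbb{R}^n$ is a bounded domain with $C^2$ boundary $\partial U=\Gamma_e\cup\Gamma_i$ and outward unit normal $N$. Let $\alpha>0$, $\beta\ge0$, and $K_2(\xi)=\frac{2}{\alpha+\sqrt{\alpha^2+4\beta\xi}}$ for $\xi\ge0$. Let $A>0$, $B>0$, $Q_0=A|U|$ and $0\le t<B/A$. The function $W$ is the (classical) solution of $$-\nabla\cdot\big(K_2(|\nabla W|)\nabla W\big)=A\ \text{in }U,\qquad W=0\ \text{on }\Gamma_i,\qquad \nabla W\cdot N=0\ \text{on }\Gamma_e$$ (so $W\ge0$). The productivity index for gas flow of a pressure $p$ is $$J[p](t)=\frac{Q(t)}{\frac1{|U|}\int_Up^2\,dx-\frac1{|\Gamma_i|}\int_{\Gamma_i}p^2\,ds},\qquad Q(t)=-\int_{\Gamma_i}K_2(p|\nabla p|)\,p\,\nabla p\cdot N\,ds$$ ($Q(t)$ is the total mass flow $\int_{\Gamma_i}\rho u\cdot N\,ds$ with density $\rho=p$ and velocity $u=-K_2(p|\nabla p|)\nabla p$). *)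

theory Defs
  imports "HOL-Analysis.Analysis"
begin

section \<open>Differential operators\<close>

text \<open>For \<open>S = closure U\<close> this gives the gradient up to the boundary: it is the ordinary gradient at
  points of the open set \<open>U\<close>, and the one-sided gradient (unique for a \<open>C\<^sup>2\<close> boundary) on the frontier.\<close>

definition gradient_within :: "'a::euclidean_space set \<Rightarrow> ('a \<Rightarrow> real) \<Rightarrow> 'a \<Rightarrow> 'a" where
  "gradient_within S f x = (THE g. (f has_derivative (\<lambda>h. g \<bullet> h)) (at x within S))"

definition divergence :: "('a::euclidean_space \<Rightarrow> 'a) \<Rightarrow> 'a \<Rightarrow> real" where
  "divergence F x = (\<Sum>b\<in>Basis. frechet_derivative F (at x) b \<bullet> b)"

text \<open>Regularity on an open set \<open>S\<close>.\<close>

definition C1_on :: "'a::euclidean_space set \<Rightarrow> ('a \<Rightarrow> real) \<Rightarrow> bool" where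
  "C1_on S f \<longleftrightarrow> (\<forall>x\<in>S. f differentiable (at x)) \<and>
     (\<forall>h. continuous_on S (\<lambda>x. frechet_derivative f (at x) h))"

definition C2_on :: "'a::euclidean_space set \<Rightarrow> ('a \<Rightarrow> real) \<Rightarrow> bool" where
  "C2_on S f \<longleftrightarrow> C1_on S f \<and> (\<forall>h. C1_on S (\<lambda>x. frechet_derivative f (at x) h))"

definition C1_upto_boundary :: "'a::euclidean_space set \<Rightarrow> ('a \<Rightarrow> real) \<Rightarrow> bool" where
  "C1_upto_boundary U f \<longleftrightarrow> f differentiable_on closure U \<and>
     continuous_on (closure U) (gradient_within (closure U) f)"


section \<open>Domains with \<open>C\<^sup>2\<close> boundary\<close>

text \<open>Inside a ball, \<open>U\<close> is the strict epigraph of a \<open>C\<^sup>2\<close> function of the \<open>n - 1\<close> coordinates other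
  than the one along \<open>e\<close>, where \<open>e\<close> is a coordinate axis up to orientation (Evans,
  Partial Differential Equations, Appendix C.1). A function of those \<open>n - 1\<close> coordinates is
  represented as a function on the whole space that is constant along \<open>e\<close>.\<close>

definition graph_chart ::
    "'a::euclidean_space set \<Rightarrow> 'a \<Rightarrow> real \<Rightarrow> 'a \<Rightarrow> ('a \<Rightarrow> real) \<Rightarrow> bool" where
  "graph_chart U z r e \<gamma> \<longleftrightarrow> r > 0 \<and> (e \<in> Basis \<or> - e \<in> Basis) \<and>
     C2_on UNIV \<gamma> \<and> (\<forall>x s. \<gamma> (x + s *\<^sub>R e) = \<gamma> x) \<and>
     U \<inter> ball z r = {x \<in> ball z r. \<gamma> x < x \<bullet> e}"

definition C2_boundary :: "'a::euclidean_space set \<Rightarrow> bool" where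
  "C2_boundary U \<longleftrightarrow> (\<forall>z\<in>frontier U. \<exists>r e \<gamma>. graph_chart U z r e \<gamma>)"

definition tangent_vector :: "'a::euclidean_space set \<Rightarrow> 'a \<Rightarrow> 'a \<Rightarrow> bool" where
  "tangent_vector M x v \<longleftrightarrow>
     (\<exists>c :: real \<Rightarrow> 'a. c 0 = x \<and> (\<forall>\<^sub>F s in nhds 0. c s \<in> M) \<and> (c has_vector_derivative v) (at 0))"

definition outward_normal :: "'a::euclidean_space set \<Rightarrow> 'a \<Rightarrow> 'a" where
  "outward_normal U x = (THE \<nu>. norm \<nu> = 1 \<and>
     (\<forall>v. tangent_vector (frontier U) x v \<longrightarrow> v \<bullet> \<nu> = 0) \<and>
     (\<forall>\<^sub>F s in at_right 0. x + s *\<^sub>R \<nu> \<notin> closure U))"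

text \<open>The area \<open>\<integral> sqrt (1 + |\<nabla>\<gamma>|\<^sup>2) dy\<close> of a part \<open>E\<close> of the graph \<open>{x. x \<bullet> e = \<gamma> x}\<close>. The integral over
  the projection of \<open>E\<close> to the hyperplane orthogonal to \<open>e\<close> is written as an integral over the
  cylinder of height \<open>1\<close> above that projection; \<open>x + (\<gamma> x - x \<bullet> e) *\<^sub>R e\<close> is the point of the graph
  on the line through \<open>x\<close> in direction \<open>e\<close>.\<close>

definition graph_area :: "'a::euclidean_space \<Rightarrow> ('a \<Rightarrow> real) \<Rightarrow> 'a set \<Rightarrow> ennreal" where
  "graph_area e \<gamma> E = (\<integral>\<^sup>+x. ennreal (sqrt (1 + (norm (gradient_within UNIV \<gamma> x))\<^sup>2)) *
     indicator {x. 0 \<le> x \<bullet> e \<and> x \<bullet> e \<le> 1 \<and> x + (\<gamma> x - x \<bullet> e) *\<^sub>R e \<in> E} x \<partial>lborel)"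

text \<open>The surface measure \<open>ds\<close> of \<open>frontier U\<close>: the Borel measure concentrated on the frontier that is
  given by the area formula in every local graph representation.\<close>

definition surface_measure :: "'a::euclidean_space set \<Rightarrow> 'a measure" where
  "surface_measure U = (THE \<sigma>. sets \<sigma> = sets borel \<and> emeasure \<sigma> (- frontier U) = 0 \<and>
     (\<forall>z r e \<gamma> E. graph_chart U z r e \<gamma> \<longrightarrow> E \<in> sets borel \<longrightarrow> E \<subseteq> frontier U \<inter> ball z r \<longrightarrow>
        emeasure \<sigma> E = graph_area e \<gamma> E))"


section \<open>Gas flow\<close>

definition K2 :: "real \<Rightarrow> real \<Rightarrow> real \<Rightarrow> real" where
  "K2 \<alpha> \<beta> \<xi> = 2 / (\<alpha> + sqrt (\<alpha>\<^sup>2 + 4 * \<beta> * \<xi>))"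

definition classical_solution ::
    "real \<Rightarrow> real \<Rightarrow> real \<Rightarrow> 'a::euclidean_space set \<Rightarrow> 'a set \<Rightarrow> 'a set \<Rightarrow> ('a \<Rightarrow> real) \<Rightarrow> bool" where
  "classical_solution \<alpha> \<beta> A U \<Gamma>e \<Gamma>i W \<longleftrightarrow>
     C2_on U W \<and> C1_upto_boundary U W \<and>
     (\<forall>x\<in>U. - divergence (\<lambda>y. K2 \<alpha> \<beta> (norm (gradient_within (closure U) W y)) *\<^sub>R
                               gradient_within (closure U) W y) x = A) \<and>
     (\<forall>x\<in>\<Gamma>i. W x = 0) \<and>
     (\<forall>x\<in>\<Gamma>e. gradient_within (closure U) W x \<bullet> outward_normal U x = 0)"

definition mass_flow ::
    "real \<Rightarrow> real \<Rightarrow> 'a::euclidean_space set \<Rightarrow> 'a set \<Rightarrow> ('a \<Rightarrow> real \<Rightarrow> real) \<Rightarrow> real \<Rightarrow> real" where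
  "mass_flow \<alpha> \<beta> U \<Gamma>i p t =
     - (LINT x:\<Gamma>i|surface_measure U.
          K2 \<alpha> \<beta> (p x t * norm (gradient_within (closure U) (\<lambda>y. p y t) x)) * p x t *
          (gradient_within (closure U) (\<lambda>y. p y t) x \<bullet> outward_normal U x))"

definition productivity_index ::
    "real \<Rightarrow> real \<Rightarrow> 'a::euclidean_space set \<Rightarrow> 'a set \<Rightarrow> ('a \<Rightarrow> real \<Rightarrow> real) \<Rightarrow> real \<Rightarrow> real" where
  "productivity_index \<alpha> \<beta> U \<Gamma>i p t =
     mass_flow \<alpha> \<beta> U \<Gamma>i p t /
     (1 / measure lborel U * (LINT x:U|lborel. (p x t)\<^sup>2) -
      1 / measure (surface_measure U) \<Gamma>i * (LINT x:\<Gamma>i|surface_measure U. (p x t)\<^sup>2))"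

definition aux_pressure :: "real \<Rightarrow> real \<Rightarrow> ('a \<Rightarrow> real) \<Rightarrow> 'a \<Rightarrow> real \<Rightarrow> real" where
  "aux_pressure A B W x t = sqrt ((B - A * t)\<^sup>2 + 2 * W x)"

end

theory Submission
  imports Defs
begin

text \<open>On \<open>\<Gamma>i\<close> the auxiliary pressure equals \<open>B - A * t > 0\<close>, and \<open>p \<nabla>p = \<nabla>W\<close>; hence the integrand of the mass
  flow is the normal component of the field \<open>K2(|\<nabla>W|) \<nabla>W\<close>. That field has divergence \<open>- A\<close> in \<open>U\<close> and
  no flux through \<open>\<Gamma>e\<close>, so by the divergence theorem the mass flow is \<open>A |U| = Q0\<close> at all times
  (\<open>total_flux\<close>, \<open>mass_flow_aux_pressure\<close>). In the denominator, \<open>p\<^sup>2 = (B - A * t)\<^sup>2 + 2 W\<close> in \<open>U\<close> and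
  \<open>p\<^sup>2 = (B - A * t)\<^sup>2\<close> on \<open>\<Gamma>i\<close>, so the time-dependent term cancels between the two means. Two facts about
  the steady problem enter here, and both come from the divergence theorem: \<open>\<Gamma>i\<close> has positive area, since
  the source \<open>A\<close> must leave through it (\<open>surface_\<Gamma>i_pos\<close>), and \<open>W \<ge> 0\<close> (\<open>W_nonneg\<close>).

  The main work is therefore the divergence theorem for \<open>C\<^sup>2\<close> domains, for fields that are \<open>C\<^sup>1\<close> inside, merely
  continuous up to the boundary, and of bounded divergence (\<open>divergence_theorem\<close>). Its core is the case
  of the region above a graph (\<open>integral_divergence_epi\<close>): the derivative in the vertical direction is
  integrated along vertical lines, and derivatives tangential to the graph become derivatives along
  straight lines under the shear that flattens the graph. A general domain is reduced to this case by cut-off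
  functions.

  The surface measure is specified by the area formula in all graph representations, so it has to be
  shown that any two of them assign the same area. Let \<open>\<phi>\<close> be a test function supported where both charts
  apply, and extend the unit normal \<open>\<nu>\<close> to the \<open>C\<^sup>1\<close> field given by the first chart. By the divergence theorem
  for graphs, the integral of \<open>\<phi> = \<phi> \<nu> \<bullet> \<nu>\<close> over the surface equals the volume integral of the divergence of
  \<open>\<phi> \<nu>\<close> over \<open>U\<close> in either chart (\<open>integral_area_eq\<close>), and such test functions determine the area measure
  (\<open>emeasure_area_eq\<close>).\<close>

section \<open>Continuously differentiable maps\<close>

text \<open>This extends \<open>C1_on\<close> to vector-valued maps; the derivative occurs as an arbitrary witness, so that
  the closure properties follow from the derivative rules directly.\<close>

definition C1_map :: "'a::euclidean_space set \<Rightarrow> ('a \<Rightarrow> 'b::real_normed_vector) \<Rightarrow> bool" where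
  "C1_map S f \<longleftrightarrow> (\<exists>f'. (\<forall>x\<in>S. (f has_derivative f' x) (at x)) \<and> (\<forall>h. continuous_on S (\<lambda>x. f' x h)))"

lemma C1_mapI:
  assumes "\<And>x. x \<in> S \<Longrightarrow> (f has_derivative f' x) (at x)" "\<And>h. continuous_on S (\<lambda>x. f' x h)"
  shows "C1_map S f"
  using assms unfolding C1_map_def by blast

lemma C1_map_has_derivative:
  assumes "C1_map S f" "x \<in> S"
  shows "(f has_derivative frechet_derivative f (at x)) (at x)"
  using assms unfolding C1_map_def by (metis differentiable_def frechet_derivative_works)

lemma C1_map_continuous_derivative:
  assumes "C1_map S f"
  shows "continuous_on S (\<lambda>x. frechet_derivative f (at x) h)"
proof -
  obtain f' where f': "\<And>x. x \<in> S \<Longrightarrow> (f has_derivative f' x) (at x)"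
      "\<And>h. continuous_on S (\<lambda>x. f' x h)"
    using assms unfolding C1_map_def by blast
  have "frechet_derivative f (at x) = f' x" if "x \<in> S" for x
    using frechet_derivative_at[OF f'(1)[OF that]] by simp
  then show ?thesis using f'(2)[of h] by (simp cong: continuous_on_cong)
qed

lemma C1_map_imp_continuous_on: "C1_map S f \<Longrightarrow> continuous_on S f"
  by (meson C1_map_has_derivative continuous_at_imp_continuous_on has_derivative_continuous)

lemma C1_map_subset: "C1_map S f \<Longrightarrow> T \<subseteq> S \<Longrightarrow> C1_map T f"
  unfolding C1_map_def by (meson continuous_on_subset subset_iff)

lemma C1_on_iff_C1_map: "C1_on S f \<longleftrightarrow> C1_map S f"
proof
  assume "C1_on S f"
  then show "C1_map S f"
    unfolding C1_on_def by (intro C1_mapI[where f' = "\<lambda>x. frechet_derivative f (at x)"])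
      (auto simp: frechet_derivative_works)
next
  assume "C1_map S f"
  then show "C1_on S f"
    unfolding C1_on_def using C1_map_continuous_derivative C1_map_has_derivative differentiable_def
    by blast
qed

lemma C1_map_cong_open:
  assumes "open S" "\<And>x. x \<in> S \<Longrightarrow> f x = g x" "C1_map S g"
  shows "C1_map S f"
proof (rule C1_mapI[where f' = "\<lambda>x. frechet_derivative g (at x)"])
  fix x assume "x \<in> S"
  then show "(f has_derivative frechet_derivative g (at x)) (at x)"
    using has_derivative_transform_within_open[OF C1_map_has_derivative[OF assms(3)] assms(1)]
      assms(2) by force
qed (rule C1_map_continuous_derivative[OF assms(3)])

lemma C1_map_Un:
  assumes "open S" "open T" "C1_map S f" "C1_map T f"
  shows "C1_map (S \<union> T) f"
proof (rule C1_mapI[where f' = "\<lambda>x. frechet_derivative f (at x)"])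
  show "(f has_derivative frechet_derivative f (at x)) (at x)" if "x \<in> S \<union> T" for x
    using that C1_map_has_derivative[OF assms(3)] C1_map_has_derivative[OF assms(4)] by blast
  show "continuous_on (S \<union> T) (\<lambda>x. frechet_derivative f (at x) h)" for h
    by (intro continuous_on_open_Un assms C1_map_continuous_derivative)
qed

lemma C1_map_const: "C1_map S (\<lambda>x. c)"
  by (rule C1_mapI[where f' = "\<lambda>_ _. 0"]) auto

lemma C1_map_bounded_linear:
  assumes "bounded_linear f" shows "C1_map S f"
  by (rule C1_mapI[where f' = "\<lambda>_. f"])
    (auto intro: bounded_linear_imp_has_derivative assms)

lemma C1_map_add:
  assumes "C1_map S f" "C1_map S g" shows "C1_map S (\<lambda>x. f x + g x)"
  by (rule C1_mapI[where f' = "\<lambda>x h. frechet_derivative f (at x) h + frechet_derivative g (at x) h"])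
    (auto intro!: derivative_intros continuous_intros C1_map_continuous_derivative assms
      C1_map_has_derivative[OF assms(1)] C1_map_has_derivative[OF assms(2)])

lemma C1_map_sum:
  assumes "\<And>i. i \<in> I \<Longrightarrow> C1_map S (f i)" shows "C1_map S (\<lambda>x. \<Sum>i\<in>I. f i x)"
  using assms by (induction I rule: infinite_finite_induct) (auto intro: C1_map_const C1_map_add)

lemma C1_map_scaleR:
  assumes "C1_map S f" "C1_map S g" shows "C1_map S (\<lambda>x. f x *\<^sub>R g x)"
  by (rule C1_mapI[where f' = "\<lambda>x h. f x *\<^sub>R frechet_derivative g (at x) h + frechet_derivative f (at x) h *\<^sub>R g x"])
    (auto intro!: has_derivative_scaleR continuous_intros C1_map_continuous_derivative assms
      C1_map_imp_continuous_on[OF assms(1)] C1_map_imp_continuous_on[OF assms(2)] C1_map_has_derivative[OF assms(1)] C1_map_has_derivative[OF assms(2)])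

lemma C1_map_mult:
  fixes f g :: "'a::euclidean_space \<Rightarrow> real"
  shows "C1_map S f \<Longrightarrow> C1_map S g \<Longrightarrow> C1_map S (\<lambda>x. f x * g x)"
  using C1_map_scaleR[of S f g] by simp

lemma C1_map_diff:
  assumes "C1_map S f" "C1_map S g" shows "C1_map S (\<lambda>x. f x - g x)"
  using C1_map_add[OF assms(1) C1_map_scaleR[OF C1_map_const[of S "-1"] assms(2)]] by simp

lemma C1_map_inner:
  assumes "C1_map S f" "C1_map S g" shows "C1_map S (\<lambda>x. f x \<bullet> g x)"
  by (rule C1_mapI[where f' = "\<lambda>x h. f x \<bullet> frechet_derivative g (at x) h + frechet_derivative f (at x) h \<bullet> g x"])
    (auto intro!: has_derivative_inner continuous_intros C1_map_continuous_derivative assms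
      C1_map_imp_continuous_on[OF assms(1)] C1_map_imp_continuous_on[OF assms(2)] C1_map_has_derivative[OF assms(1)] C1_map_has_derivative[OF assms(2)])

text \<open>The derivative of \<open>f\<close> is only assumed to be continuous in each fixed direction; linearity in
  the direction and finite dimension give joint continuity.\<close>

lemma C1_map_compose:
  fixes g :: "'a::euclidean_space \<Rightarrow> 'b::euclidean_space"
  assumes f: "C1_map T f" and g: "C1_map S g" and sub: "g ` S \<subseteq> T"
  shows "C1_map S (\<lambda>x. f (g x))"
proof (rule C1_mapI)
  fix x assume x: "x \<in> S"
  show "((\<lambda>x. f (g x)) has_derivative
      (\<lambda>h. frechet_derivative f (at (g x)) (frechet_derivative g (at x) h))) (at x)"
    using has_derivative_compose[OF C1_map_has_derivative[OF g x] C1_map_has_derivative[OF f]]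
      x sub by blast
next
  fix h
  have "frechet_derivative f (at (g x)) (frechet_derivative g (at x) h) =
      (\<Sum>b\<in>Basis. (frechet_derivative g (at x) h \<bullet> b) *\<^sub>R frechet_derivative f (at (g x)) b)"
    if "x \<in> S" for x
  proof -
    have "linear (frechet_derivative f (at (g x)))"
      using C1_map_has_derivative[OF f] that sub has_derivative_linear by blast
    then show ?thesis
      by (subst (1) euclidean_representation[symmetric, of "frechet_derivative g (at x) h"])
        (simp add: linear_sum linear_scale)
  qed
  moreover have "continuous_on S (\<lambda>x. \<Sum>b\<in>Basis. (frechet_derivative g (at x) h \<bullet> b) *\<^sub>R
      frechet_derivative f (at (g x)) b)"
    by (intro continuous_intros C1_map_continuous_derivative g
        continuous_on_compose2[OF C1_map_continuous_derivative[OF f] C1_map_imp_continuous_on[OF g] sub])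
  ultimately show "continuous_on S (\<lambda>x. frechet_derivative f (at (g x)) (frechet_derivative g (at x) h))"
    by (simp cong: continuous_on_cong)
qed

lemma C1_map_realI:
  fixes f :: "real \<Rightarrow> real"
  assumes "\<And>x. x \<in> S \<Longrightarrow> (f has_real_derivative f' x) (at x)" "continuous_on S f'"
  shows "C1_map S f"
  by (rule C1_mapI[where f' = "\<lambda>x h. f' x * h"])
    (use assms in \<open>auto intro!: continuous_intros simp: has_field_derivative_def\<close>)

lemma C1_map_inverse:
  fixes f :: "'a::euclidean_space \<Rightarrow> real"
  assumes "C1_map S f" "\<And>x. x \<in> S \<Longrightarrow> f x \<noteq> 0" shows "C1_map S (\<lambda>x. inverse (f x))"
proof (rule C1_map_compose[OF _ assms(1)])
  show "C1_map (- {0}) (inverse :: real \<Rightarrow> real)"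
    by (rule C1_map_realI[where f' = "\<lambda>x. - (inverse x)\<^sup>2"])
      (auto intro!: derivative_eq_intros continuous_intros simp: power2_eq_square)
qed (use assms in auto)

subsection \<open>Gradients and divergence\<close>

definition grad :: "('a::euclidean_space \<Rightarrow> real) \<Rightarrow> 'a \<Rightarrow> 'a" where
  "grad f x = (\<Sum>b\<in>Basis. frechet_derivative f (at x) b *\<^sub>R b)"

lemma linear_eq_inner:
  fixes D :: "'a::euclidean_space \<Rightarrow> real"
  assumes "linear D" shows "D h = (\<Sum>b\<in>Basis. D b *\<^sub>R b) \<bullet> h"
proof -
  have "D h = (\<Sum>b\<in>Basis. (h \<bullet> b) * D b)"
    by (subst (1) euclidean_representation[symmetric, of h])
      (simp add: linear_sum[OF assms] linear_scale[OF assms])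
  then show ?thesis by (simp add: inner_sum_left inner_commute[of h] mult.commute)
qed

lemma grad_inner:
  assumes "f differentiable at x"
  shows "grad f x \<bullet> h = frechet_derivative f (at x) h"
  unfolding grad_def
  by (rule linear_eq_inner[symmetric]) (use assms frechet_derivative_works has_derivative_linear in blast)

lemma has_derivative_grad:
  assumes "f differentiable at x"
  shows "(f has_derivative (\<lambda>h. grad f x \<bullet> h)) (at x)"
proof -
  have "(\<lambda>h. grad f x \<bullet> h) = frechet_derivative f (at x)"
    using grad_inner[OF assms] by blast
  then show ?thesis using assms frechet_derivative_works by metis
qed

lemma continuous_on_grad:
  assumes "C1_map S f" shows "continuous_on S (grad f)"
  unfolding grad_def by (intro continuous_intros C1_map_continuous_derivative assms)

lemma C1_map_differentiable: "C1_map S f \<Longrightarrow> x \<in> S \<Longrightarrow> f differentiable at x"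
  using C1_map_has_derivative differentiable_def by blast

lemma C1_map_grad:
  assumes "C2_on S f" shows "C1_map S (grad f)"
  using assms unfolding grad_def C2_on_def
  by (intro C1_map_sum C1_map_scaleR C1_map_const) (simp add: C1_on_iff_C1_map)

lemma gradient_within_eqI:
  assumes "(f has_derivative (\<lambda>h. g \<bullet> h)) (at x within S)"
    and "\<And>g'. (f has_derivative (\<lambda>h. g' \<bullet> h)) (at x within S) \<Longrightarrow> g' = g"
  shows "gradient_within S f x = g"
  unfolding gradient_within_def by (rule the_equality, rule assms(1), erule assms(2))

lemma gradient_within_interior:
  assumes "x \<in> interior S" "f differentiable at x"
  shows "gradient_within S f x = grad f x"
proof (rule gradient_within_eqI)
  show "(f has_derivative (\<lambda>h. grad f x \<bullet> h)) (at x within S)"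
    by (rule has_derivative_at_withinI[OF has_derivative_grad[OF assms(2)]])
  fix g assume "(f has_derivative (\<lambda>h. g \<bullet> h)) (at x within S)"
  then have "(f has_derivative (\<lambda>h. g \<bullet> h)) (at x)"
    by (simp only: at_within_interior[OF assms(1)])
  then have "(\<lambda>h. g \<bullet> h) = (\<lambda>h. grad f x \<bullet> h)"
    by (rule has_derivative_unique[OF _ has_derivative_grad[OF assms(2)]])
  then show "g = grad f x" by (metis vector_eq_rdot)
qed

lemma gradient_within_UNIV: "f differentiable at x \<Longrightarrow> gradient_within UNIV f x = grad f x"
  by (rule gradient_within_interior) auto

lemma divergence_cong_open:
  assumes "open S" "x \<in> S" "\<And>y. y \<in> S \<Longrightarrow> F y = G y"
  shows "divergence F x = divergence G x"
proof -
  have "(F has_derivative F') (at x) \<longleftrightarrow> (G has_derivative F') (at x)" for F'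
    using assms has_derivative_transform_within_open[of F F' x UNIV S G]
      has_derivative_transform_within_open[of G F' x UNIV S F] by auto
  then show ?thesis unfolding divergence_def frechet_derivative_def by simp
qed

lemma divergence_eqI: "(F has_derivative F') (at x) \<Longrightarrow> divergence F x = (\<Sum>b\<in>Basis. F' b \<bullet> b)"
  unfolding divergence_def by (metis frechet_derivative_at)

lemma divergence_scaleR:
  fixes f :: "'a::euclidean_space \<Rightarrow> real"
  assumes "f differentiable at x" "F differentiable at x"
  shows "divergence (\<lambda>y. f y *\<^sub>R F y) x = f x * divergence F x + grad f x \<bullet> F x"
proof -
  have "((\<lambda>y. f y *\<^sub>R F y) has_derivative (\<lambda>h. f x *\<^sub>R frechet_derivative F (at x) h +
      (grad f x \<bullet> h) *\<^sub>R F x)) (at x)"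
    using assms by (intro has_derivative_scaleR has_derivative_grad) (simp_all add: frechet_derivative_works[symmetric])
  then have "divergence (\<lambda>y. f y *\<^sub>R F y) x =
      f x * divergence F x + (\<Sum>b\<in>Basis. (grad f x \<bullet> b) * (F x \<bullet> b))"
    unfolding divergence_def[of F]
    by (simp add: divergence_eqI inner_add_left sum.distrib sum_distrib_left)
  then show ?thesis by (simp add: euclidean_inner[symmetric])
qed

lemma divergence_sum:
  assumes "\<And>i. i \<in> I \<Longrightarrow> F i differentiable at x"
  shows "divergence (\<lambda>y. \<Sum>i\<in>I. F i y) x = (\<Sum>i\<in>I. divergence (F i) x)"
proof -
  have "((\<lambda>y. \<Sum>i\<in>I. F i y) has_derivative (\<lambda>h. \<Sum>i\<in>I. frechet_derivative (F i) (at x) h)) (at x)"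
    by (intro has_derivative_sum) (use assms frechet_derivative_works in blast)
  then have "divergence (\<lambda>y. \<Sum>i\<in>I. F i y) x =
      (\<Sum>b\<in>Basis. \<Sum>i\<in>I. frechet_derivative (F i) (at x) b \<bullet> b)"
    by (simp add: divergence_eqI inner_sum_left)
  then show ?thesis unfolding divergence_def by (subst sum.swap) simp
qed

lemma continuous_on_divergence: "C1_map S F \<Longrightarrow> continuous_on S (divergence F)"
  unfolding divergence_def by (intro continuous_intros C1_map_continuous_derivative)

subsection \<open>Cut-off functions\<close>

text \<open>A continuously differentiable function that is positive exactly on the ball.\<close>

definition bump :: "'a::euclidean_space \<Rightarrow> real \<Rightarrow> 'a \<Rightarrow> real" where
  "bump z r x = (max 0 (r\<^sup>2 - (x - z) \<bullet> (x - z)))\<^sup>2"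

text \<open>Squaring removes the corner of the positive part. This yields both the cut-off functions of the
  localisation and the test function of the maximum principle.\<close>

lemma has_real_derivative_pos_part_sq:
  "((\<lambda>s::real. (max 0 s)\<^sup>2) has_real_derivative 2 * max 0 s) (at s)"
proof -
  consider "s > 0" | "s < 0" | "s = 0" by linarith
  then show ?thesis
  proof cases
    case 1
    have "((\<lambda>s::real. s\<^sup>2) has_real_derivative 2 * s) (at s)"
      by (auto intro!: derivative_eq_intros)
    then have "((\<lambda>s::real. (max 0 s)\<^sup>2) has_real_derivative 2 * s) (at s)"
      by (rule has_field_derivative_transform_within_open[where S = "{0<..}"]) (use 1 in auto)
    then show ?thesis using 1 by simp
  next
    case 2
    have "((\<lambda>s::real. 0) has_real_derivative 0) (at s)" by simp
    then have "((\<lambda>s::real. (max 0 s)\<^sup>2) has_real_derivative 0) (at s)"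
      by (rule has_field_derivative_transform_within_open[where S = "{..<0}"]) (use 2 in auto)
    then show ?thesis using 2 by simp
  next
    case 3
    have "((\<lambda>h::real. (max 0 h)\<^sup>2 / h) \<longlongrightarrow> 0) (at 0)"
    proof (rule tendsto_rabs_zero_cancel, rule tendsto_sandwich[of "\<lambda>_. 0" _ _ "\<lambda>h. \<bar>h\<bar>"])
      have "\<bar>(max 0 h)\<^sup>2 / h\<bar> \<le> \<bar>h\<bar>" for h :: real
        by (cases "h > 0") (auto simp: power2_eq_square max_def)
      then show "\<forall>\<^sub>F h in at 0. \<bar>(max 0 h)\<^sup>2 / h\<bar> \<le> \<bar>h::real\<bar>" by simp
    qed (auto intro!: tendsto_eq_intros)
    then show ?thesis using 3 by (simp add: DERIV_def)
  qed
qed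

lemma C1_map_pos_part_sq: "C1_map S (\<lambda>s::real. (max 0 s)\<^sup>2)"
  by (rule C1_map_realI[OF has_real_derivative_pos_part_sq]) (intro continuous_intros)

lemma C1_map_bump: "C1_map S (bump z r)"
  unfolding bump_def
  by (rule C1_map_compose[OF C1_map_pos_part_sq[of UNIV]])
    (intro C1_map_diff C1_map_inner C1_map_const C1_map_bounded_linear[OF bounded_linear_ident] subset_UNIV)+

lemma bump_nonneg: "bump z r x \<ge> 0"
  unfolding bump_def by simp

lemma bump_pos_iff:
  assumes "r > 0" shows "bump z r x > 0 \<longleftrightarrow> x \<in> ball z r"
proof -
  have "bump z r x > 0 \<longleftrightarrow> (norm (x - z))\<^sup>2 < r\<^sup>2"
    unfolding bump_def zero_less_power2 power2_norm_eq_inner by linarith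
  also have "\<dots> \<longleftrightarrow> norm (x - z) < r"
    using assms by (metis norm_ge_zero power2_less_imp_less power_strict_mono less_imp_le zero_less_numeral)
  finally show ?thesis by (simp add: dist_norm norm_minus_commute)
qed

lemma bump_eq_0: "r > 0 \<Longrightarrow> x \<notin> ball z r \<Longrightarrow> bump z r x = 0"
  using bump_pos_iff[of r z x] bump_nonneg[of z r x] by linarith

section \<open>Integration along parallel lines\<close>

text \<open>The slab of height \<open>1\<close> meets each line parallel to the unit vector \<open>e\<close> in a segment of length \<open>1\<close>;
  integrating over the slab thus amounts to integrating over the space of these lines.\<close>

definition slab :: "'a::euclidean_space \<Rightarrow> 'a set" where
  "slab e = {x. 0 \<le> x \<bullet> e \<and> x \<bullet> e \<le> 1}"

lemma slab_borel [measurable]: "slab e \<in> sets borel"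
proof -
  have "closed (slab e)"
    unfolding slab_def by (intro closed_Collect_conj closed_Collect_le continuous_intros)
  then show ?thesis by simp
qed

lemma nn_integral_lborel_translate:
  fixes c :: "'a::euclidean_space"
  assumes [measurable]: "g \<in> borel_measurable borel"
  shows "(\<integral>\<^sup>+x. g (x + c) \<partial>lborel) = (\<integral>\<^sup>+x. g x \<partial>lborel)"
proof -
  have "(\<integral>\<^sup>+x. g x \<partial>lborel) = (\<integral>\<^sup>+x. g x \<partial>distr lborel borel ((+) c))"
    by (simp add: lborel_distr_plus)
  also have "\<dots> = (\<integral>\<^sup>+x. g (c + x) \<partial>lborel)"
    by (rule nn_integral_distr) simp_all
  finally show ?thesis by (simp add: add.commute)
qed

text \<open>Sliding the slab along \<open>e\<close> covers each point for a set of times of length \<open>1\<close>; Tonelli and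
  translation invariance therefore give integration over the lines parallel to \<open>e\<close>, each of them
  being represented by its segment in the slab.\<close>

lemma nn_integral_fibres:
  fixes e :: "'a::euclidean_space"
  assumes e: "norm e = 1" and g [measurable]: "g \<in> borel_measurable borel"
  shows "(\<integral>\<^sup>+x. indicator (slab e) x * (\<integral>\<^sup>+s. g (x + s *\<^sub>R e) \<partial>lborel) \<partial>lborel) = (\<integral>\<^sup>+x. g x \<partial>lborel)"
proof -
  have ee: "e \<bullet> e = 1" using e by (simp add: norm_eq_1)
  have "(\<integral>\<^sup>+x. indicator (slab e) x * (\<integral>\<^sup>+s. g (x + s *\<^sub>R e) \<partial>lborel) \<partial>lborel) =
      (\<integral>\<^sup>+x. (\<integral>\<^sup>+s. indicator (slab e) x * g (x + s *\<^sub>R e) \<partial>lborel) \<partial>lborel)"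
    by (simp add: nn_integral_cmult)
  also have "\<dots> = (\<integral>\<^sup>+s. (\<integral>\<^sup>+x. indicator (slab e) x * g (x + s *\<^sub>R e) \<partial>lborel) \<partial>(lborel::real measure))"
    by (rule lborel_pair.Fubini'[symmetric]) simp
  also have "\<dots> = (\<integral>\<^sup>+s. (\<integral>\<^sup>+x. indicator (slab e) (x - s *\<^sub>R e) * g x \<partial>lborel) \<partial>(lborel::real measure))"
  proof (rule nn_integral_cong)
    fix s :: real
    show "(\<integral>\<^sup>+x. indicator (slab e) x * g (x + s *\<^sub>R e) \<partial>lborel) =
        (\<integral>\<^sup>+x. indicator (slab e) (x - s *\<^sub>R e) * g x \<partial>lborel)"
      using nn_integral_lborel_translate[of "\<lambda>x. indicator (slab e) (x - s *\<^sub>R e) * g x" "s *\<^sub>R e"]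
      by simp
  qed
  also have "\<dots> = (\<integral>\<^sup>+x. (\<integral>\<^sup>+s. indicator (slab e) (x - s *\<^sub>R e) * g x \<partial>(lborel::real measure)) \<partial>lborel)"
    by (rule lborel_pair.Fubini') simp
  also have "\<dots> = (\<integral>\<^sup>+x. g x \<partial>lborel)"
  proof (rule nn_integral_cong)
    fix x :: 'a
    have "(\<integral>\<^sup>+s. indicator (slab e) (x - s *\<^sub>R e) * g x \<partial>(lborel::real measure)) =
        (\<integral>\<^sup>+s. indicator {x \<bullet> e - 1..x \<bullet> e} s * g x \<partial>lborel)"
      by (intro nn_integral_cong) (auto simp: slab_def inner_diff_left ee indicator_def)
    also have "\<dots> = g x"
      by (simp add: nn_integral_multc)
    finally show "(\<integral>\<^sup>+s. indicator (slab e) (x - s *\<^sub>R e) * g x \<partial>(lborel::real measure)) = g x" .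
  qed
  finally show ?thesis .
qed

text \<open>The identity for nonnegative functions says that \<open>(x, s) \<mapsto> x + s *\<^sub>R e\<close> pushes the product of the
  slab and the line forward to Lebesgue measure, so Fubini applies to integrable functions.\<close>

lemma integral_fibres:
  fixes e :: "'a::euclidean_space" and g :: "'a \<Rightarrow> real"
  assumes e: "norm e = 1" and g: "integrable lborel g"
  shows "(\<integral>x. g x \<partial>lborel) = (\<integral>x. indicator (slab e) x * (\<integral>s. g (x + s *\<^sub>R e) \<partial>lborel) \<partial>lborel)"
proof -
  define N where "N = density lborel (\<lambda>x. ennreal (indicator (slab e) x))"
  interpret N: sigma_finite_measure N
    unfolding N_def by (subst sigma_finite_measure.sigma_finite_iff_density_finite[OF sigma_finite_lborel]) simp_all
  interpret pair_sigma_finite N "lborel :: real measure" ..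
  have sN [measurable_cong]: "sets N = sets borel" unfolding N_def by simp
  have m [measurable]: "(\<lambda>(x, s). x + s *\<^sub>R e) \<in> N \<Otimes>\<^sub>M (lborel :: real measure) \<rightarrow>\<^sub>M borel"
    by measurable
  have gm [measurable]: "g \<in> borel_measurable borel"
    using borel_measurable_integrable[OF g] by simp
  have "distr (N \<Otimes>\<^sub>M (lborel :: real measure)) borel (\<lambda>(x, s). x + s *\<^sub>R e) = lborel"
  proof (rule measure_eqI)
    fix A :: "'a set" assume "A \<in> sets (distr (N \<Otimes>\<^sub>M (lborel :: real measure)) borel (\<lambda>(x, s). x + s *\<^sub>R e))"
    then have A [measurable]: "A \<in> sets borel" by simp
    have "emeasure (distr (N \<Otimes>\<^sub>M (lborel :: real measure)) borel (\<lambda>(x, s). x + s *\<^sub>R e)) A =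
        (\<integral>\<^sup>+y. indicator A y \<partial>distr (N \<Otimes>\<^sub>M (lborel :: real measure)) borel (\<lambda>(x, s). x + s *\<^sub>R e))"
      by simp
    also have "\<dots> = (\<integral>\<^sup>+z. indicator A (case z of (x, s) \<Rightarrow> x + s *\<^sub>R e) \<partial>(N \<Otimes>\<^sub>M (lborel :: real measure)))"
      by (rule nn_integral_distr[OF m]) simp
    also have "\<dots> = (\<integral>\<^sup>+x. (\<integral>\<^sup>+s. indicator A (x + s *\<^sub>R e) \<partial>(lborel::real measure)) \<partial>N)"
      by (subst lborel.nn_integral_fst[symmetric]) simp_all
    also have "\<dots> = (\<integral>\<^sup>+x. indicator (slab e) x * (\<integral>\<^sup>+s. indicator A (x + s *\<^sub>R e) \<partial>(lborel::real measure)) \<partial>lborel)"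
      unfolding N_def by (subst nn_integral_density) (simp_all add: ennreal_indicator)
    also have "\<dots> = emeasure lborel A"
      by (subst nn_integral_fibres[OF e]) simp_all
    finally show "emeasure (distr (N \<Otimes>\<^sub>M (lborel :: real measure)) borel (\<lambda>(x, s). x + s *\<^sub>R e)) A = emeasure lborel A" .
  qed simp
  note D = this
  have "integrable (N \<Otimes>\<^sub>M (lborel :: real measure)) (\<lambda>z. g (case z of (x, s) \<Rightarrow> x + s *\<^sub>R e))"
    using integrable_distr[OF m, of g] g unfolding D by simp
  then have I: "integrable (N \<Otimes>\<^sub>M (lborel :: real measure)) (\<lambda>(x, s). g (x + s *\<^sub>R e))"
    by (simp add: case_prod_unfold)
  have "(\<integral>x. g x \<partial>lborel) = (\<integral>z. g (case z of (x, s) \<Rightarrow> x + s *\<^sub>R e) \<partial>(N \<Otimes>\<^sub>M (lborel :: real measure)))"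
    by (subst D[symmetric], rule integral_distr[OF m]) simp
  also have "\<dots> = (\<integral>x. (\<integral>s. g (x + s *\<^sub>R e) \<partial>lborel) \<partial>N)"
    using integral_fst'[OF I] by (simp add: case_prod_unfold)
  also have "\<dots> = (\<integral>x. indicator (slab e) x *\<^sub>R (\<integral>s. g (x + s *\<^sub>R e) \<partial>lborel) \<partial>lborel)"
    unfolding N_def by (rule integral_density) (auto intro!: lborel.borel_measurable_lebesgue_integral)
  finally show ?thesis by simp
qed

text \<open>On every line parallel to \<open>e\<close> the shear is a translation.\<close>

lemma distr_shear:
  fixes e :: "'a::euclidean_space"
  assumes e: "norm e = 1" and g [measurable]: "\<gamma> \<in> borel_measurable borel"
    and inv: "\<And>x s. \<gamma> (x + s *\<^sub>R e) = \<gamma> x"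
  shows "distr lborel borel (\<lambda>x. x + \<gamma> x *\<^sub>R e) = lborel"
proof (rule measure_eqI)
  fix A :: "'a set" assume "A \<in> sets (distr lborel borel (\<lambda>x. x + \<gamma> x *\<^sub>R e))"
  then have A [measurable]: "A \<in> sets borel" by simp
  have "emeasure (distr lborel borel (\<lambda>x. x + \<gamma> x *\<^sub>R e)) A =
      (\<integral>\<^sup>+y. indicator A y \<partial>distr lborel borel (\<lambda>x. x + \<gamma> x *\<^sub>R e))"
    by simp
  also have "\<dots> = (\<integral>\<^sup>+x. indicator A (x + \<gamma> x *\<^sub>R e) \<partial>lborel)"
    by (rule nn_integral_distr) simp_all
  also have "\<dots> = (\<integral>\<^sup>+x. indicator (slab e) x *
      (\<integral>\<^sup>+s. indicator A (x + s *\<^sub>R e + \<gamma> (x + s *\<^sub>R e) *\<^sub>R e) \<partial>(lborel::real measure)) \<partial>lborel)"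
    by (rule nn_integral_fibres[OF e, symmetric]) simp
  also have "\<dots> = (\<integral>\<^sup>+x. indicator (slab e) x *
      (\<integral>\<^sup>+s. indicator A (x + s *\<^sub>R e) \<partial>(lborel::real measure)) \<partial>lborel)"
  proof (rule nn_integral_cong)
    fix x :: 'a
    have "(\<integral>\<^sup>+s. indicator A (x + s *\<^sub>R e + \<gamma> (x + s *\<^sub>R e) *\<^sub>R e) \<partial>(lborel::real measure)) =
        (\<integral>\<^sup>+s. indicator A (x + (s + \<gamma> x) *\<^sub>R e) \<partial>(lborel::real measure))"
      by (simp add: inv scaleR_add_left add.assoc)
    also have "\<dots> = (\<integral>\<^sup>+s. indicator A (x + s *\<^sub>R e) \<partial>(lborel::real measure))"
      by (rule nn_integral_lborel_translate) simp
    finally show "indicator (slab e) x * (\<integral>\<^sup>+s. indicator A (x + s *\<^sub>R e + \<gamma> (x + s *\<^sub>R e) *\<^sub>R e) \<partial>(lborel::real measure)) =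
        indicator (slab e) x * (\<integral>\<^sup>+s. indicator A (x + s *\<^sub>R e) \<partial>(lborel::real measure))"
      by simp
  qed
  also have "\<dots> = emeasure lborel A"
    by (subst nn_integral_fibres[OF e]) simp_all
  finally show "emeasure (distr lborel borel (\<lambda>x. x + \<gamma> x *\<^sub>R e)) A = emeasure lborel A" .
qed simp

lemma integral_derivative_ray:
  fixes \<phi> \<phi>' :: "real \<Rightarrow> real"
  assumes der: "\<And>s. s \<ge> a \<Longrightarrow> (\<phi> has_real_derivative \<phi>' s) (at s)"
    and cont: "continuous_on {a..} \<phi>'"
    and van: "\<And>s. s > b \<Longrightarrow> \<phi> s = 0"
  shows "(\<integral>s. indicator {a..} s * \<phi>' s \<partial>lborel) = - \<phi> a"
proof -
  \<comment> \<open>Beyond \<open>b\<close> the derivative vanishes too, so the ray can be cut at any later point.\<close>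
  define c where "c = max a b + 1"
  have van': "\<phi>' s = 0" if "s > b" "s \<ge> a" for s
  proof -
    have "((\<lambda>_. 0) has_real_derivative \<phi>' s) (at s)"
      by (rule has_field_derivative_transform_within_open[OF der[OF that(2)], of "{b<..}"])
        (use that van in auto)
    then show ?thesis using DERIV_const DERIV_unique by blast
  qed
  have "(\<integral>s. indicator {a..} s * \<phi>' s \<partial>lborel) = (\<integral>s. indicator {a..c} s *\<^sub>R \<phi>' s \<partial>lborel)"
    by (intro Bochner_Integration.integral_cong) (auto simp: indicator_def c_def van')
  also have "\<dots> = \<phi> c - \<phi> a"
  proof (rule integral_FTC_atLeastAtMost)
    show "continuous_on {a..c} \<phi>'" by (rule continuous_on_subset[OF cont]) auto
    fix s assume "a \<le> s" "s \<le> c"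
    show "(\<phi> has_vector_derivative \<phi>' s) (at s within {a..c})"
      using der[OF \<open>a \<le> s\<close>] has_real_derivative_iff_has_vector_derivative has_vector_derivative_at_within by blast
  qed (simp add: c_def)
  finally show ?thesis using van[of c] by (simp add: c_def)
qed

lemma integral_derivative_line:
  fixes \<phi> \<phi>' :: "real \<Rightarrow> real"
  assumes der: "\<And>s. (\<phi> has_real_derivative \<phi>' s) (at s)"
    and cont: "continuous_on UNIV \<phi>'"
    and van: "\<And>s. \<bar>s\<bar> > b \<Longrightarrow> \<phi> s = 0"
  shows "(\<integral>s. \<phi>' s \<partial>lborel) = 0"
proof -
  define a where "a = - \<bar>b\<bar> - 1"
  have van': "\<phi>' s = 0" if "s < a" for s
  proof -
    have "((\<lambda>_. 0) has_real_derivative \<phi>' s) (at s)"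
      by (rule has_field_derivative_transform_within_open[OF der, of "{..<a}"])
        (use that van in \<open>auto simp: a_def\<close>)
    then show ?thesis using DERIV_const DERIV_unique by blast
  qed
  have "(\<integral>s. \<phi>' s \<partial>lborel) = (\<integral>s. indicator {a..} s * \<phi>' s \<partial>lborel)"
    by (intro Bochner_Integration.integral_cong) (auto simp: indicator_def van')
  also have "\<dots> = - \<phi> a"
    by (rule integral_derivative_ray[of _ _ _ b])
      (use der van in \<open>auto intro: continuous_on_subset[OF cont]\<close>)
  finally show ?thesis using van[of a] by (simp add: a_def)
qed

section \<open>The divergence theorem on an epigraph\<close>

text \<open>The graph \<open>{x. x \<bullet> e = \<gamma> x}\<close> and the region above it, with the representation of \<open>\<gamma>\<close> as a function
  on the whole space that is constant along \<open>e\<close>. The point \<open>foot x\<close> is the point of the graph on the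
  line through \<open>x\<close> in direction \<open>e\<close>, and \<open>epi_from a\<close> is the closed region above the graph raised by \<open>a\<close>.\<close>

locale C2_graph =
  fixes e :: "'a::euclidean_space" and \<gamma> :: "'a \<Rightarrow> real"
  assumes axis: "e \<in> Basis \<or> - e \<in> Basis"
    and C2: "C2_on UNIV \<gamma>"
    and const_along: "\<gamma> (x + s *\<^sub>R e) = \<gamma> x"
begin

definition epi :: "'a set" where "epi = {x. \<gamma> x < x \<bullet> e}"
definition epi_from :: "real \<Rightarrow> 'a set" where "epi_from a = {x. \<gamma> x + a \<le> x \<bullet> e}"
definition graph :: "'a set" where "graph = {x. \<gamma> x = x \<bullet> e}"
definition foot :: "'a \<Rightarrow> 'a" where "foot x = x + (\<gamma> x - x \<bullet> e) *\<^sub>R e"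

lemma norm_e: "norm e = 1"
  using axis by (metis norm_Basis norm_minus_cancel)

lemma e_inner_e: "e \<bullet> e = 1"
  using norm_e by (simp add: norm_eq_1)

lemma C1: "C1_map S \<gamma>"
  using C2 C1_map_subset[of UNIV \<gamma> S] by (simp add: C2_on_def C1_on_iff_C1_map)

lemma differentiable: "\<gamma> differentiable at x"
  using C1_map_differentiable[OF C1[of UNIV]] by simp

lemma C1_grad: "C1_map S (grad \<gamma>)"
  using C1_map_grad[OF C2] C1_map_subset by blast

lemma continuous_on_gamma [continuous_intros]: "continuous_on S f \<Longrightarrow> continuous_on S (\<lambda>x. \<gamma> (f x))"
  using continuous_on_compose2[OF C1_map_imp_continuous_on[OF C1[of UNIV]]] by auto

lemma continuous_on_grad_gamma [continuous_intros]:
  "continuous_on S f \<Longrightarrow> continuous_on S (\<lambda>x. grad \<gamma> (f x))"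
  using continuous_on_compose2[OF C1_map_imp_continuous_on[OF C1_grad[of UNIV]]] by auto

lemma gamma_measurable [measurable]: "\<gamma> \<in> borel_measurable borel"
  by (intro borel_measurable_continuous_onI continuous_on_gamma continuous_on_id)

lemma has_derivative_gamma: "(\<gamma> has_derivative (\<lambda>h. grad \<gamma> x \<bullet> h)) (at x)"
  by (rule has_derivative_grad[OF differentiable])

lemma grad_const_along: "grad \<gamma> (x + s *\<^sub>R e) = grad \<gamma> x"
proof -
  have "((\<lambda>y. \<gamma> (y + s *\<^sub>R e)) has_derivative (\<lambda>h. grad \<gamma> (x + s *\<^sub>R e) \<bullet> h)) (at x)"
    by (rule has_derivative_compose[OF _ has_derivative_gamma]) (auto intro!: derivative_eq_intros)
  then have "(\<gamma> has_derivative (\<lambda>h. grad \<gamma> (x + s *\<^sub>R e) \<bullet> h)) (at x)"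
    by (simp add: const_along)
  then have "(\<lambda>h. grad \<gamma> (x + s *\<^sub>R e) \<bullet> h) = (\<lambda>h. grad \<gamma> x \<bullet> h)"
    by (rule has_derivative_unique[OF _ has_derivative_gamma])
  then show ?thesis by (metis vector_eq_rdot)
qed

lemma grad_inner_e: "grad \<gamma> x \<bullet> e = 0"
proof -
  have "((\<lambda>s. \<gamma> (x + s *\<^sub>R e)) has_derivative (\<lambda>s. grad \<gamma> x \<bullet> (s *\<^sub>R e))) (at 0)"
    by (rule has_derivative_compose[where f = "\<lambda>s. x + s *\<^sub>R e"])
      (auto intro!: derivative_eq_intros has_derivative_gamma)
  then have "((\<lambda>s::real. \<gamma> x) has_derivative (\<lambda>s. grad \<gamma> x \<bullet> (s *\<^sub>R e))) (at 0)"
    by (simp add: const_along)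
  then have "(\<lambda>s::real. grad \<gamma> x \<bullet> (s *\<^sub>R e)) = (\<lambda>s. 0)"
    by (rule has_derivative_unique) simp
  then show ?thesis by (metis scaleR_one)
qed

lemma foot_inner_e: "foot x \<bullet> e = \<gamma> (foot x)" and gamma_foot: "\<gamma> (foot x) = \<gamma> x"
  and grad_foot: "grad \<gamma> (foot x) = grad \<gamma> x"
  unfolding foot_def by (simp_all add: const_along grad_const_along inner_add_left e_inner_e)

lemma foot_in_graph: "foot x \<in> graph"
  unfolding graph_def using foot_inner_e by simp

lemma foot_eq: "x \<in> graph \<Longrightarrow> foot x = x"
  unfolding graph_def foot_def by simp

lemma foot_shift_in: "a \<ge> 0 \<Longrightarrow> foot x + a *\<^sub>R e \<in> epi_from a"
  unfolding epi_from_def by (simp add: inner_add_left foot_inner_e e_inner_e const_along)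

lemma epi_from_subset: "a > 0 \<Longrightarrow> epi_from a \<subseteq> epi"
  unfolding epi_from_def epi_def by auto

lemma epi_from_mono: "a \<le> b \<Longrightarrow> epi_from b \<subseteq> epi_from a"
  unfolding epi_from_def by auto

lemma open_epi: "open epi"
  unfolding epi_def by (intro open_Collect_less continuous_intros continuous_on_id)

lemma closed_epi_from: "closed (epi_from a)"
  unfolding epi_from_def by (intro closed_Collect_le continuous_intros continuous_on_id)

lemma closed_graph: "closed graph"
  unfolding graph_def by (intro closed_Collect_eq continuous_intros continuous_on_id)

lemma measurable_sets [measurable]:
  "epi \<in> sets borel" "epi_from a \<in> sets borel" "graph \<in> sets borel"
  using open_epi closed_epi_from closed_graph by auto

lemma continuous_on_foot: "continuous_on S foot"
  unfolding foot_def by (intro continuous_intros continuous_on_id)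

lemma foot_measurable [measurable]: "foot \<in> borel_measurable borel"
  by (intro borel_measurable_continuous_onI continuous_on_foot)

text \<open>Compact support of an integrand above the graph is inherited by its restriction to the raised
  graph, once that is parametrised by the slab.\<close>

lemma slab_bounded_by_foot:
  assumes "x \<in> slab e" "foot x + a *\<^sub>R e \<in> cball 0 R"
  shows "x \<in> cball 0 (2 * R + 1)"
proof -
  define y where "y = foot x + a *\<^sub>R e"
  have "x = y - (y \<bullet> e) *\<^sub>R e + (x \<bullet> e) *\<^sub>R e"
    unfolding y_def foot_def by (simp add: inner_add_left e_inner_e algebra_simps)
  then have "norm x \<le> norm (y - (y \<bullet> e) *\<^sub>R e) + norm ((x \<bullet> e) *\<^sub>R e)"
    by (metis norm_triangle_ineq)
  also have "\<dots> \<le> norm y + norm ((y \<bullet> e) *\<^sub>R e) + norm ((x \<bullet> e) *\<^sub>R e)"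
    using norm_triangle_ineq4[of y "(y \<bullet> e) *\<^sub>R e"] by linarith
  also have "\<dots> \<le> R + R + 1"
    using assms Cauchy_Schwarz_ineq2[of y e] unfolding y_def[symmetric]
    by (simp add: norm_e slab_def)
  finally show ?thesis by simp
qed

context
  fixes R :: real
begin

lemma derivative_outside:
  fixes f :: "'a \<Rightarrow> 'b::real_normed_vector"
  assumes "C1_map epi f" and van: "\<And>x. x \<in> epi \<Longrightarrow> x \<notin> cball 0 R \<Longrightarrow> f x = 0"
    and x: "x \<in> epi" "x \<notin> cball 0 R"
  shows "frechet_derivative f (at x) h = 0"
proof -
  have "open (epi - cball 0 R)" using open_epi by (simp add: open_Diff)
  then have "((\<lambda>_. 0) has_derivative frechet_derivative f (at x)) (at x)"
    by (rule has_derivative_transform_within_open[OF C1_map_has_derivative[OF assms(1) x(1)]])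
      (use x van in auto)
  then have "frechet_derivative f (at x) = (\<lambda>_. 0)"
    using has_derivative_unique has_derivative_const by blast
  then show ?thesis by simp
qed

lemma integrable_on_epi_from:
  fixes g :: "'a \<Rightarrow> real"
  assumes "continuous_on (epi_from a) g" and van: "\<And>x. x \<in> epi_from a \<Longrightarrow> x \<notin> cball 0 R \<Longrightarrow> g x = 0"
  shows "integrable lborel (\<lambda>x. indicator (epi_from a) x * g x)"
proof -
  have "integrable lborel (\<lambda>x. indicator (epi_from a \<inter> cball 0 R) x *\<^sub>R g x)"
    by (intro borel_integrable_compact closed_Int_compact closed_epi_from compact_cball
        continuous_on_subset[OF assms(1)]) auto
  moreover have "(\<lambda>x. indicator (epi_from a \<inter> cball 0 R) x *\<^sub>R g x) = (\<lambda>x. indicator (epi_from a) x * g x)"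
    using van by (auto simp: indicator_def fun_eq_iff)
  ultimately show ?thesis by (simp only:)
qed

lemma integrable_on_slab:
  fixes g :: "'a \<Rightarrow> real"
  assumes "continuous_on (slab e) g"
    and van: "\<And>x. x \<in> slab e \<Longrightarrow> foot x + a *\<^sub>R e \<notin> cball 0 R \<Longrightarrow> g x = 0"
  shows "integrable lborel (\<lambda>x. indicator (slab e) x * g x)"
proof -
  have cl: "closed (slab e)"
    unfolding slab_def by (intro closed_Collect_conj closed_Collect_le continuous_intros)
  have "integrable lborel (\<lambda>x. indicator (slab e \<inter> cball 0 (2 * R + 1)) x *\<^sub>R g x)"
    by (intro borel_integrable_compact closed_Int_compact cl compact_cball
        continuous_on_subset[OF assms(1)]) auto
  moreover have "(\<lambda>x. indicator (slab e \<inter> cball 0 (2 * R + 1)) x *\<^sub>R g x) = (\<lambda>x. indicator (slab e) x * g x)"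
  proof
    fix x
    show "indicator (slab e \<inter> cball 0 (2 * R + 1)) x *\<^sub>R g x = indicator (slab e) x * g x"
      using van[of x] slab_bounded_by_foot[of x a R] by (auto simp: indicator_def)
  qed
  ultimately show ?thesis by (simp only:)
qed

text \<open>The fundamental theorem of calculus on each line parallel to \<open>e\<close>. The weight \<open>c\<close>, constant along
  these lines, later takes the value \<open>grad \<gamma> x \<bullet> b\<close>.\<close>

lemma integral_derivative_e:
  fixes f c :: "'a \<Rightarrow> real"
  assumes f: "C1_map epi f" and van: "\<And>x. x \<in> epi \<Longrightarrow> x \<notin> cball 0 R \<Longrightarrow> f x = 0"
    and a: "a > 0" and c: "continuous_on UNIV c" "\<And>x s. c (x + s *\<^sub>R e) = c x"
  shows "(\<integral>x. indicator (epi_from a) x * (c x * frechet_derivative f (at x) e) \<partial>lborel) =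
    - (\<integral>x. indicator (slab e) x * (c x * f (foot x + a *\<^sub>R e)) \<partial>lborel)"
proof -
  have out: "frechet_derivative f (at x) h = 0" if "x \<in> epi" "x \<notin> cball 0 R" for x h
    using derivative_outside[OF f _ that] van by blast
  let ?g = "\<lambda>x. indicator (epi_from a) x * (c x * frechet_derivative f (at x) e)"
  have inner: "(\<integral>s. ?g (x + s *\<^sub>R e) \<partial>lborel) = - (c x * f (foot x + a *\<^sub>R e))" for x
  proof -
    define s0 where "s0 = \<gamma> x + a - x \<bullet> e"
    have in_epi: "x + s *\<^sub>R e \<in> epi" if "s \<ge> s0" for s
      using that a unfolding epi_def s0_def by (simp add: const_along inner_add_left e_inner_e)
    have "(\<integral>s. ?g (x + s *\<^sub>R e) \<partial>lborel) =
        (\<integral>s. c x * (indicator {s0..} s * frechet_derivative f (at (x + s *\<^sub>R e)) e) \<partial>lborel)"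
      by (intro Bochner_Integration.integral_cong)
        (auto simp: indicator_def epi_from_def const_along inner_add_left e_inner_e c(2) s0_def)
    also have "\<dots> = c x * (\<integral>s. indicator {s0..} s * frechet_derivative f (at (x + s *\<^sub>R e)) e \<partial>lborel)"
      by simp
    also have "(\<integral>s. indicator {s0..} s * frechet_derivative f (at (x + s *\<^sub>R e)) e \<partial>lborel) =
        - f (x + s0 *\<^sub>R e)"
    proof (rule integral_derivative_ray[where b = "max s0 (R + norm x)"])
      fix s assume s: "s \<ge> s0"
      have "((\<lambda>s. f (x + s *\<^sub>R e)) has_derivative (\<lambda>h. frechet_derivative f (at (x + s *\<^sub>R e)) (h *\<^sub>R e))) (at s)"
        by (rule has_derivative_compose[where f = "\<lambda>s. x + s *\<^sub>R e"])
          (auto intro!: derivative_eq_intros C1_map_has_derivative[OF f in_epi[OF s]])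
      moreover have "frechet_derivative f (at (x + s *\<^sub>R e)) (h *\<^sub>R e) =
          h * frechet_derivative f (at (x + s *\<^sub>R e)) e" for h
        using linear_scale[OF has_derivative_linear[OF C1_map_has_derivative[OF f in_epi[OF s]]]] by simp
      ultimately show "((\<lambda>s. f (x + s *\<^sub>R e)) has_real_derivative
          frechet_derivative f (at (x + s *\<^sub>R e)) e) (at s)"
        by (simp add: has_field_derivative_def mult.commute[of _ "frechet_derivative f _ e"])
    next
      show "continuous_on {s0..} (\<lambda>s. frechet_derivative f (at (x + s *\<^sub>R e)) e)"
        by (rule continuous_on_compose2[OF C1_map_continuous_derivative[OF f]])
          (auto intro!: continuous_intros in_epi)
    next
      fix s assume s: "s > max s0 (R + norm x)"
      have "norm (s *\<^sub>R e) \<le> norm (x + s *\<^sub>R e) + norm x"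
        by (metis add_diff_cancel_left' norm_triangle_ineq4)
      then have "\<bar>s\<bar> \<le> norm (x + s *\<^sub>R e) + norm x" by (simp add: norm_e)
      then have "norm (x + s *\<^sub>R e) > R" using s by linarith
      then show "f (x + s *\<^sub>R e) = 0" using van[OF in_epi] s by simp
    qed
    also have "x + s0 *\<^sub>R e = foot x + a *\<^sub>R e"
      unfolding s0_def foot_def by (simp add: algebra_simps)
    finally show ?thesis by simp
  qed
  have "integrable lborel ?g"
    by (rule integrable_on_epi_from)
      (use a in \<open>auto intro!: continuous_intros continuous_on_subset[OF c(1)]
         continuous_on_subset[OF C1_map_continuous_derivative[OF f] epi_from_subset]
         simp: out dest!: epi_from_subset[THEN subsetD, rotated]\<close>)
  then have "(\<integral>x. ?g x \<partial>lborel) = (\<integral>x. indicator (slab e) x * (\<integral>s. ?g (x + s *\<^sub>R e) \<partial>lborel) \<partial>lborel)"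
    by (rule integral_fibres[OF norm_e])
  then show ?thesis by (simp only: inner mult_minus_right Bochner_Integration.integral_minus)
qed

text \<open>The vector \<open>b + (grad \<gamma> x \<bullet> b) *\<^sub>R e\<close> is tangent to the translates of the graph. The shear
  \<open>x \<mapsto> x + \<gamma> x *\<^sub>R e\<close> flattens them and preserves volume, and it turns the derivative along this
  vector into the derivative along \<open>b\<close>, whose integral over every line vanishes.\<close>

lemma integral_derivative_tangential:
  fixes f :: "'a \<Rightarrow> real"
  assumes f: "C1_map epi f" and van: "\<And>x. x \<in> epi \<Longrightarrow> x \<notin> cball 0 R \<Longrightarrow> f x = 0"
    and a: "a > 0" and b: "norm b = 1" "b \<bullet> e = 0"
  shows "(\<integral>x. indicator (epi_from a) x *
      (frechet_derivative f (at x) b + (grad \<gamma> x \<bullet> b) * frechet_derivative f (at x) e) \<partial>lborel) = 0"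
proof -
  let ?g = "\<lambda>x. indicator (epi_from a) x *
      (frechet_derivative f (at x) b + (grad \<gamma> x \<bullet> b) * frechet_derivative f (at x) e)"
  let ?T = "\<lambda>x. x + \<gamma> x *\<^sub>R e"
  have out: "frechet_derivative f (at x) h = 0" if "x \<in> epi" "x \<notin> cball 0 R" for x h
    using derivative_outside[OF f _ that] van by blast
  have eb: "e \<bullet> b = 0" using b(2) by (simp add: inner_commute)
  have int: "integrable lborel ?g"
    by (rule integrable_on_epi_from)
      (use a in \<open>auto intro!: continuous_intros
         continuous_on_subset[OF C1_map_continuous_derivative[OF f] epi_from_subset]
         simp: out dest!: epi_from_subset[THEN subsetD, rotated]\<close>)
  have [measurable]: "?g \<in> borel_measurable borel"
    using borel_measurable_integrable[OF int] by simp
  have sh: "distr lborel borel ?T = lborel"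
    by (rule distr_shear[OF norm_e gamma_measurable const_along])
  have "(\<integral>x. ?g x \<partial>lborel) = (\<integral>x. ?g x \<partial>distr lborel borel ?T)" by (simp only: sh)
  also have "\<dots> = (\<integral>x. ?g (?T x) \<partial>lborel)" by (rule integral_distr) auto
  also have "\<dots> = (\<integral>x. indicator (slab b) x * (\<integral>s. ?g (?T (x + s *\<^sub>R b)) \<partial>lborel) \<partial>lborel)"
  proof (rule integral_fibres[OF b(1)])
    have "integrable (distr lborel borel ?T) ?g" unfolding sh by (rule int)
    then show "integrable lborel (\<lambda>x. ?g (?T x))" by (rule integrable_distr[rotated]) auto
  qed
  also have "\<dots> = (\<integral>x. 0 \<partial>(lborel :: 'a measure))"
  proof (intro Bochner_Integration.integral_cong refl)
    fix x :: 'a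
    have "(\<integral>s. ?g (?T (x + s *\<^sub>R b)) \<partial>lborel) = 0"
    proof (cases "x \<bullet> e \<ge> a")
      case False
      then have "?g (?T (x + s *\<^sub>R b)) = 0" for s
        by (simp add: indicator_def epi_from_def const_along inner_add_left e_inner_e b)
      then show ?thesis by (simp only: Bochner_Integration.integral_zero)
    next
      case True
      let ?y = "\<lambda>s. ?T (x + s *\<^sub>R b)"
      let ?D = "\<lambda>s. frechet_derivative f (at (?y s)) b +
          (grad \<gamma> (?y s) \<bullet> b) * frechet_derivative f (at (?y s)) e"
      have y_in: "?y s \<in> epi_from a" for s
        using True by (simp add: epi_from_def const_along inner_add_left e_inner_e b)
      then have y_epi: "?y s \<in> epi" for s using epi_from_subset[OF a] by blast
      have "(\<integral>s. ?D s \<partial>lborel) = 0"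
      proof (rule integral_derivative_line[where \<phi> = "\<lambda>s. f (?y s)" and b = "R + norm x"])
        fix s :: real
        let ?A = "frechet_derivative f (at (?y s))"
        have lin: "linear ?A" by (rule has_derivative_linear[OF C1_map_has_derivative[OF f y_epi]])
        have "((\<lambda>s. \<gamma> (x + s *\<^sub>R b)) has_derivative (\<lambda>h. grad \<gamma> (x + s *\<^sub>R b) \<bullet> (h *\<^sub>R b))) (at s)"
          by (rule has_derivative_compose[where f = "\<lambda>s. x + s *\<^sub>R b"])
            (auto intro!: derivative_eq_intros has_derivative_gamma)
        then have "(?y has_derivative (\<lambda>h. h *\<^sub>R b + (grad \<gamma> (x + s *\<^sub>R b) \<bullet> (h *\<^sub>R b)) *\<^sub>R e)) (at s)"
          by (auto intro!: derivative_eq_intros)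
        then have "((\<lambda>s. f (?y s)) has_derivative
            (\<lambda>h. ?A (h *\<^sub>R b + (grad \<gamma> (x + s *\<^sub>R b) \<bullet> (h *\<^sub>R b)) *\<^sub>R e))) (at s)"
          by (rule has_derivative_compose) (rule C1_map_has_derivative[OF f y_epi])
        moreover have "?A (h *\<^sub>R b + (grad \<gamma> (x + s *\<^sub>R b) \<bullet> (h *\<^sub>R b)) *\<^sub>R e) = ?D s * h" for h
          unfolding grad_const_along
          by (simp add: linear_add[OF lin] linear_scale[OF lin] distrib_left mult_ac)
        ultimately show "((\<lambda>s. f (?y s)) has_real_derivative ?D s) (at s)"
          by (simp add: has_field_derivative_def)
      next
        have cy: "continuous_on UNIV ?y" by (intro continuous_intros)
        have "continuous_on UNIV (\<lambda>s. frechet_derivative f (at (?y s)) h)" for h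
          by (rule continuous_on_compose2[OF C1_map_continuous_derivative[OF f] cy]) (use y_epi in auto)
        then show "continuous_on UNIV ?D" by (intro continuous_intros cy)
      next
        fix s assume s: "\<bar>s\<bar> > R + norm x"
        have "\<bar>?y s \<bullet> b\<bar> \<le> norm (?y s)" using Cauchy_Schwarz_ineq2[of "?y s" b] b by simp
        moreover have "?y s \<bullet> b = x \<bullet> b + s"
          using b by (simp add: inner_add_left eb norm_eq_1)
        moreover have "\<bar>x \<bullet> b\<bar> \<le> norm x" using Cauchy_Schwarz_ineq2[of x b] b by simp
        ultimately have "norm (?y s) > R" using s by linarith
        then show "f (?y s) = 0" by (intro van y_epi) simp
      qed
      moreover have "?g (?y s) = ?D s" for s using y_in[of s] by (simp add: indicator_def)
      ultimately show ?thesis by (simp only:)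
    qed
    then show "indicator (slab b) x * (\<integral>s. ?g (?T (x + s *\<^sub>R b)) \<partial>lborel) = 0" by (simp only: mult_zero_right)
  qed
  finally show ?thesis by simp
qed

lemma continuous_on_foot_shift:
  fixes f :: "'a \<Rightarrow> 'b::topological_space"
  assumes "continuous_on epi f" "a > 0"
  shows "continuous_on S (\<lambda>x. f (foot x + a *\<^sub>R e))"
proof (rule continuous_on_compose2[OF assms(1)])
  show "continuous_on S (\<lambda>x. foot x + a *\<^sub>R e)" by (intro continuous_intros continuous_on_foot)
  show "(\<lambda>x. foot x + a *\<^sub>R e) ` S \<subseteq> epi"
    using foot_shift_in[of a] epi_from_subset[of a] assms(2) by fastforce
qed

text \<open>For \<open>b\<close> orthogonal to \<open>e\<close>, write \<open>b = (b + (grad \<gamma> x \<bullet> b) *\<^sub>R e) - (grad \<gamma> x \<bullet> b) *\<^sub>R e\<close>: the first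
  vector is tangential and contributes nothing, the second is parallel to \<open>e\<close>. The only other case is
  \<open>b = \<plusminus> e\<close>.\<close>

lemma integral_partial_derivative:
  fixes f :: "'a \<Rightarrow> real"
  assumes f: "C1_map epi f" and van: "\<And>x. x \<in> epi \<Longrightarrow> x \<notin> cball 0 R \<Longrightarrow> f x = 0"
    and a: "a > 0" and b: "b \<in> Basis"
  shows "(\<integral>x. indicator (epi_from a) x * frechet_derivative f (at x) b \<partial>lborel) =
    (\<integral>x. indicator (slab e) x * (f (foot x + a *\<^sub>R e) * ((grad \<gamma> x - e) \<bullet> b)) \<partial>lborel)"
proof (cases "e \<bullet> b = 0")
  case True
  let ?t = "\<lambda>x. indicator (epi_from a) x *
      (frechet_derivative f (at x) b + (grad \<gamma> x \<bullet> b) * frechet_derivative f (at x) e)"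
  let ?n = "\<lambda>x. indicator (epi_from a) x * ((grad \<gamma> x \<bullet> b) * frechet_derivative f (at x) e)"
  have out: "frechet_derivative f (at x) h = 0" if "x \<in> epi" "x \<notin> cball 0 R" for x h
    using derivative_outside[OF f _ that] van by blast
  have "integrable lborel ?t"
    by (rule integrable_on_epi_from)
      (use a in \<open>auto intro!: continuous_intros
         continuous_on_subset[OF C1_map_continuous_derivative[OF f] epi_from_subset]
         simp: out dest!: epi_from_subset[THEN subsetD, rotated]\<close>)
  moreover have "integrable lborel ?n"
    by (rule integrable_on_epi_from)
      (use a in \<open>auto intro!: continuous_intros
         continuous_on_subset[OF C1_map_continuous_derivative[OF f] epi_from_subset]
         simp: out dest!: epi_from_subset[THEN subsetD, rotated]\<close>)
  ultimately have "(\<integral>x. ?t x - ?n x \<partial>lborel) = (\<integral>x. ?t x \<partial>lborel) - (\<integral>x. ?n x \<partial>lborel)"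
    by (rule Bochner_Integration.integral_diff)
  also have "(\<integral>x. ?t x \<partial>lborel) = 0"
    by (rule integral_derivative_tangential[OF f van a]) (use b True in \<open>auto simp: inner_commute\<close>)
  also have "(\<integral>x. ?n x \<partial>lborel) =
      - (\<integral>x. indicator (slab e) x * ((grad \<gamma> x \<bullet> b) * f (foot x + a *\<^sub>R e)) \<partial>lborel)"
    by (rule integral_derivative_e[OF f van a])
      (auto intro!: continuous_intros simp: grad_const_along)
  finally show ?thesis
    using True by (simp add: algebra_simps inner_diff_left)
next
  case False
  then have eb: "e = (e \<bullet> b) *\<^sub>R b" "b = (e \<bullet> b) *\<^sub>R e"
  proof -
    have "e = b \<or> e = - b"
      using axis False b inner_not_same_Basis by (metis add.inverse_inverse inner_minus_left neg_equal_0_iff_equal)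
    then show "e = (e \<bullet> b) *\<^sub>R b" "b = (e \<bullet> b) *\<^sub>R e"
      using b by auto
  qed
  have gb: "grad \<gamma> x \<bullet> b = 0" for x
    using grad_inner_e[of x] by (subst eb(2)) simp
  have "frechet_derivative f (at x) b = (e \<bullet> b) * frechet_derivative f (at x) e" if "x \<in> epi" for x
    using linear_scale[OF has_derivative_linear[OF C1_map_has_derivative[OF f that]], of "e \<bullet> b" e]
    by (simp flip: eb(2))
  then have "(\<integral>x. indicator (epi_from a) x * frechet_derivative f (at x) b \<partial>lborel) =
      (\<integral>x. indicator (epi_from a) x * ((e \<bullet> b) * frechet_derivative f (at x) e) \<partial>lborel)"
    using epi_from_subset[OF a] by (intro Bochner_Integration.integral_cong) (auto simp: indicator_def)
  also have "\<dots> = - (\<integral>x. indicator (slab e) x * ((e \<bullet> b) * f (foot x + a *\<^sub>R e)) \<partial>lborel)"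
    by (rule integral_derivative_e[OF f van a]) auto
  finally show ?thesis
    by (simp add: inner_diff_left gb mult.commute[of "e \<bullet> b"])
qed

lemma integral_divergence_epi_from:
  fixes F :: "'a \<Rightarrow> 'a"
  assumes F: "C1_map epi F" and van: "\<And>x. x \<in> epi \<Longrightarrow> x \<notin> cball 0 R \<Longrightarrow> F x = 0"
    and a: "a > 0"
  shows "(\<integral>x. indicator (epi_from a) x * divergence F x \<partial>lborel) =
    (\<integral>x. indicator (slab e) x * (F (foot x + a *\<^sub>R e) \<bullet> (grad \<gamma> x - e)) \<partial>lborel)"
proof -
  have Fb: "C1_map epi (\<lambda>x. F x \<bullet> b)" for b by (intro C1_map_inner F C1_map_const)
  have vb: "F x \<bullet> b = 0" if "x \<in> epi" "x \<notin> cball 0 R" for x b using van[OF that] by simp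
  have D: "frechet_derivative (\<lambda>x. F x \<bullet> b) (at x) h = frechet_derivative F (at x) h \<bullet> b" if "x \<in> epi" for x b h
    using has_derivative_inner_left[OF C1_map_has_derivative[OF F that], of b]
    by (metis frechet_derivative_at)
  have "(\<integral>x. indicator (epi_from a) x * divergence F x \<partial>lborel) =
      (\<integral>x. (\<Sum>b\<in>Basis. indicator (epi_from a) x * frechet_derivative (\<lambda>x. F x \<bullet> b) (at x) b) \<partial>lborel)"
    using epi_from_subset[OF a] D
    by (intro Bochner_Integration.integral_cong) (auto simp: divergence_def indicator_def intro!: sum.cong)
  also have "\<dots> = (\<Sum>b\<in>Basis. \<integral>x. indicator (epi_from a) x * frechet_derivative (\<lambda>x. F x \<bullet> b) (at x) b \<partial>lborel)"
  proof (rule Bochner_Integration.integral_sum)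
    fix b :: 'a
    have out: "frechet_derivative (\<lambda>x. F x \<bullet> b) (at x) h = 0" if "x \<in> epi" "x \<notin> cball 0 R" for x h
      using derivative_outside[OF Fb _ that] vb by blast
    show "integrable lborel (\<lambda>x. indicator (epi_from a) x * frechet_derivative (\<lambda>x. F x \<bullet> b) (at x) b)"
      by (rule integrable_on_epi_from)
        (use a in \<open>auto intro!: continuous_on_subset[OF C1_map_continuous_derivative[OF Fb] epi_from_subset]
           simp: out dest!: epi_from_subset[THEN subsetD, rotated]\<close>)
  qed
  also have "\<dots> = (\<Sum>b\<in>Basis. \<integral>x. indicator (slab e) x * ((F (foot x + a *\<^sub>R e) \<bullet> b) * ((grad \<gamma> x - e) \<bullet> b)) \<partial>lborel)"
    by (intro sum.cong refl integral_partial_derivative Fb vb a)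
  also have "\<dots> = (\<integral>x. (\<Sum>b\<in>Basis. indicator (slab e) x * ((F (foot x + a *\<^sub>R e) \<bullet> b) * ((grad \<gamma> x - e) \<bullet> b))) \<partial>lborel)"
  proof (rule Bochner_Integration.integral_sum[symmetric])
    fix b :: 'a
    have "F (foot x + a *\<^sub>R e) = 0" if "foot x + a *\<^sub>R e \<notin> cball 0 R" for x
      using that foot_shift_in[of a x] epi_from_subset[OF a] a by (intro van) auto
    then show "integrable lborel (\<lambda>x. indicator (slab e) x * ((F (foot x + a *\<^sub>R e) \<bullet> b) * ((grad \<gamma> x - e) \<bullet> b)))"
      by (intro integrable_on_slab[where a = a] continuous_intros
           continuous_on_foot_shift[OF C1_map_imp_continuous_on[OF F] a]) auto
  qed
  also have "\<dots> = (\<integral>x. indicator (slab e) x * (F (foot x + a *\<^sub>R e) \<bullet> (grad \<gamma> x - e)) \<partial>lborel)"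
    by (simp add: sum_distrib_left[symmetric] euclidean_inner[symmetric])
  finally show ?thesis .
qed

text \<open>Since \<open>F\<close> is only continuous up to the graph, its partial derivatives need not be integrable up
  to the graph; the divergence is, so the graph is approached by its translates.\<close>

theorem integral_divergence_epi:
  fixes F :: "'a \<Rightarrow> 'a"
  assumes F: "C1_map epi F" and cont: "continuous_on (epi_from 0) F"
    and van: "\<And>x. x \<in> epi_from 0 \<Longrightarrow> x \<notin> cball 0 R \<Longrightarrow> F x = 0"
    and bd: "\<And>x. x \<in> epi \<Longrightarrow> \<bar>divergence F x\<bar> \<le> C"
  shows "(\<integral>x. indicator epi x * divergence F x \<partial>lborel) =
    (\<integral>x. indicator (slab e) x * (F (foot x) \<bullet> (grad \<gamma> x - e)) \<partial>lborel)"
proof -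
  let ?a = "\<lambda>n. inverse (real (Suc n))"
  have apos: "?a n > 0" for n by simp
  have sub: "epi \<subseteq> epi_from 0" unfolding epi_def epi_from_def by auto
  have van': "F x = 0" if "x \<in> epi" "x \<notin> cball 0 R" for x using that sub van by blast
  have "compact (epi_from 0 \<inter> cball 0 R)" by (intro closed_Int_compact closed_epi_from compact_cball)
  then have "bounded (F ` (epi_from 0 \<inter> cball 0 R))"
    by (intro compact_imp_bounded compact_continuous_image continuous_on_subset[OF cont]) auto
  then obtain M where "M > 0" and M: "\<And>x. x \<in> epi_from 0 \<inter> cball 0 R \<Longrightarrow> norm (F x) \<le> M"
    unfolding bounded_pos by blast
  have M': "norm (F x) \<le> M" if "x \<in> epi_from 0" for x
    using M[of x] van[of x] that \<open>M > 0\<close> by (cases "x \<in> cball 0 R") auto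
  have in0: "foot x + a *\<^sub>R e \<in> epi_from 0" if "a \<ge> 0" for x a
    using foot_shift_in[OF that] epi_from_mono[OF that] by blast
  have dvan: "divergence F x = 0" if "x \<in> epi" "x \<notin> cball 0 R" for x
    unfolding divergence_def using derivative_outside[OF F _ that] van' by simp
  have "(\<lambda>n. \<integral>x. indicator (epi_from (?a n)) x * divergence F x \<partial>lborel) \<longlonglongrightarrow>
      (\<integral>x. indicator epi x * divergence F x \<partial>lborel)"
  proof (rule integral_dominated_convergence[where w = "\<lambda>x. indicator (cball 0 R) x *\<^sub>R \<bar>C\<bar>"])
    show "(\<lambda>x. indicator epi x * divergence F x) \<in> borel_measurable lborel"
      using borel_measurable_continuous_on_indicator[OF _ continuous_on_divergence[OF F]] by simp
    show "(\<lambda>x. indicator (epi_from (?a n)) x * divergence F x) \<in> borel_measurable lborel" for n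
      using borel_measurable_continuous_on_indicator[OF _ continuous_on_subset[OF
        continuous_on_divergence[OF F] epi_from_subset[OF apos]]] by simp
    show "integrable lborel (\<lambda>x. indicator (cball 0 R) x *\<^sub>R \<bar>C\<bar>)"
      by (rule borel_integrable_compact) auto
    show "AE x in lborel. (\<lambda>n. indicator (epi_from (?a n)) x * divergence F x) \<longlonglongrightarrow> indicator epi x * divergence F x"
    proof (rule AE_I2, rule tendsto_mult_right)
      fix x :: 'a
      show "(\<lambda>n. indicator (epi_from (?a n)) x :: real) \<longlonglongrightarrow> indicator epi x"
      proof (cases "x \<in> epi")
        case True
        then have "x \<bullet> e - \<gamma> x > 0" by (simp add: epi_def)
        then have "\<forall>\<^sub>F n in sequentially. ?a n < x \<bullet> e - \<gamma> x"
          using order_tendstoD(2)[OF LIMSEQ_inverse_real_of_nat] by blast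
        then have "\<forall>\<^sub>F n in sequentially. indicator (epi_from (?a n)) x = (indicator epi x :: real)"
          by eventually_elim (use True in \<open>auto simp: indicator_def epi_from_def\<close>)
        then show ?thesis by (rule tendsto_eventually)
      next
        case False
        then have "x \<notin> epi_from (?a n)" for n using epi_from_subset[OF apos] by blast
        then show ?thesis using False by simp
      qed
    qed
    show "AE x in lborel. norm (indicator (epi_from (?a n)) x * divergence F x) \<le> indicator (cball 0 R) x *\<^sub>R \<bar>C\<bar>" for n
    proof (rule AE_I2)
      fix x :: 'a
      have "x \<in> epi_from (?a n) \<Longrightarrow> x \<in> epi" using epi_from_subset[OF apos] by blast
      then show "norm (indicator (epi_from (?a n)) x * divergence F x) \<le> indicator (cball 0 R) x *\<^sub>R \<bar>C\<bar>"
        using bd[of x] dvan[of x] by (auto simp: indicator_def)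
    qed
  qed
  moreover have "(\<lambda>n. \<integral>x. indicator (slab e) x * (F (foot x + ?a n *\<^sub>R e) \<bullet> (grad \<gamma> x - e)) \<partial>lborel) \<longlonglongrightarrow>
      (\<integral>x. indicator (slab e) x * (F (foot x) \<bullet> (grad \<gamma> x - e)) \<partial>lborel)"
  proof (rule integral_dominated_convergence[where
        w = "\<lambda>x. indicator (cball 0 (2 * R + 1)) x *\<^sub>R (M * norm (grad \<gamma> x - e))"])
    have c: "continuous_on UNIV (\<lambda>x. F (foot x + a *\<^sub>R e) \<bullet> (grad \<gamma> x - e))" if "a \<ge> 0" for a
      by (intro continuous_intros continuous_on_compose2[OF cont] continuous_on_foot)
        (use in0[OF that] in auto)
    have m: "(\<lambda>x. indicator (slab e) x * (F (foot x + a *\<^sub>R e) \<bullet> (grad \<gamma> x - e))) \<in> borel_measurable lborel" if "a \<ge> 0" for a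
      using borel_measurable_continuous_onI[OF c[OF that]] by simp
    show "(\<lambda>x. indicator (slab e) x * (F (foot x) \<bullet> (grad \<gamma> x - e))) \<in> borel_measurable lborel"
      using m[of 0] by simp
    show "(\<lambda>x. indicator (slab e) x * (F (foot x + ?a n *\<^sub>R e) \<bullet> (grad \<gamma> x - e))) \<in> borel_measurable lborel" for n
      by (rule m) simp
    show "integrable lborel (\<lambda>x. indicator (cball 0 (2 * R + 1)) x *\<^sub>R (M * norm (grad \<gamma> x - e)))"
      by (intro borel_integrable_compact compact_cball continuous_intros)
    show "AE x in lborel. (\<lambda>n. indicator (slab e) x * (F (foot x + ?a n *\<^sub>R e) \<bullet> (grad \<gamma> x - e))) \<longlonglongrightarrow>
        indicator (slab e) x * (F (foot x) \<bullet> (grad \<gamma> x - e))"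
    proof (rule AE_I2, intro tendsto_intros)
      fix x :: 'a
      have "(\<lambda>n. foot x + ?a n *\<^sub>R e) \<longlonglongrightarrow> foot x + 0 *\<^sub>R e"
        by (intro tendsto_intros LIMSEQ_inverse_real_of_nat)
      then show "(\<lambda>n. F (foot x + ?a n *\<^sub>R e)) \<longlonglongrightarrow> F (foot x)"
        using in0[of 0 x] in0[of "?a _" x]
        by (intro continuous_on_tendsto_compose[OF cont]) (auto intro!: always_eventually)
    qed
    show "AE x in lborel. norm (indicator (slab e) x * (F (foot x + ?a n *\<^sub>R e) \<bullet> (grad \<gamma> x - e)))
        \<le> indicator (cball 0 (2 * R + 1)) x *\<^sub>R (M * norm (grad \<gamma> x - e))" for n
    proof (rule AE_I2)
      fix x :: 'a
      let ?y = "foot x + ?a n *\<^sub>R e"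
      have y: "?y \<in> epi_from 0" by (rule in0) simp
      show "norm (indicator (slab e) x * (F ?y \<bullet> (grad \<gamma> x - e)))
          \<le> indicator (cball 0 (2 * R + 1)) x *\<^sub>R (M * norm (grad \<gamma> x - e))"
      proof (cases "x \<in> slab e \<and> ?y \<in> cball 0 R")
        case True
        then have "x \<in> cball 0 (2 * R + 1)" using slab_bounded_by_foot by blast
        moreover have "\<bar>F ?y \<bullet> (grad \<gamma> x - e)\<bar> \<le> norm (F ?y) * norm (grad \<gamma> x - e)"
          by (rule Cauchy_Schwarz_ineq2)
        moreover have "norm (F ?y) * norm (grad \<gamma> x - e) \<le> M * norm (grad \<gamma> x - e)"
          by (intro mult_right_mono M' y norm_ge_zero)
        ultimately show ?thesis using True by (simp add: indicator_def)
      next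
        case False
        then have "indicator (slab e) x * (F ?y \<bullet> (grad \<gamma> x - e)) = 0"
          using van[OF y] by (auto simp: indicator_def)
        then show ?thesis using \<open>M > 0\<close> by (simp add: indicator_def)
      qed
    qed
  qed
  moreover have "(\<integral>x. indicator (epi_from (?a n)) x * divergence F x \<partial>lborel) =
      (\<integral>x. indicator (slab e) x * (F (foot x + ?a n *\<^sub>R e) \<bullet> (grad \<gamma> x - e)) \<partial>lborel)" for n
    by (rule integral_divergence_epi_from[OF F van' apos])
  ultimately show ?thesis using LIMSEQ_unique by fastforce
qed

end

subsection \<open>Area and normal of the graph\<close>

text \<open>The vector \<open>grad \<gamma> x - e\<close> is normal to the graph, points downwards and has length \<open>area_density x\<close>,
  the density of the surface area over the base. Hence a flux density against it with respect to
  volume in the slab is a flux density against the unit normal with respect to surface area.\<close>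

definition area_density :: "'a \<Rightarrow> real" where
  "area_density x = sqrt (1 + (norm (grad \<gamma> x))\<^sup>2)"

definition normal :: "'a \<Rightarrow> 'a" where
  "normal x = inverse (area_density x) *\<^sub>R (grad \<gamma> x - e)"

definition area :: "'a measure" where
  "area = distr (density lborel (\<lambda>x. ennreal (indicator (slab e) x * area_density x))) borel foot"

lemma area_density_pos: "area_density x > 0"
  unfolding area_density_def by (simp add: add_pos_nonneg)

lemma continuous_on_area_density: "continuous_on S area_density"
  unfolding area_density_def by (intro continuous_intros continuous_on_id)

lemma area_density_measurable [measurable]: "area_density \<in> borel_measurable borel"
  by (intro borel_measurable_continuous_onI continuous_on_area_density)

lemma normal_foot: "normal (foot x) = normal x"
  unfolding normal_def area_density_def by (simp add: grad_foot)

lemma norm_grad_minus_e: "norm (grad \<gamma> x - e) = area_density x"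
proof -
  have "(norm (grad \<gamma> x - e))\<^sup>2 = 1 + (norm (grad \<gamma> x))\<^sup>2"
    unfolding power2_norm_eq_inner
    by (simp add: inner_diff_left inner_diff_right grad_inner_e inner_commute[of e "grad \<gamma> x"] e_inner_e)
  then show ?thesis unfolding area_density_def by (metis norm_ge_zero real_sqrt_unique)
qed

lemma norm_normal: "norm (normal x) = 1"
  unfolding normal_def using area_density_pos[of x] by (simp add: norm_grad_minus_e)

lemma C1_normal: "C1_map S normal"
proof -
  have "C1_map {0<..} (\<lambda>s::real. inverse (sqrt s))"
    by (rule C1_map_inverse, rule C1_map_realI[where f' = "\<lambda>x. inverse (sqrt x) / 2"])
      (auto intro!: DERIV_real_sqrt continuous_intros)
  then have "C1_map S (\<lambda>x. inverse (area_density x))"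
    unfolding area_density_def power2_norm_eq_inner
    by (rule C1_map_compose) (auto intro!: C1_map_add C1_map_const C1_map_inner C1_grad simp: add_pos_nonneg)
  then show ?thesis
    unfolding normal_def by (intro C1_map_scaleR C1_map_diff C1_grad C1_map_const)
qed

lemma sets_area [measurable_cong, simp]: "sets area = sets borel" and space_area [simp]: "space area = UNIV"
  unfolding area_def by simp_all

lemma integral_area:
  fixes f :: "'a \<Rightarrow> real"
  assumes [measurable]: "f \<in> borel_measurable borel"
  shows "(\<integral>x. f x \<partial>area) = (\<integral>x. indicator (slab e) x * (area_density x * f (foot x)) \<partial>lborel)"
proof -
  have "(\<integral>x. f x \<partial>area) = (\<integral>x. f (foot x) \<partial>density lborel (\<lambda>x. ennreal (indicator (slab e) x * area_density x)))"
    unfolding area_def by (rule integral_distr) simp_all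
  also have "\<dots> = (\<integral>x. (indicator (slab e) x * area_density x) *\<^sub>R f (foot x) \<partial>lborel)"
    by (rule integral_density) (auto intro!: AE_I2 mult_nonneg_nonneg less_imp_le[OF area_density_pos])
  finally show ?thesis by (simp add: mult.assoc)
qed

lemma emeasure_area:
  assumes [measurable]: "E \<in> sets borel"
  shows "emeasure area E = graph_area e \<gamma> E"
proof -
  have "emeasure area E = emeasure (density lborel (\<lambda>x. ennreal (indicator (slab e) x * area_density x))) (foot -` E)"
    unfolding area_def by (subst emeasure_distr) auto
  also have "\<dots> = (\<integral>\<^sup>+x. ennreal (indicator (slab e) x * area_density x) * indicator (foot -` E) x \<partial>lborel)"
    by (rule emeasure_density) (use measurable_sets_borel[OF foot_measurable assms] in auto)
  also have "\<dots> = graph_area e \<gamma> E"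
    unfolding graph_area_def gradient_within_UNIV[OF differentiable]
    by (intro nn_integral_cong) (auto simp: indicator_def slab_def area_density_def foot_def)
  finally show ?thesis .
qed

lemma emeasure_area_outside_graph: "emeasure area (- graph) = 0"
proof -
  have "emeasure area (- graph) = emeasure (density lborel (\<lambda>x. ennreal (indicator (slab e) x * area_density x))) (foot -` (- graph))"
    unfolding area_def by (subst emeasure_distr) auto
  also have "foot -` (- graph) = {}" using foot_in_graph by auto
  finally show ?thesis by simp
qed

lemma emeasure_area_cball: "emeasure area (cball 0 R) < \<infinity>"
proof -
  have "emeasure area (cball 0 R) = emeasure (density lborel (\<lambda>x. ennreal (indicator (slab e) x * area_density x))) (foot -` (cball 0 R))"
    unfolding area_def by (subst emeasure_distr) auto
  also have "\<dots> = (\<integral>\<^sup>+x. ennreal (indicator (slab e) x * area_density x) * indicator (foot -` (cball 0 R)) x \<partial>lborel)"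
    by (rule emeasure_density) (use measurable_sets_borel[OF foot_measurable, of "cball 0 R"] in auto)
  also have "\<dots> \<le> (\<integral>\<^sup>+x. ennreal (indicator (cball 0 (2 * R + 1)) x *\<^sub>R area_density x) \<partial>lborel)"
    using slab_bounded_by_foot[of _ 0 R] by (intro nn_integral_mono) (auto simp: indicator_def)
  also have "\<dots> = ennreal (\<integral>x. indicator (cball 0 (2 * R + 1)) x *\<^sub>R area_density x \<partial>lborel)"
    by (intro nn_integral_eq_integral borel_integrable_compact compact_cball continuous_on_area_density)
      (auto intro!: AE_I2 mult_nonneg_nonneg less_imp_le[OF area_density_pos])
  finally show ?thesis by (simp add: le_less_trans)
qed

text \<open>The density of the area cancels the normalisation of the normal, so the boundary term is a surface
  integral.\<close>

theorem divergence_theorem_epi: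
  fixes F :: "'a \<Rightarrow> 'a"
  assumes F: "C1_map epi F" and cont: "continuous_on (epi_from 0) F"
    and van: "\<And>x. x \<in> epi_from 0 \<Longrightarrow> x \<notin> cball 0 R \<Longrightarrow> F x = 0"
    and bd: "\<And>x. x \<in> epi \<Longrightarrow> \<bar>divergence F x\<bar> \<le> C"
  shows "(\<integral>x. indicator epi x * divergence F x \<partial>lborel) = (\<integral>x. indicator graph x * (F x \<bullet> normal x) \<partial>area)"
proof -
  have sub: "graph \<subseteq> epi_from 0" unfolding graph_def epi_from_def by auto
  have "continuous_on graph (\<lambda>x. F x \<bullet> normal x)"
    by (intro continuous_intros continuous_on_subset[OF cont sub] C1_map_imp_continuous_on C1_normal)
  then have "(\<lambda>x. indicator graph x * (F x \<bullet> normal x)) \<in> borel_measurable borel"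
    using borel_measurable_continuous_on_indicator[of graph "\<lambda>x. F x \<bullet> normal x"] by simp
  then have "(\<integral>x. indicator graph x * (F x \<bullet> normal x) \<partial>area) =
      (\<integral>x. indicator (slab e) x * (area_density x * (indicator graph (foot x) * (F (foot x) \<bullet> normal (foot x)))) \<partial>lborel)"
    by (rule integral_area)
  also have "\<dots> = (\<integral>x. indicator (slab e) x * (F (foot x) \<bullet> (grad \<gamma> x - e)) \<partial>lborel)"
  proof (intro Bochner_Integration.integral_cong refl)
    fix x
    show "indicator (slab e) x * (area_density x * (indicator graph (foot x) * (F (foot x) \<bullet> normal (foot x)))) =
        indicator (slab e) x * (F (foot x) \<bullet> (grad \<gamma> x - e))"
      using area_density_pos[of x] foot_in_graph[of x]
      by (simp add: normal_foot) (simp add: normal_def)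
  qed
  finally show ?thesis using integral_divergence_epi[OF assms] by simp
qed

end

section \<open>Local geometry of the boundary\<close>

lemma has_derivative_at_within_direction:
  fixes f :: "'a::real_normed_vector \<Rightarrow> 'b::real_normed_vector"
  assumes "(f has_derivative D) (at x within S)" and S: "\<And>s. 0 \<le> s \<Longrightarrow> s \<le> d \<Longrightarrow> x + s *\<^sub>R v \<in> S"
  shows "((\<lambda>s. f (x + s *\<^sub>R v)) has_vector_derivative D v) (at 0 within {0..d})"
proof -
  have "((\<lambda>s. x + s *\<^sub>R v) has_derivative (\<lambda>s. s *\<^sub>R v)) (at 0 within {0..d})"
    by (auto intro!: derivative_eq_intros)
  moreover have "(f has_derivative D) (at (x + 0 *\<^sub>R v) within (\<lambda>s. x + s *\<^sub>R v) ` {0..d})"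
    unfolding scaleR_zero_left add_0_right by (rule has_derivative_subset[OF assms(1)]) (use S in auto)
  ultimately have "((\<lambda>s. f (x + s *\<^sub>R v)) has_derivative (\<lambda>s. D (s *\<^sub>R v))) (at 0 within {0..d})"
    by (rule has_derivative_in_compose)
  then show ?thesis
    using linear_scale[OF has_derivative_linear[OF assms(1)]] by (simp add: has_vector_derivative_def)
qed

text \<open>At a boundary point, a derivative within a set is determined along those directions that enter
  the set.\<close>

lemma has_derivative_unique_direction:
  fixes f :: "'a::real_normed_vector \<Rightarrow> 'b::real_normed_vector"
  assumes "(f has_derivative D) (at x within S)" "(f has_derivative D') (at x within S)"
    and S: "x \<in> S" "\<forall>\<^sub>F s in at_right 0. x + s *\<^sub>R v \<in> S"
  shows "D v = D' v"
proof -
  obtain d where d: "d > 0" "\<And>s. 0 < s \<Longrightarrow> s < d \<Longrightarrow> x + s *\<^sub>R v \<in> S"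
    using S(2) unfolding eventually_at_right_field by auto
  have S': "x + s *\<^sub>R v \<in> S" if "0 \<le> s" "s \<le> d / 2" for s
    using d S(1) that by (cases "s = 0") auto
  \<comment> \<open>Half of \<open>d\<close>, because the line is known to lie in \<open>S\<close> only for times strictly below \<open>d\<close>.\<close>
  have "at (0::real) within {0..d / 2} \<noteq> bot"
    using d(1) by (subst at_within_Icc_at_right) auto
  then show ?thesis
    by (rule vector_derivative_unique_within[OF _ has_derivative_at_within_direction[OF assms(1) S']
        has_derivative_at_within_direction[OF assms(2) S']])
qed

context C2_graph
begin

lemma height_has_derivative:
  "((\<lambda>s. (x + s *\<^sub>R v) \<bullet> e - \<gamma> (x + s *\<^sub>R v)) has_real_derivative - (v \<bullet> (grad \<gamma> x - e))) (at 0)"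
proof -
  have "((\<lambda>s. \<gamma> (x + s *\<^sub>R v)) has_derivative (\<lambda>h. grad \<gamma> (x + 0 *\<^sub>R v) \<bullet> (h *\<^sub>R v))) (at 0)"
    by (rule has_derivative_compose[where f = "\<lambda>s. x + s *\<^sub>R v"])
      (auto intro!: derivative_eq_intros has_derivative_gamma)
  then have g: "((\<lambda>s. \<gamma> (x + s *\<^sub>R v)) has_derivative (\<lambda>h. h * (grad \<gamma> x \<bullet> v))) (at 0)" by simp
  have "((\<lambda>s. (x + s *\<^sub>R v) \<bullet> e - \<gamma> (x + s *\<^sub>R v)) has_derivative
      (\<lambda>h. h * (v \<bullet> e) - h * (grad \<gamma> x \<bullet> v))) (at 0)"
    by (intro has_derivative_diff g) (auto intro!: derivative_eq_intros)
  moreover have "(\<lambda>h. h * (v \<bullet> e) - h * (grad \<gamma> x \<bullet> v)) = (*) (- (v \<bullet> (grad \<gamma> x - e)))"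
    by (auto simp: fun_eq_iff inner_diff_right inner_commute[of v] algebra_simps)
  ultimately show ?thesis by (simp add: has_field_derivative_def)
qed

lemma eventually_in_epi:
  assumes "x \<in> graph" "v \<bullet> (grad \<gamma> x - e) < 0"
  shows "\<forall>\<^sub>F s in at_right 0. x + s *\<^sub>R v \<in> epi"
proof -
  obtain d where "d > 0" and d: "\<And>h. 0 < h \<Longrightarrow> h < d \<Longrightarrow>
      x \<bullet> e - \<gamma> x < (x + h *\<^sub>R v) \<bullet> e - \<gamma> (x + h *\<^sub>R v)"
    using has_real_derivative_pos_inc_right[OF height_has_derivative[of x v]] assms(2) by auto
  have "x + s *\<^sub>R v \<in> epi" if "0 < s" "s < d" for s
    using d[OF that] assms(1) by (simp add: graph_def epi_def)
  then show ?thesis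
    unfolding eventually_at_right_field using \<open>d > 0\<close> by auto
qed

lemma eventually_below_graph:
  assumes "x \<in> graph" "v \<bullet> (grad \<gamma> x - e) > 0"
  shows "\<forall>\<^sub>F s in at_right 0. x + s *\<^sub>R v \<notin> epi_from 0"
proof -
  obtain d where "d > 0" and d: "\<And>h. 0 < h \<Longrightarrow> h < d \<Longrightarrow>
      x \<bullet> e - \<gamma> x > (x + h *\<^sub>R v) \<bullet> e - \<gamma> (x + h *\<^sub>R v)"
    using has_real_derivative_neg_dec_right[OF height_has_derivative[of x v]] assms(2) by auto
  have "x + s *\<^sub>R v \<notin> epi_from 0" if "0 < s" "s < d" for s
    using d[OF that] assms(1) by (simp add: graph_def epi_from_def)
  then show ?thesis
    unfolding eventually_at_right_field using \<open>d > 0\<close> by auto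
qed

lemma normal_sign: "v \<bullet> normal x > 0 \<longleftrightarrow> v \<bullet> (grad \<gamma> x - e) > 0"
  "v \<bullet> normal x < 0 \<longleftrightarrow> v \<bullet> (grad \<gamma> x - e) < 0"
  "v \<bullet> normal x = 0 \<longleftrightarrow> v \<bullet> (grad \<gamma> x - e) = 0"
  using area_density_pos[of x] unfolding normal_def
  by (auto simp: zero_less_mult_iff mult_less_0_iff)

lemma normal_inner_e_neg: "e \<bullet> normal x < 0"
  unfolding normal_sign by (simp add: inner_diff_right inner_commute[of e "grad \<gamma> x"] grad_inner_e e_inner_e)

text \<open>Near a point of the graph, a line in a tangent direction is pushed back into the graph by
  \<open>foot\<close> without changing its velocity.\<close>

lemma foot_line_has_derivative:
  assumes "x \<in> graph" "v \<bullet> normal x = 0"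
  shows "((\<lambda>s. foot (x + s *\<^sub>R v)) has_vector_derivative v) (at 0)"
proof -
  have "((\<lambda>s. - ((x + s *\<^sub>R v) \<bullet> e - \<gamma> (x + s *\<^sub>R v))) has_real_derivative 0) (at 0)"
    using DERIV_minus[OF height_has_derivative[of x v]] assms(2) by (simp add: normal_sign)
  then have "((\<lambda>s. \<gamma> (x + s *\<^sub>R v) - (x + s *\<^sub>R v) \<bullet> e) has_derivative (*) 0) (at 0)"
    by (simp add: has_field_derivative_def)
  then have "((\<lambda>s. (\<gamma> (x + s *\<^sub>R v) - (x + s *\<^sub>R v) \<bullet> e) *\<^sub>R e) has_vector_derivative 0 *\<^sub>R e) (at 0)"
    unfolding has_vector_derivative_def by (rule has_derivative_eq_rhs[OF has_derivative_scaleR_left]) simp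
  moreover have "((\<lambda>s. x + s *\<^sub>R v) has_vector_derivative v) (at 0)"
    by (auto intro!: derivative_eq_intros)
  ultimately have "((\<lambda>s. x + s *\<^sub>R v + (\<gamma> (x + s *\<^sub>R v) - (x + s *\<^sub>R v) \<bullet> e) *\<^sub>R e) has_vector_derivative v + 0 *\<^sub>R e) (at 0)"
    by (intro has_vector_derivative_add)
  then show ?thesis unfolding foot_def by simp
qed

end

locale chart = C2_graph +
  fixes U :: "'a set" and z :: 'a and r :: real
  assumes r_pos: "r > 0" and open_U: "open U"
    and local_epigraph: "U \<inter> ball z r = {x \<in> ball z r. \<gamma> x < x \<bullet> e}"
begin

lemma in_U_iff:
  assumes "x \<in> ball z r" shows "x \<in> U \<longleftrightarrow> x \<in> epi"
proof -
  have "x \<in> U \<inter> ball z r \<longleftrightarrow> x \<in> {x \<in> ball z r. \<gamma> x < x \<bullet> e}" by (simp only: local_epigraph)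
  then show ?thesis using assms by (simp add: epi_def)
qed

lemma in_closure_iff:
  assumes x: "x \<in> ball z r"
  shows "x \<in> closure U \<longleftrightarrow> x \<in> epi_from 0"
proof
  assume "x \<in> closure U"
  then have "x \<in> closure (ball z r \<inter> U)"
    using open_Int_closure_subset[OF open_ball, of z r U] x by blast
  also have "closure (ball z r \<inter> U) \<subseteq> epi_from 0"
    by (rule closure_minimal[OF _ closed_epi_from]) (auto simp: in_U_iff epi_def epi_from_def)
  finally show "x \<in> epi_from 0" .
next
  assume x0: "x \<in> epi_from 0"
  have lim: "(\<lambda>n. x + inverse (real (Suc n)) *\<^sub>R e) \<longlonglongrightarrow> x + 0 *\<^sub>R e"
    by (intro tendsto_intros LIMSEQ_inverse_real_of_nat)
  then have "\<forall>\<^sub>F n in sequentially. x + inverse (real (Suc n)) *\<^sub>R e \<in> ball z r"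
    by (intro topological_tendstoD[OF lim open_ball]) (use x in simp)
  then have "\<forall>\<^sub>F n in sequentially. x + inverse (real (Suc n)) *\<^sub>R e \<in> closure U"
  proof eventually_elim
    case (elim n)
    have "x + inverse (real (Suc n)) *\<^sub>R e \<in> epi"
    proof -
      have "inverse (real (Suc n)) > 0" by simp
      then show ?thesis
        using x0 unfolding epi_from_def epi_def mem_Collect_eq const_along inner_add_left inner_scaleR_left e_inner_e
        by linarith
    qed
    then show ?case using in_U_iff[OF elim] closure_subset by blast
  qed
  then show "x \<in> closure U"
    using Lim_in_closed_set[OF closed_closure _ sequentially_bot lim] by simp
qed

lemma in_frontier_iff:
  assumes "x \<in> ball z r" shows "x \<in> frontier U \<longleftrightarrow> x \<in> graph"
  unfolding frontier_def interior_open[OF open_U] Diff_iff in_closure_iff[OF assms] in_U_iff[OF assms]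
  by (auto simp: epi_def epi_from_def graph_def)

lemma eventually_in_ball:
  assumes "x \<in> ball z r" shows "\<forall>\<^sub>F s in at_right 0. x + s *\<^sub>R v \<in> ball z r"
proof -
  have lim: "((\<lambda>s. x + s *\<^sub>R v) \<longlongrightarrow> x + 0 *\<^sub>R v) (at_right 0)"
    by (intro tendsto_intros)
  show ?thesis by (rule topological_tendstoD[OF lim open_ball]) (use assms in simp)
qed

lemma eventually_into_U:
  assumes "x \<in> frontier U" "x \<in> ball z r" "v \<bullet> normal x < 0"
  shows "\<forall>\<^sub>F s in at_right 0. x + s *\<^sub>R v \<in> U"
proof -
  have "\<forall>\<^sub>F s in at_right 0. x + s *\<^sub>R v \<in> epi"
    using assms in_frontier_iff normal_sign(2) by (intro eventually_in_epi) auto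
  then show ?thesis
    using eventually_in_ball[OF assms(2), of v] by eventually_elim (simp add: in_U_iff)
qed

lemma eventually_out_of_closure:
  assumes "x \<in> frontier U" "x \<in> ball z r" "v \<bullet> normal x > 0"
  shows "\<forall>\<^sub>F s in at_right 0. x + s *\<^sub>R v \<notin> closure U"
proof -
  have "\<forall>\<^sub>F s in at_right 0. x + s *\<^sub>R v \<notin> epi_from 0"
    using assms in_frontier_iff normal_sign(1) by (intro eventually_below_graph) auto
  then show ?thesis
    using eventually_in_ball[OF assms(2), of v] by eventually_elim (simp add: in_closure_iff)
qed

text \<open>The directions pointing into \<open>U\<close> form an open half-space, so they span the whole space.\<close>

lemma derivative_unique_at_frontier:
  fixes f :: "'a \<Rightarrow> 'b::real_normed_vector"
  assumes x: "x \<in> frontier U" "x \<in> ball z r"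
    and D: "(f has_derivative D) (at x within closure U)" "(f has_derivative D') (at x within closure U)"
  shows "D = D'"
proof
  have xc: "x \<in> closure U" using x by (simp add: frontier_def)
  have eq: "D v = D' v" if "v \<bullet> normal x < 0" for v
  proof -
    have "\<forall>\<^sub>F s in at_right 0. x + s *\<^sub>R v \<in> closure U"
      by (rule eventually_mono[OF eventually_into_U[OF x that]]) (use closure_subset in blast)
    then show ?thesis by (rule has_derivative_unique_direction[OF D xc])
  qed
  note lin = has_derivative_linear[OF D(1)] has_derivative_linear[OF D(2)]
  fix h
  \<comment> \<open>Adding a large multiple of \<open>e\<close> makes any vector point into \<open>U\<close>.\<close>
  define k where "k = (\<bar>h \<bullet> normal x\<bar> + 1) / - (e \<bullet> normal x)"
  have "(h + k *\<^sub>R e) \<bullet> normal x = h \<bullet> normal x - (\<bar>h \<bullet> normal x\<bar> + 1)"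
    unfolding k_def using normal_inner_e_neg[of x]
    by (simp add: inner_add_left inner_diff_left)
  then have "D (h + k *\<^sub>R e) = D' (h + k *\<^sub>R e)" by (intro eq) linarith
  moreover have "D e = D' e" by (intro eq normal_inner_e_neg)
  ultimately show "D h = D' h"
    by (simp add: linear_add[OF lin(1)] linear_add[OF lin(2)] linear_scale[OF lin(1)] linear_scale[OF lin(2)])
qed

lemma tangent_iff:
  assumes x: "x \<in> frontier U" "x \<in> ball z r"
  shows "tangent_vector (frontier U) x v \<longleftrightarrow> v \<bullet> normal x = 0"
proof
  have xg: "x \<in> graph" using x in_frontier_iff by blast
  assume "tangent_vector (frontier U) x v"
  then obtain c where c: "c 0 = x" "\<forall>\<^sub>F s in nhds 0. c s \<in> frontier U" "(c has_vector_derivative v) (at 0)"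
    unfolding tangent_vector_def by blast
  have cd: "(c has_derivative (\<lambda>h. h *\<^sub>R v)) (at 0)" using c(3) by (simp add: has_vector_derivative_def)
  have "isCont c 0" by (rule has_derivative_continuous[OF cd])
  then have "(c \<longlongrightarrow> c 0) (nhds 0)" by (simp add: continuous_at tendsto_nhds_iff)
  then have "\<forall>\<^sub>F s in nhds 0. c s \<in> ball z r"
    by (rule topological_tendstoD) (use x c(1) in auto)
  then have ev: "\<forall>\<^sub>F s in nhds 0. c s \<bullet> e - \<gamma> (c s) = 0"
    using c(2) by eventually_elim (use in_frontier_iff in \<open>auto simp: graph_def\<close>)
  have "((\<lambda>s. \<gamma> (c s)) has_derivative (\<lambda>h. grad \<gamma> (c 0) \<bullet> (h *\<^sub>R v))) (at 0)"
    by (rule has_derivative_compose[OF cd has_derivative_gamma])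
  then have "((\<lambda>s. c s \<bullet> e - \<gamma> (c s)) has_derivative (\<lambda>h. h *\<^sub>R v \<bullet> e - grad \<gamma> (c 0) \<bullet> (h *\<^sub>R v))) (at 0)"
    by (intro has_derivative_diff has_derivative_inner_left cd)
  moreover have "((\<lambda>s. c s \<bullet> e - \<gamma> (c s)) has_derivative (\<lambda>h. 0)) (at 0)"
    using has_derivative_transform_eventually[of "\<lambda>_. 0" "\<lambda>_. 0" "0::real" UNIV "\<lambda>s. c s \<bullet> e - \<gamma> (c s)"]
      eventually_nhds_x_imp_x[OF ev] eventually_nhds_conv_at[THEN iffD1, OF ev] by (auto elim: eventually_mono)
  ultimately have "(\<lambda>h. h *\<^sub>R v \<bullet> e - grad \<gamma> (c 0) \<bullet> (h *\<^sub>R v)) = (\<lambda>h. 0)"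
    by (rule has_derivative_unique)
  then have "1 *\<^sub>R v \<bullet> e - grad \<gamma> (c 0) \<bullet> (1 *\<^sub>R v) = 0" by metis
  then show "v \<bullet> normal x = 0"
    by (simp add: normal_sign c(1) inner_diff_right inner_commute[of v "grad \<gamma> x"])
next
  have xg: "x \<in> graph" using x in_frontier_iff by blast
  assume v: "v \<bullet> normal x = 0"
  let ?c = "\<lambda>s. foot (x + s *\<^sub>R v)"
  have "continuous_on UNIV ?c"
    by (rule continuous_on_compose2[OF continuous_on_foot[of UNIV]]) (auto intro!: continuous_intros)
  then have "(?c \<longlongrightarrow> ?c 0) (nhds 0)"
    by (metis UNIV_I continuous_at continuous_on_eq_continuous_at open_UNIV tendsto_nhds_iff)
  then have "\<forall>\<^sub>F s in nhds 0. ?c s \<in> ball z r"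
    by (rule topological_tendstoD) (use x foot_eq[OF xg] in auto)
  then have "\<forall>\<^sub>F s in nhds 0. ?c s \<in> frontier U"
    by eventually_elim (simp add: in_frontier_iff foot_in_graph)
  then show "tangent_vector (frontier U) x v"
    unfolding tangent_vector_def using foot_line_has_derivative[OF xg v] foot_eq[OF xg]
    by (intro exI[of _ ?c]) auto
qed

text \<open>The tangent vectors form the hyperplane orthogonal to \<open>normal x\<close>, which leaves \<open>normal x\<close> and its
  opposite as candidates; the opposite points into \<open>U\<close>.\<close>

lemma outward_normal_eq:
  assumes x: "x \<in> frontier U" "x \<in> ball z r"
  shows "outward_normal U x = normal x"
  unfolding outward_normal_def tangent_iff[OF x]
proof (rule the_equality)
  have "normal x \<bullet> normal x = 1" using norm_normal[of x] by (simp add: norm_eq_1)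
  then show "norm (normal x) = 1 \<and> (\<forall>v. v \<bullet> normal x = 0 \<longrightarrow> v \<bullet> normal x = 0) \<and>
      (\<forall>\<^sub>F s in at_right 0. x + s *\<^sub>R normal x \<notin> closure U)"
    using norm_normal eventually_out_of_closure[OF x] by simp
next
  fix n assume n: "norm n = 1 \<and> (\<forall>v. v \<bullet> normal x = 0 \<longrightarrow> v \<bullet> n = 0) \<and>
      (\<forall>\<^sub>F s in at_right 0. x + s *\<^sub>R n \<notin> closure U)"
  have nn: "normal x \<bullet> normal x = 1" using norm_normal[of x] by (simp add: norm_eq_1)
  define k where "k = n \<bullet> normal x"
  define w where "w = n - k *\<^sub>R normal x"
  have w0: "w \<bullet> normal x = 0" unfolding w_def k_def by (simp add: inner_diff_left nn)
  then have "w \<bullet> n = 0" using n by blast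
  then have "w \<bullet> w = 0" using w0 by (simp add: w_def inner_diff_right)
  then have nk: "n = k *\<^sub>R normal x" by (simp add: w_def)
  then have "\<bar>k\<bar> = 1" using n by (simp add: norm_normal)
  moreover have "\<not> k < 0"
  proof
    assume "k < 0"
    then have "\<forall>\<^sub>F s in at_right 0. x + s *\<^sub>R n \<in> U"
      by (intro eventually_into_U[OF x]) (simp add: k_def)
    moreover have "\<forall>\<^sub>F s in at_right 0. x + s *\<^sub>R n \<notin> closure U" using n by blast
    ultimately have "\<forall>\<^sub>F s in at_right (0::real). False"
      by eventually_elim (use closure_subset in blast)
    then show False by (simp add: trivial_limit_at_right_real)
  qed
  ultimately show "n = normal x" using nk by simp
qed

end

lemma graph_chart_imp_chart:
  assumes "open U" "graph_chart U z r e \<gamma>" shows "chart e \<gamma> U z r"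
  using assms unfolding graph_chart_def by unfold_locales auto

text \<open>Inside \<open>U\<close> a constant graph below the ball serves as a chart, so interior points and boundary
  points can be treated alike.\<close>

lemma ex_graph_chart:
  fixes U :: "'a::euclidean_space set"
  assumes "open U" "C2_boundary U" "z \<in> closure U"
  obtains r e \<gamma> where "graph_chart U z r e \<gamma>"
proof (cases "z \<in> U")
  case True
  then obtain r where r: "r > 0" "ball z r \<subseteq> U" using assms(1) openE by blast
  obtain e :: 'a where e: "e \<in> Basis" using nonempty_Basis by blast
  have "C1_map UNIV (\<lambda>x::'a. c)" for c :: real by (rule C1_map_const)
  moreover have "frechet_derivative (\<lambda>x::'a. c) (at x) = (\<lambda>_. 0)" for c :: real and x
    by simp
  ultimately have "C2_on UNIV (\<lambda>x::'a. z \<bullet> e - r)"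
    unfolding C2_on_def C1_on_iff_C1_map by simp
  moreover have "z \<bullet> e - r < x \<bullet> e" if "x \<in> ball z r" for x
  proof -
    have "\<bar>(z - x) \<bullet> e\<bar> \<le> norm (z - x)" using e by (simp add: Basis_le_norm)
    then show ?thesis using that by (simp add: dist_norm inner_diff_left)
  qed
  ultimately have "graph_chart U z r e (\<lambda>x. z \<bullet> e - r)"
    unfolding graph_chart_def using r e by auto
  then show thesis by (rule that)
next
  case False
  then have "z \<in> frontier U" using assms by (simp add: frontier_def interior_open)
  then show thesis using assms(2) that unfolding C2_boundary_def by blast
qed

section \<open>The surface measure\<close>

text \<open>The indicator of a closed set is a bounded limit of continuous functions of the distance to it.\<close>

lemma finite_borel_measure_eqI:
  fixes M N :: "'a::euclidean_space measure"
  assumes M: "finite_measure M" "sets M = sets borel" and N: "finite_measure N" "sets N = sets borel"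
    and eq: "\<And>f::'a \<Rightarrow> real. continuous_on UNIV f \<Longrightarrow> bounded (range f) \<Longrightarrow> (\<integral>x. f x \<partial>M) = (\<integral>x. f x \<partial>N)"
  shows "M = N"
proof (rule measure_eqI_generator_eq[where E = "Collect closed" and \<Omega> = UNIV and A = "\<lambda>_. UNIV"])
  show "Int_stable (Collect closed :: 'a set set)" by (auto simp: Int_stable_def)
  have "sets (borel :: 'a measure) = sigma_sets UNIV (Collect closed)"
    by (subst borel_eq_closed) simp
  then show "sets M = sigma_sets UNIV (Collect closed)" "sets N = sigma_sets UNIV (Collect closed)"
    using M N by auto
  show "emeasure M UNIV \<noteq> \<infinity>" using M finite_measure.emeasure_finite by fastforce
  fix C :: "'a set" assume "C \<in> Collect closed"
  then have C: "closed C" by simp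
  show "emeasure M C = emeasure N C"
  proof (cases "C = {}")
    case False
    define f where "f n x = max 0 (1 - real n * infdist x C)" for n x
    have fc: "continuous_on UNIV (f n)" for n
      unfolding f_def by (intro continuous_intros)
    have f01: "0 \<le> f n x" "f n x \<le> 1" for n x
      unfolding f_def by (auto simp: infdist_nonneg)
    have fb: "bounded (range (f n))" for n
      unfolding bounded_iff using f01 by (intro exI[of _ 1]) auto
    have lim: "(\<lambda>n. f n x) \<longlonglongrightarrow> indicator C x" for x
    proof (cases "x \<in> C")
      case True
      then show ?thesis by (simp add: f_def)
    next
      case notin: False
      then have "infdist x C > 0"
        using C False in_closed_iff_infdist_zero infdist_nonneg[of x C] by (metis less_eq_real_def)
      then obtain k where k: "1 < real k * infdist x C" using reals_Archimedean3 by blast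
      have "f n x = 0" if "n \<ge> k" for n
      proof -
        have "real k * infdist x C \<le> real n * infdist x C"
          using that by (intro mult_right_mono infdist_nonneg) simp
        then show ?thesis using k unfolding f_def by simp
      qed
      then have "\<forall>\<^sub>F n in sequentially. f n x = 0" unfolding eventually_sequentially by blast
      then show ?thesis using notin by (simp add: tendsto_eventually)
    qed
    have conv: "(\<lambda>n. \<integral>x. f n x \<partial>K) \<longlonglongrightarrow> measure K C"
      if K: "finite_measure K" "sets K = sets borel" for K :: "'a measure"
    proof -
      interpret finite_measure K by fact
      note [measurable_cong] = K(2)
      have [measurable]: "C \<in> sets borel" using C by simp
      have [measurable]: "f n \<in> borel_measurable borel" for n
        by (rule borel_measurable_continuous_onI[OF fc])
      have "(\<lambda>n. \<integral>x. f n x \<partial>K) \<longlonglongrightarrow> (\<integral>x. indicator C x \<partial>K)"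
        by (rule integral_dominated_convergence[where w = "\<lambda>_. 1"]) (use lim f01 in auto)
      moreover have "C \<in> sets K" using C K(2) by simp
      ultimately show ?thesis using sets.sets_into_space[of C K] by (simp add: Int_absorb2)
    qed
    have "measure M C = measure N C"
      using conv[OF M] conv[OF N] eq[OF fc fb] LIMSEQ_unique by simp
    then show ?thesis
      using M(1) N(1) by (simp add: finite_measure.emeasure_eq_measure)
  qed simp
qed auto

text \<open>A zero of a nonnegative function is a minimum. Consequently a multiple of a product of bump
  functions has divergence \<open>0\<close> wherever the product vanishes, the edges of the balls included.\<close>

lemma grad_eq_0_at_zero_of_nonneg:
  fixes f :: "'a::euclidean_space \<Rightarrow> real"
  assumes "f differentiable at x" "\<And>y. f y \<ge> 0" "f x = 0"
  shows "grad f x = 0"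
proof -
  have "(\<lambda>h. grad f x \<bullet> h) = (\<lambda>h. 0)"
    by (rule differential_zero_maxmin[of x UNIV f, OF _ _ has_derivative_grad[OF assms(1)]])
      (use assms in auto)
  then show ?thesis by (metis inner_eq_zero_iff)
qed

context C2_graph
begin

lemma integrable_area:
  fixes g :: "'a \<Rightarrow> real"
  assumes g: "continuous_on UNIV g" and van: "\<And>x. x \<notin> cball z R \<Longrightarrow> g x = 0"
  shows "integrable area g"
proof -
  have "bounded (g ` cball z R)"
    by (intro compact_imp_bounded compact_continuous_image continuous_on_subset[OF g]) auto
  then obtain B where B: "\<And>x. x \<in> cball z R \<Longrightarrow> \<bar>g x\<bar> \<le> B"
    unfolding bounded_iff by (metis imageI real_norm_def)
  have "cball z R \<subseteq> cball 0 (norm z + R)"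
    by (auto simp: dist_norm) (metis add_left_mono norm_minus_commute norm_triangle_sub order_trans)
  then have "emeasure area (cball z R) \<le> emeasure area (cball 0 (norm z + R))"
    by (intro emeasure_mono) auto
  then have "emeasure area (cball z R) < \<infinity>"
    using emeasure_area_cball le_less_trans by blast
  moreover have "g \<in> borel_measurable area"
    using borel_measurable_continuous_onI[OF g] by simp
  ultimately show ?thesis
    by (intro integrableI_bounded_set[of "cball z R" _ _ B]) (use B van in auto)
qed

lemma AE_area_graph: "AE x in area. x \<in> graph"
  by (rule AE_I[of _ _ "- graph"]) (use emeasure_area_outside_graph in auto)

end

context chart
begin

lemma divergence_theorem_smooth:
  fixes G :: "'a \<Rightarrow> 'a"
  assumes G: "C1_map UNIV G"
    and van: "\<And>x. x \<notin> ball z r \<Longrightarrow> G x = 0" "\<And>x. x \<notin> ball z r \<Longrightarrow> divergence G x = 0"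
  shows "(\<integral>x. indicator U x * divergence G x \<partial>lborel) = (\<integral>x. G x \<bullet> normal x \<partial>area)"
proof -
  have c: "continuous_on UNIV (divergence G)" by (rule continuous_on_divergence[OF G])
  have "bounded (divergence G ` cball z r)"
    by (intro compact_imp_bounded compact_continuous_image continuous_on_subset[OF c]) auto
  then obtain C where C: "C > 0" "\<And>x. x \<in> cball z r \<Longrightarrow> \<bar>divergence G x\<bar> \<le> C"
    unfolding bounded_pos by auto
  have bd: "\<bar>divergence G x\<bar> \<le> C" for x
    using C(2)[of x] van(2)[of x] C(1) by (cases "x \<in> ball z r") auto
  have sub: "x \<in> cball 0 (norm z + r)" if "x \<in> ball z r" for x
    using that norm_triangle_sub[of x z] by (auto simp: dist_norm norm_minus_commute)
  have "(\<integral>x. indicator U x * divergence G x \<partial>lborel) = (\<integral>x. indicator epi x * divergence G x \<partial>lborel)"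
    using van(2) in_U_iff by (intro Bochner_Integration.integral_cong) (auto simp: indicator_def)
  also have "\<dots> = (\<integral>x. indicator graph x * (G x \<bullet> normal x) \<partial>area)"
    by (rule divergence_theorem_epi[OF C1_map_subset[OF G] continuous_on_subset[OF C1_map_imp_continuous_on[OF G]],
          where R = "norm z + r" and C = C])
      (use bd van(1) sub in auto)
  also have "\<dots> = (\<integral>x. G x \<bullet> normal x \<partial>area)"
  proof (rule integral_cong_AE)
    have "continuous_on UNIV (\<lambda>x. G x \<bullet> normal x)"
      by (intro continuous_intros C1_map_imp_continuous_on G C1_normal)
    then have [measurable]: "(\<lambda>x. G x \<bullet> normal x) \<in> borel_measurable borel"
      by (rule borel_measurable_continuous_onI)
    show "(\<lambda>x. G x \<bullet> normal x) \<in> borel_measurable area"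
      "(\<lambda>x. indicator graph x * (G x \<bullet> normal x)) \<in> borel_measurable area" by simp_all
  qed (use AE_area_graph in \<open>auto elim: eventually_mono\<close>)
  finally show ?thesis .
qed

end

text \<open>For a test function \<open>g\<close> supported in both balls, the integral of \<open>g\<close> over the graph is the flux
  of \<open>g\<close> times the normal, so the divergence theorem writes it as an integral over \<open>U\<close>, in which no
  chart occurs. This replaces the change of variables between two graph representations.\<close>

lemma integral_area_eq:
  fixes q :: "'a::euclidean_space \<Rightarrow> real"
  assumes c1: "chart e1 \<gamma>1 U z1 r1" and c2: "chart e2 \<gamma>2 U z2 r2" and q: "C1_map UNIV q"
  shows "(\<integral>x. q x * (bump z1 r1 x * bump z2 r2 x) \<partial>C2_graph.area e1 \<gamma>1) =
    (\<integral>x. q x * (bump z1 r1 x * bump z2 r2 x) \<partial>C2_graph.area e2 \<gamma>2)"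
proof -
  interpret c1: chart e1 \<gamma>1 U z1 r1 by fact
  interpret c2: chart e2 \<gamma>2 U z2 r2 by fact
  define \<eta> where "\<eta> x = bump z1 r1 x * bump z2 r2 x" for x
  \<comment> \<open>The normal of the first chart is defined off the graph as well and is continuously differentiable
    because the boundary is \<open>C\<^sup>2\<close>.\<close>
  define G where "G x = \<eta> x *\<^sub>R (q x *\<^sub>R c1.normal x)" for x
  have \<eta>: "C1_map UNIV \<eta>" unfolding \<eta>_def by (intro C1_map_mult C1_map_bump)
  have qn: "C1_map UNIV (\<lambda>x. q x *\<^sub>R c1.normal x)" by (intro C1_map_scaleR q c1.C1_normal)
  have G: "C1_map UNIV G" unfolding G_def by (intro C1_map_scaleR \<eta> qn)
  have \<eta>0: "\<eta> x = 0" if "x \<notin> ball z1 r1 \<or> x \<notin> ball z2 r2" for x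
    using that bump_eq_0[OF c1.r_pos] bump_eq_0[OF c2.r_pos] unfolding \<eta>_def by auto
  have \<eta>nn: "\<eta> x \<ge> 0" for x unfolding \<eta>_def by (simp add: bump_nonneg)
  have div0: "divergence G x = 0" if "\<eta> x = 0" for x
  proof -
    have "grad \<eta> x = 0"
      by (rule grad_eq_0_at_zero_of_nonneg) (use \<eta>nn that C1_map_differentiable[OF \<eta>] in auto)
    then show ?thesis
      unfolding G_def by (subst divergence_scaleR)
        (use that C1_map_differentiable[OF \<eta>] C1_map_differentiable[OF qn] in auto)
  qed
  have nn: "c1.normal x \<bullet> c1.normal x = 1" for x using c1.norm_normal[of x] by (simp add: norm_eq_1)
  have "(\<integral>x. q x * \<eta> x \<partial>c1.area) = (\<integral>x. G x \<bullet> c1.normal x \<partial>c1.area)"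
    unfolding G_def by (simp add: nn mult.commute)
  also have "\<dots> = (\<integral>x. indicator U x * divergence G x \<partial>lborel)"
    by (rule c1.divergence_theorem_smooth[symmetric, OF G]) (auto simp: G_def \<eta>0 intro!: div0)
  also have "\<dots> = (\<integral>x. G x \<bullet> c2.normal x \<partial>c2.area)"
    by (rule c2.divergence_theorem_smooth[OF G]) (auto simp: G_def \<eta>0 intro!: div0)
  also have "\<dots> = (\<integral>x. q x * \<eta> x \<partial>c2.area)"
  proof (rule integral_cong_AE)
    have "continuous_on UNIV (\<lambda>x. G x \<bullet> c2.normal x)" "continuous_on UNIV (\<lambda>x. q x * \<eta> x)"
      by (intro continuous_intros C1_map_imp_continuous_on G c2.C1_normal q \<eta>)+
    then show "(\<lambda>x. G x \<bullet> c2.normal x) \<in> borel_measurable c2.area"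
      "(\<lambda>x. q x * \<eta> x) \<in> borel_measurable c2.area"
      by (simp_all add: borel_measurable_continuous_onI cong: measurable_cong_sets)
    have "G x \<bullet> c2.normal x = q x * \<eta> x" if x: "x \<in> c2.graph" for x
    proof (cases "\<eta> x = 0")
      case False
      then have b: "x \<in> ball z1 r1" "x \<in> ball z2 r2" using \<eta>0 by auto
      then have "x \<in> frontier U" using x c2.in_frontier_iff by blast
      then have "c2.normal x = c1.normal x"
        using c1.outward_normal_eq[of x] c2.outward_normal_eq[of x] b by metis
      then show ?thesis by (simp add: G_def nn)
    qed (simp add: G_def)
    then show "AE x in c2.area. G x \<bullet> c2.normal x = q x * \<eta> x"
      using c2.AE_area_graph by (auto elim: eventually_mono)
  qed
  finally show ?thesis unfolding \<eta>_def .
qed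

text \<open>The functions \<open>q\<close> of the previous lemma are dense by the Stone-Weierstrass theorem, so the two area
  measures agree after multiplication by the product \<open>\<eta>\<close> of the bump functions. As \<open>\<eta>\<close> is positive
  on both balls, the factor can be divided out there.\<close>

lemma emeasure_area_eq:
  fixes E :: "'a::euclidean_space set"
  assumes c1: "chart e1 \<gamma>1 U z1 r1" and c2: "chart e2 \<gamma>2 U z2 r2"
    and E: "E \<in> sets borel" "E \<subseteq> ball z1 r1 \<inter> ball z2 r2"
  shows "emeasure (C2_graph.area e1 \<gamma>1) E = emeasure (C2_graph.area e2 \<gamma>2) E"
proof -
  interpret c1: chart e1 \<gamma>1 U z1 r1 by fact
  interpret c2: chart e2 \<gamma>2 U z2 r2 by fact
  define \<eta> where "\<eta> x = bump z1 r1 x * bump z2 r2 x" for x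
  have \<eta>c: "continuous_on UNIV \<eta>"
    unfolding \<eta>_def by (intro continuous_intros C1_map_imp_continuous_on C1_map_bump)
  have [measurable]: "\<eta> \<in> borel_measurable borel" by (rule borel_measurable_continuous_onI[OF \<eta>c])
  have \<eta>0: "\<eta> x = 0" if "x \<notin> cball z1 r1" for x
    using that bump_eq_0[OF c1.r_pos, of x z1] unfolding \<eta>_def by auto
  have \<eta>nn: "\<eta> x \<ge> 0" for x unfolding \<eta>_def by (simp add: bump_nonneg)
  have int1: "integrable c1.area (\<lambda>x. f x * \<eta> x)" and int2: "integrable c2.area (\<lambda>x. f x * \<eta> x)"
    if "continuous_on UNIV f" for f
    by (rule c1.integrable_area[of _ z1 r1] c2.integrable_area[of _ z1 r1];
        use that \<eta>0 in \<open>auto intro!: continuous_intros \<eta>c\<close>)+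
  define D1 where "D1 = density c1.area (\<lambda>x. ennreal (\<eta> x))"
  define D2 where "D2 = density c2.area (\<lambda>x. ennreal (\<eta> x))"
  have sets_D [simp, measurable_cong]: "sets D1 = sets borel" "sets D2 = sets borel"
    unfolding D1_def D2_def by simp_all
  have "D1 = D2"
  proof (rule finite_borel_measure_eqI)
    have "emeasure D1 UNIV = ennreal (\<integral>x. \<eta> x \<partial>c1.area)" "emeasure D2 UNIV = ennreal (\<integral>x. \<eta> x \<partial>c2.area)"
      unfolding D1_def D2_def using int1[of "\<lambda>_. 1"] int2[of "\<lambda>_. 1"] \<eta>nn
      by (simp_all add: emeasure_density nn_integral_eq_integral)
    then show "finite_measure D1" "finite_measure D2"
      by (auto intro!: finite_measureI simp: D1_def D2_def)
    fix f :: "'a \<Rightarrow> real" assume f: "continuous_on UNIV f" "bounded (range f)"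
    have [measurable]: "f \<in> borel_measurable borel" by (rule borel_measurable_continuous_onI[OF f(1)])
    have i1: "(\<integral>x. f x \<partial>D1) = (\<integral>x. f x * \<eta> x \<partial>c1.area)"
      unfolding D1_def by (subst integral_density) (auto simp: \<eta>nn mult.commute)
    have i2: "(\<integral>x. f x \<partial>D2) = (\<integral>x. f x * \<eta> x \<partial>c2.area)"
      unfolding D2_def by (subst integral_density) (auto simp: \<eta>nn mult.commute)
    define I where "I = (\<integral>x. \<eta> x \<partial>c1.area) + (\<integral>x. \<eta> x \<partial>c2.area)"
    have I0: "I \<ge> 0" unfolding I_def by (intro add_nonneg_nonneg Bochner_Integration.integral_nonneg \<eta>nn)
    have close: "\<bar>(\<integral>x. f x * \<eta> x \<partial>c1.area) - (\<integral>x. f x * \<eta> x \<partial>c2.area)\<bar> \<le> \<epsilon> * I" if "\<epsilon> > 0" for \<epsilon>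
    proof -
      have "\<exists>q. C1_map UNIV q \<and> (\<forall>x\<in>cball z1 r1. \<bar>f x - q x\<bar> < \<epsilon>)"
      proof (rule Stone_Weierstrass_HOL)
        show "continuous_on (cball z1 r1) q" if "C1_map UNIV q" for q :: "'a \<Rightarrow> real"
          using C1_map_imp_continuous_on[OF that] continuous_on_subset by blast
        fix x y :: 'a assume "x \<in> cball z1 r1 \<and> y \<in> cball z1 r1 \<and> x \<noteq> y"
        then have "(x - y) \<bullet> x \<noteq> (x - y) \<bullet> y"
          by (metis inner_diff_right inner_eq_zero_iff right_minus_eq)
        then show "\<exists>f. C1_map UNIV f \<and> f x \<noteq> (f y :: real)"
          by (intro exI[of _ "\<lambda>w. (x - y) \<bullet> w"])
            (auto intro!: C1_map_bounded_linear bounded_linear_inner_right)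
      qed (use that f(1) continuous_on_subset in \<open>auto intro: C1_map_const C1_map_add C1_map_mult\<close>)
      then obtain q where q: "C1_map UNIV q" "\<And>x. x \<in> cball z1 r1 \<Longrightarrow> \<bar>f x - q x\<bar> < \<epsilon>" by blast
      have qc: "continuous_on UNIV q" by (rule C1_map_imp_continuous_on[OF q(1)])
      have bound: "\<bar>f x * \<eta> x - q x * \<eta> x\<bar> \<le> \<epsilon> * \<eta> x" for x
        using q(2)[of x] \<eta>0[of x] \<eta>nn[of x]
        by (cases "x \<in> cball z1 r1") (auto simp: abs_mult left_diff_distrib[symmetric] intro!: mult_right_mono)
      have "\<bar>(\<integral>x. f x * \<eta> x \<partial>c1.area) - (\<integral>x. q x * \<eta> x \<partial>c1.area)\<bar> \<le> (\<integral>x. \<epsilon> * \<eta> x \<partial>c1.area)"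
        unfolding Bochner_Integration.integral_diff[OF int1[OF f(1)] int1[OF qc], symmetric]
        by (rule integral_abs_bound_integral) (use int1 int1[of "\<lambda>_. \<epsilon>"] f(1) qc bound in auto)
      moreover have "\<bar>(\<integral>x. f x * \<eta> x \<partial>c2.area) - (\<integral>x. q x * \<eta> x \<partial>c2.area)\<bar> \<le> (\<integral>x. \<epsilon> * \<eta> x \<partial>c2.area)"
        unfolding Bochner_Integration.integral_diff[OF int2[OF f(1)] int2[OF qc], symmetric]
        by (rule integral_abs_bound_integral) (use int2 int2[of "\<lambda>_. \<epsilon>"] f(1) qc bound in auto)
      moreover have "(\<integral>x. q x * \<eta> x \<partial>c1.area) = (\<integral>x. q x * \<eta> x \<partial>c2.area)"
        unfolding \<eta>_def by (rule integral_area_eq[OF c1 c2 q(1)])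
      ultimately show ?thesis unfolding I_def by (simp add: distrib_left)
    qed
    have "\<bar>(\<integral>x. f x * \<eta> x \<partial>c1.area) - (\<integral>x. f x * \<eta> x \<partial>c2.area)\<bar> \<le> 0"
    proof (rule field_le_epsilon)
      fix d :: real assume "d > 0"
      then have "d / (I + 1) > 0" "d / (I + 1) * I \<le> d"
        using I0 by (auto simp: field_simps)
      then show "\<bar>(\<integral>x. f x * \<eta> x \<partial>c1.area) - (\<integral>x. f x * \<eta> x \<partial>c2.area)\<bar> \<le> 0 + d"
        using close by fastforce
    qed
    then show "(\<integral>x. f x \<partial>D1) = (\<integral>x. f x \<partial>D2)" unfolding i1 i2 by simp
  qed simp_all
  moreover have "emeasure M E = (\<integral>\<^sup>+x. indicator E x * ennreal (inverse (\<eta> x)) \<partial>density M (\<lambda>x. ennreal (\<eta> x)))"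
    if [measurable_cong]: "sets M = sets borel" for M :: "'a measure"
  proof -
    note [measurable] = E(1)
    have "(\<integral>\<^sup>+x. indicator E x * ennreal (inverse (\<eta> x)) \<partial>density M (\<lambda>x. ennreal (\<eta> x))) =
        (\<integral>\<^sup>+x. ennreal (\<eta> x) * (indicator E x * ennreal (inverse (\<eta> x))) \<partial>M)"
      by (rule nn_integral_density) simp_all
    also have "\<dots> = (\<integral>\<^sup>+x. indicator E x \<partial>M)"
    proof (rule nn_integral_cong)
      fix x
      show "ennreal (\<eta> x) * (indicator E x * ennreal (inverse (\<eta> x))) = indicator E x"
      proof (cases "x \<in> E")
        case True
        then have "\<eta> x > 0"
          using E(2) bump_pos_iff[OF c1.r_pos] bump_pos_iff[OF c2.r_pos] unfolding \<eta>_def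
          by (intro mult_pos_pos) blast+
        then show ?thesis using True by (simp add: ennreal_mult[symmetric])
      qed simp
    qed
    also have "\<dots> = emeasure M E" using E(1) that by simp
    finally show ?thesis by simp
  qed
  ultimately show ?thesis
    unfolding D1_def D2_def by (metis c1.sets_area c2.sets_area)
qed

text \<open>The property that characterises \<open>surface_measure\<close>, named in order to prove that exactly one measure
  has it.\<close>

definition is_surface_measure :: "'a::euclidean_space set \<Rightarrow> 'a measure \<Rightarrow> bool" where
  "is_surface_measure U \<sigma> \<longleftrightarrow> sets \<sigma> = sets borel \<and> emeasure \<sigma> (- frontier U) = 0 \<and>
     (\<forall>z r e \<gamma> E. graph_chart U z r e \<gamma> \<longrightarrow> E \<in> sets borel \<longrightarrow> E \<subseteq> frontier U \<inter> ball z r \<longrightarrow>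
        emeasure \<sigma> E = graph_area e \<gamma> E)"

locale C2_domain =
  fixes U :: "'a::euclidean_space set"
  assumes open_U: "open U" and bounded_U: "bounded U" and C2_boundary_U: "C2_boundary U"
begin

lemma compact_closure: "compact (closure U)"
  using bounded_U by (simp add: compact_closure)

lemma compact_frontier: "compact (frontier U)"
  using bounded_U by (simp add: compact_frontier_bounded)

lemma chartI: "graph_chart U z r e \<gamma> \<Longrightarrow> chart e \<gamma> U z r"
  by (rule graph_chart_imp_chart[OF open_U])

text \<open>The boundary is compact, so it splits into finitely many Borel pieces, each within one chart. A
  surface measure is determined on each piece by the area formula, which gives uniqueness; adding up
  the area measures of the pieces gives existence.\<close>

definition charted_partition ::
    "nat \<Rightarrow> (nat \<Rightarrow> 'a) \<Rightarrow> (nat \<Rightarrow> real) \<Rightarrow> (nat \<Rightarrow> 'a) \<Rightarrow> (nat \<Rightarrow> 'a \<Rightarrow> real) \<Rightarrow> (nat \<Rightarrow> 'a set) \<Rightarrow> bool" where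
  "charted_partition m z r e \<gamma> D \<longleftrightarrow>
     (\<forall>i<m. graph_chart U (z i) (r i) (e i) (\<gamma> i) \<and> D i \<in> sets borel \<and>
        D i \<subseteq> frontier U \<inter> ball (z i) (r i)) \<and>
     disjoint_family_on D {..<m} \<and> (\<Union>i<m. D i) = frontier U"

lemma charted_partitionD:
  assumes "charted_partition m z r e \<gamma> D"
  shows "i < m \<Longrightarrow> graph_chart U (z i) (r i) (e i) (\<gamma> i)"
    "i < m \<Longrightarrow> D i \<in> sets borel" "i < m \<Longrightarrow> D i \<subseteq> frontier U \<inter> ball (z i) (r i)"
    "disjoint_family_on D {..<m}" "(\<Union>i<m. D i) = frontier U"
  using assms unfolding charted_partition_def by blast+

lemma ex_charted_partition: "\<exists>m z r e \<gamma> D. charted_partition m z r e \<gamma> D"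
proof -
  have "\<forall>z\<in>frontier U. \<exists>r e \<gamma>. graph_chart U z r e \<gamma>"
    using C2_boundary_U by (simp add: C2_boundary_def)
  then obtain r e \<gamma> where ch: "\<And>z. z \<in> frontier U \<Longrightarrow> graph_chart U z (r z) (e z) (\<gamma> z)" by metis
  have "frontier U \<subseteq> (\<Union>z\<in>frontier U. ball z (r z))"
    using ch by (force simp: graph_chart_def)
  then obtain Z where Z: "Z \<subseteq> frontier U" "finite Z" "frontier U \<subseteq> (\<Union>z\<in>Z. ball z (r z))"
    using compactE_image[OF compact_frontier, of "frontier U" "\<lambda>z. ball z (r z)"] by auto
  obtain f where f: "bij_betw f {..<card Z} Z"
    using ex_bij_betw_nat_finite[OF Z(2)] by (auto simp: atLeast0LessThan)
  define A where "A i = (if i < card Z then frontier U \<inter> ball (f i) (r (f i)) else {})" for i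
  have "\<forall>i<card Z. graph_chart U (f i) (r (f i)) (e (f i)) (\<gamma> (f i)) \<and> disjointed A i \<in> sets borel \<and>
      disjointed A i \<subseteq> frontier U \<inter> ball (f i) (r (f i))"
  proof (intro allI impI conjI)
    fix i assume i: "i < card Z"
    have "f i \<in> Z" using f i by (auto simp: bij_betw_def)
    then show "graph_chart U (f i) (r (f i)) (e (f i)) (\<gamma> (f i))" using ch Z(1) by blast
    have "A j \<in> sets borel" for j
      unfolding A_def using compact_frontier by (auto simp: borel_closed)
    then show "disjointed A i \<in> sets borel" unfolding disjointed_def by auto
    show "disjointed A i \<subseteq> frontier U \<inter> ball (f i) (r (f i))"
      using i disjointed_subset[of A i] by (auto simp: A_def)
  qed
  moreover have "disjoint_family_on (disjointed A) {..<card Z}"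
    using disjoint_family_disjointed by (rule disjoint_family_on_mono[rotated]) simp
  moreover have "(\<Union>i<card Z. disjointed A i) = frontier U"
  proof -
    have "disjointed A i = {}" if "\<not> i < card Z" for i
      using disjointed_subset[of A i] that by (simp add: A_def)
    then have "(\<Union>i<card Z. disjointed A i) = (\<Union>i. disjointed A i)" by blast
    also have "\<dots> = (\<Union>i. A i)" by (rule UN_disjointed_eq)
    also have "\<dots> = frontier U"
    proof
      show "(\<Union>i. A i) \<subseteq> frontier U" by (auto simp: A_def split: if_splits)
      show "frontier U \<subseteq> (\<Union>i. A i)"
      proof
        fix x assume x: "x \<in> frontier U"
        then obtain w where "w \<in> Z" "x \<in> ball w (r w)" using Z(3) by blast
        moreover have "w \<in> f ` {..<card Z}" using \<open>w \<in> Z\<close> f by (simp add: bij_betw_def)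
        then obtain i where "i < card Z" "f i = w" by blast
        ultimately show "x \<in> (\<Union>i. A i)" using x by (auto simp: A_def intro!: exI[of _ i])
      qed
    qed
    finally show ?thesis .
  qed
  ultimately have "charted_partition (card Z) f (\<lambda>i. r (f i)) (\<lambda>i. e (f i)) (\<lambda>i. \<gamma> (f i)) (disjointed A)"
    unfolding charted_partition_def by blast
  then show ?thesis by blast
qed

lemma is_surface_measure_unique:
  assumes "is_surface_measure U \<sigma>" "is_surface_measure U \<tau>"
  shows "\<sigma> = \<tau>"
proof -
  obtain m z r e \<gamma> D where part: "charted_partition m z r e \<gamma> D"
    using ex_charted_partition by blast
  note ch = charted_partitionD(1)[OF part] and D = charted_partitionD(2-5)[OF part]
  have F: "frontier U \<in> sets borel" using compact_frontier by (auto simp: borel_closed)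
  have val: "emeasure \<rho> E = (\<Sum>i<m. graph_area (e i) (\<gamma> i) (E \<inter> D i))"
    if \<rho>: "is_surface_measure U \<rho>" and E: "E \<in> sets borel" for \<rho> E
  proof -
    have s: "sets \<rho> = sets borel" using \<rho> by (simp add: is_surface_measure_def)
    have "emeasure \<rho> (E - frontier U) = 0"
      using \<rho> emeasure_mono[of "E - frontier U" "- frontier U" \<rho>] F s
      by (auto simp: is_surface_measure_def Diff_eq)
    moreover have "emeasure \<rho> E = emeasure \<rho> (E \<inter> frontier U) + emeasure \<rho> (E - frontier U)"
      using E F s by (subst plus_emeasure) (auto intro!: arg_cong2[where f = emeasure])
    moreover have "emeasure \<rho> (E \<inter> frontier U) = (\<Sum>i<m. emeasure \<rho> (E \<inter> D i))"
    proof (subst sum_emeasure)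
      show "(\<lambda>i. E \<inter> D i) ` {..<m} \<subseteq> sets \<rho>" using E D(1) s by auto
      show "disjoint_family_on (\<lambda>i. E \<inter> D i) {..<m}" using D(3) by (auto simp: disjoint_family_on_def)
      show "emeasure \<rho> (E \<inter> frontier U) = emeasure \<rho> (\<Union>i<m. E \<inter> D i)"
        unfolding D(4)[symmetric] by (simp only: Int_UN_distrib)
    qed simp
    moreover have "emeasure \<rho> (E \<inter> D i) = graph_area (e i) (\<gamma> i) (E \<inter> D i)" if "i < m" for i
    proof -
      have "E \<inter> D i \<in> sets borel" "E \<inter> D i \<subseteq> frontier U \<inter> ball (z i) (r i)"
        using E D(1,2)[OF that] by auto
      then show ?thesis using \<rho> ch[OF that] unfolding is_surface_measure_def by blast
    qed
    ultimately show ?thesis by simp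
  qed
  have "sets \<sigma> = sets borel" "sets \<tau> = sets borel"
    using assms unfolding is_surface_measure_def by blast+
  then show ?thesis
    using val[OF assms(1)] val[OF assms(2)] by (intro measure_eqI) metis+
qed

text \<open>The sum of the area measures over the pieces satisfies the area formula in every other chart,
  because the area measures of two charts agree where both apply.\<close>

lemma ex_is_surface_measure: "\<exists>\<sigma>. is_surface_measure U \<sigma>"
proof -
  obtain m z r e \<gamma> D where part: "charted_partition m z r e \<gamma> D"
    using ex_charted_partition by blast
  note ch = charted_partitionD(1)[OF part] and D = charted_partitionD(2-5)[OF part]
  define \<mu> where "\<mu> i = C2_graph.area (e i) (\<gamma> i)" for i
  have chart: "chart (e i) (\<gamma> i) U (z i) (r i)" if "i < m" for i by (rule chartI[OF ch[OF that]])
  have graph: "C2_graph (e i) (\<gamma> i)" if "i < m" for i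
    using chart[OF that] by (simp add: chart_def)
  have s\<mu>: "sets (\<mu> i) = sets borel" if "i < m" for i
    unfolding \<mu>_def by (rule C2_graph.sets_area[OF graph[OF that]])
  define \<sigma> where "\<sigma> = measure_of UNIV (sets borel) (\<lambda>E. \<Sum>i<m. emeasure (\<mu> i) (E \<inter> D i))"
  have s: "sets \<sigma> = sets borel"
    unfolding \<sigma>_def using sets.sigma_sets_eq[of "borel :: 'a measure"] by simp
  have em: "emeasure \<sigma> E = (\<Sum>i<m. emeasure (\<mu> i) (E \<inter> D i))" if "E \<in> sets borel" for E
    unfolding \<sigma>_def
  proof (rule emeasure_measure_of_sigma)
    show "sigma_algebra UNIV (sets (borel :: 'a measure))"
      using sets.sigma_algebra_axioms[of "borel :: 'a measure"] by simp
    show "positive (sets borel) (\<lambda>E. \<Sum>i<m. emeasure (\<mu> i) (E \<inter> D i))"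
      by (simp add: positive_def)
    show "countably_additive (sets borel) (\<lambda>E. \<Sum>i<m. emeasure (\<mu> i) (E \<inter> D i))"
    proof (rule countably_additiveI)
      fix A :: "nat \<Rightarrow> 'a set"
      assume A: "range A \<subseteq> sets borel" "disjoint_family A"
      have "(\<Sum>n. \<Sum>i<m. emeasure (\<mu> i) (A n \<inter> D i)) = (\<Sum>i<m. \<Sum>n. emeasure (\<mu> i) (A n \<inter> D i))"
        by (rule suminf_sum) simp
      also have "\<dots> = (\<Sum>i<m. emeasure (\<mu> i) ((\<Union>n. A n) \<inter> D i))"
      proof (intro sum.cong refl)
        fix i assume "i \<in> {..<m}"
        then have "(\<Sum>n. emeasure (\<mu> i) (A n \<inter> D i)) = emeasure (\<mu> i) (\<Union>n. A n \<inter> D i)"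
          using A D(1)[of i] s\<mu>[of i] by (intro suminf_emeasure) (auto simp: disjoint_family_on_def)
        then show "(\<Sum>n. emeasure (\<mu> i) (A n \<inter> D i)) = emeasure (\<mu> i) ((\<Union>n. A n) \<inter> D i)"
          by simp
      qed
      finally show "(\<Sum>n. \<Sum>i<m. emeasure (\<mu> i) (A n \<inter> D i)) = (\<Sum>i<m. emeasure (\<mu> i) ((\<Union>n. A n) \<inter> D i))" .
    qed
  qed (use that in auto)
  have F: "frontier U \<in> sets borel" using compact_frontier by (auto simp: borel_closed)
  have "emeasure \<sigma> (- frontier U) = 0"
  proof -
    have "- frontier U \<inter> D i = {}" if "i < m" for i using D(2)[OF that] by auto
    then show ?thesis using em[of "- frontier U"] F by simp
  qed
  moreover have "emeasure \<sigma> E = graph_area e' \<gamma>' E"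
    if c': "graph_chart U z' r' e' \<gamma>'" and E: "E \<in> sets borel" "E \<subseteq> frontier U \<inter> ball z' r'" for z' r' e' \<gamma>' E
  proof -
    interpret c': chart e' \<gamma>' U z' r' by (rule chartI[OF c'])
    have "emeasure \<sigma> E = (\<Sum>i<m. emeasure c'.area (E \<inter> D i))"
      unfolding em[OF E(1)]
    proof (intro sum.cong refl)
      fix i assume "i \<in> {..<m}"
      then have i: "i < m" by simp
      show "emeasure (\<mu> i) (E \<inter> D i) = emeasure c'.area (E \<inter> D i)"
        unfolding \<mu>_def
        by (rule emeasure_area_eq[OF chart[OF i] c'.chart_axioms]) (use E D(1,2)[OF i] in auto)
    qed
    also have "\<dots> = emeasure c'.area (\<Union>i<m. E \<inter> D i)"
      by (rule sum_emeasure) (use E D(1,3) in \<open>auto simp: disjoint_family_on_def\<close>)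
    also have "(\<Union>i<m. E \<inter> D i) = E"
      using D(4) E(2) by (auto simp: set_eq_iff)
    also have "emeasure c'.area E = graph_area e' \<gamma>' E" by (rule c'.emeasure_area[OF E(1)])
    finally show ?thesis .
  qed
  ultimately have "is_surface_measure U \<sigma>" unfolding is_surface_measure_def using s by blast
  then show ?thesis by blast
qed

lemma is_surface_measure: "is_surface_measure U (surface_measure U)"
proof -
  have "\<exists>!\<sigma>. is_surface_measure U \<sigma>"
    using ex_is_surface_measure is_surface_measure_unique by blast
  then have "is_surface_measure U (THE \<sigma>. is_surface_measure U \<sigma>)" by (rule theI')
  then show ?thesis unfolding surface_measure_def is_surface_measure_def[abs_def] .
qed

lemma sets_surface [simp, measurable_cong]: "sets (surface_measure U) = sets borel"
  using is_surface_measure by (simp add: is_surface_measure_def)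

lemma space_surface [simp]: "space (surface_measure U) = UNIV"
  using sets_eq_imp_space_eq[OF sets_surface] by simp

lemma frontier_borel [measurable]: "frontier U \<in> sets borel"
  using compact_frontier by (auto simp: borel_closed)

lemma emeasure_surface_chart:
  assumes "chart e \<gamma> U z r" "graph_chart U z r e \<gamma>" "E \<in> sets borel" "E \<subseteq> frontier U \<inter> ball z r"
  shows "emeasure (surface_measure U) E = emeasure (C2_graph.area e \<gamma>) E"
proof -
  interpret chart e \<gamma> U z r by fact
  show ?thesis
    using is_surface_measure assms unfolding is_surface_measure_def by (simp add: emeasure_area)
qed

lemma finite_measure_surface: "finite_measure (surface_measure U)"
proof
  obtain m z r e \<gamma> D where part: "charted_partition m z r e \<gamma> D"
    using ex_charted_partition by blast
  note ch = charted_partitionD(1)[OF part] and D = charted_partitionD(2-5)[OF part]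
  obtain R where "\<forall>x\<in>frontier U. norm x \<le> R"
    using compact_imp_bounded[OF compact_frontier] unfolding bounded_iff by blast
  then have R: "frontier U \<subseteq> cball 0 R" by auto
  have "emeasure (surface_measure U) UNIV =
      emeasure (surface_measure U) (frontier U) + emeasure (surface_measure U) (- frontier U)"
    using plus_emeasure[of "frontier U" "surface_measure U" "- frontier U"] by simp
  also have "\<dots> = emeasure (surface_measure U) (\<Union>i<m. D i)"
    unfolding D(4) using is_surface_measure by (simp add: is_surface_measure_def)
  also have "\<dots> = (\<Sum>i<m. emeasure (surface_measure U) (D i))"
    by (rule sum_emeasure[symmetric]) (use D in auto)
  also have "\<dots> < \<infinity>"
  proof (subst infinity_ennreal_def, rule ennreal_sum_less_top[THEN iffD2], simp, intro ballI)
    fix i assume "i \<in> {..<m}"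
    then have i: "i < m" by simp
    interpret chart "e i" "\<gamma> i" U "z i" "r i" by (rule chartI[OF ch[OF i]])
    have "emeasure (surface_measure U) (D i) = emeasure area (D i)"
      by (rule emeasure_surface_chart[OF chart_axioms ch[OF i] D(1,2)[OF i]])
    also have "\<dots> \<le> emeasure area (cball 0 R)"
      by (rule emeasure_mono) (use R D(2)[OF i] in auto)
    also have "\<dots> < top" using emeasure_area_cball by simp
    finally show "emeasure (surface_measure U) (D i) < top" .
  qed
  finally show "emeasure (surface_measure U) (space (surface_measure U)) \<noteq> \<infinity>" by simp
qed

lemma outward_normal_measurable:
  "(\<lambda>x. indicator (frontier U) x *\<^sub>R outward_normal U x) \<in> borel_measurable borel"
proof -
  obtain m z r e \<gamma> D where part: "charted_partition m z r e \<gamma> D"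
    using ex_charted_partition by blast
  note ch = charted_partitionD(1)[OF part] and D = charted_partitionD(2-5)[OF part]
  have "indicator (frontier U) x *\<^sub>R outward_normal U x =
      (\<Sum>i<m. indicator (D i) x *\<^sub>R C2_graph.normal (e i) (\<gamma> i) x)" for x
  proof (cases "x \<in> frontier U")
    case True
    then obtain i where i: "i < m" "x \<in> D i" using D(4) by blast
    interpret chart "e i" "\<gamma> i" U "z i" "r i" by (rule chartI[OF ch[OF i(1)]])
    have "x \<notin> D j" if "j < m" "j \<noteq> i" for j
      using D(3) i that unfolding disjoint_family_on_def by blast
    then have "(\<Sum>j<m. indicator (D j) x *\<^sub>R C2_graph.normal (e j) (\<gamma> j) x) =
        (\<Sum>j<m. if j = i then normal x else 0)"
      using i by (intro sum.cong) (auto simp: indicator_def)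
    also have "\<dots> = outward_normal U x"
      using i(1) outward_normal_eq[of x] subsetD[OF D(2)[OF i(1)] i(2)] by simp
    finally show ?thesis using True by simp
  next
    case False
    then have "x \<notin> D i" if "i < m" for i using D(2)[OF that] by blast
    then show ?thesis using False by simp
  qed
  moreover have "(\<lambda>x. \<Sum>i<m. indicator (D i) x *\<^sub>R C2_graph.normal (e i) (\<gamma> i) x) \<in> borel_measurable borel"
  proof (rule borel_measurable_sum)
    fix i assume "i \<in> {..<m}"
    then have i: "i < m" by simp
    interpret chart "e i" "\<gamma> i" U "z i" "r i" by (rule chartI[OF ch[OF i]])
    have "normal \<in> borel_measurable borel"
      by (intro borel_measurable_continuous_onI C1_map_imp_continuous_on C1_normal)
    then show "(\<lambda>x. indicator (D i) x *\<^sub>R normal x) \<in> borel_measurable borel"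
      using D(1)[OF i] by simp
  qed
  ultimately show ?thesis by simp
qed

lemma norm_outward_normal:
  assumes "x \<in> frontier U" shows "norm (outward_normal U x) = 1"
proof -
  obtain r e \<gamma> where c: "graph_chart U x r e \<gamma>" using assms C2_boundary_U C2_boundary_def by blast
  interpret chart e \<gamma> U x r by (rule chartI[OF c])
  show ?thesis using outward_normal_eq[OF assms] norm_normal r_pos by simp
qed

text \<open>Measurability of the outward normal on the boundary comes from the continuous normals of finitely
  many charts.\<close>

lemma integrable_flux:
  assumes F: "continuous_on (closure U) F"
  shows "integrable (surface_measure U) (\<lambda>x. indicator (frontier U) x * (F x \<bullet> outward_normal U x))"
proof -
  interpret finite_measure "surface_measure U" by (rule finite_measure_surface)
  have sub: "frontier U \<subseteq> closure U" by (auto simp: frontier_def)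
  have "bounded (F ` frontier U)"
    by (intro compact_imp_bounded compact_continuous_image compact_frontier continuous_on_subset[OF F sub])
  then obtain B where B: "B > 0" "\<And>x. x \<in> frontier U \<Longrightarrow> norm (F x) \<le> B" unfolding bounded_pos by auto
  have [measurable]: "(\<lambda>x. indicator (frontier U) x *\<^sub>R F x) \<in> borel_measurable borel"
    by (intro borel_measurable_continuous_on_indicator continuous_on_subset[OF F sub]) simp
  note [measurable] = outward_normal_measurable
  have "(\<lambda>x. (indicator (frontier U) x *\<^sub>R F x) \<bullet> (indicator (frontier U) x *\<^sub>R outward_normal U x))
      \<in> borel_measurable (surface_measure U)" by measurable
  then have "(\<lambda>x. indicator (frontier U) x * (F x \<bullet> outward_normal U x)) \<in> borel_measurable (surface_measure U)"
    by (rule measurable_cong[THEN iffD1, rotated]) (auto simp: indicator_def)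
  moreover have "norm (indicator (frontier U) x * (F x \<bullet> outward_normal U x)) \<le> B" for x
    using B Cauchy_Schwarz_ineq2[of "F x" "outward_normal U x"] norm_outward_normal[of x]
    by (cases "x \<in> frontier U") (auto intro: order_trans)
  ultimately show ?thesis by (intro integrable_const_bound) auto
qed

end

section \<open>The divergence theorem on a domain with \<open>C\<^sup>2\<close> boundary\<close>

context C2_domain
begin

lemma U_borel [measurable]: "U \<in> sets borel"
  using open_U by auto

lemma U_subset_closure: "U \<subseteq> closure U"
  by (rule closure_subset)

lemma integrable_on_U:
  fixes g :: "'a \<Rightarrow> real"
  assumes g: "continuous_on U g" and bd: "\<And>x. x \<in> U \<Longrightarrow> \<bar>g x\<bar> \<le> C"
  shows "integrable lborel (\<lambda>x. indicator U x * g x)"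
proof (rule integrableI_bounded_set[where A = U and B = C])
  show "(\<lambda>x. indicator U x * g x) \<in> borel_measurable lborel"
    using borel_measurable_continuous_on_indicator[OF _ g] by simp
  show "emeasure lborel U < \<infinity>"
    using bounded_U by (rule emeasure_bounded_finite)
qed (use bd in auto)

lemma integral_surface_chart:
  fixes f :: "'a \<Rightarrow> real"
  assumes c: "graph_chart U z r e \<gamma>"
  shows "(\<integral>x. indicator (frontier U \<inter> ball z r) x * f x \<partial>surface_measure U) =
    (\<integral>x. indicator (frontier U \<inter> ball z r) x * f x \<partial>C2_graph.area e \<gamma>)"
proof -
  interpret chart e \<gamma> U z r by (rule chartI[OF c])
  let ?\<Omega> = "frontier U \<inter> ball z r"
  have \<Omega>: "?\<Omega> \<in> sets borel" by simp
  have "restrict_space (surface_measure U) ?\<Omega> = restrict_space area ?\<Omega>"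
  proof (rule measure_eqI)
    show "sets (restrict_space (surface_measure U) ?\<Omega>) = sets (restrict_space area ?\<Omega>)"
      by (rule sets_restrict_space_cong) simp
    fix E assume "E \<in> sets (restrict_space (surface_measure U) ?\<Omega>)"
    then have E: "E \<in> sets borel" "E \<subseteq> ?\<Omega>"
      using \<Omega> by (auto simp: sets_restrict_space_iff)
    show "emeasure (restrict_space (surface_measure U) ?\<Omega>) E = emeasure (restrict_space area ?\<Omega>) E"
      using emeasure_surface_chart[OF chart_axioms c E] E \<Omega> by (simp add: emeasure_restrict_space)
  qed
  then show ?thesis
    using integral_restrict_space[of ?\<Omega> "surface_measure U" f] integral_restrict_space[of ?\<Omega> area f] \<Omega>
    by simp
qed

text \<open>A field supported well inside the ball of a chart extends by zero to the whole epigraph.\<close>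

lemma divergence_theorem_chart:
  fixes F :: "'a \<Rightarrow> 'a"
  assumes c: "graph_chart U z r e \<gamma>" and \<rho>: "\<rho> < r"
    and F: "C1_map U F" and cont: "continuous_on (closure U) F"
    and van: "\<And>x. x \<in> closure U \<Longrightarrow> x \<notin> cball z \<rho> \<Longrightarrow> F x = 0"
    and bd: "\<And>x. x \<in> U \<Longrightarrow> \<bar>divergence F x\<bar> \<le> C"
  shows "(\<integral>x. indicator U x * divergence F x \<partial>lborel) =
    (\<integral>x. indicator (frontier U) x * (F x \<bullet> outward_normal U x) \<partial>surface_measure U)"
proof -
  interpret chart e \<gamma> U z r by (rule chartI[OF c])
  define G where "G x = (if x \<in> ball z r then F x else 0)" for x
  have G0: "G x = 0" if "x \<in> epi_from 0" "x \<notin> cball z \<rho>" for x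
    using that van in_closure_iff by (auto simp: G_def)
  have epi0: "epi \<subseteq> epi_from 0" by (auto simp: epi_def epi_from_def)
  have open1: "open (epi \<inter> ball z r)" and open2: "open (epi - cball z \<rho>)"
    using open_epi by auto
  have "C1_map ((epi \<inter> ball z r) \<union> (epi - cball z \<rho>)) G"
  proof (rule C1_map_Un[OF open1 open2])
    show "C1_map (epi \<inter> ball z r) G"
      by (rule C1_map_cong_open[OF open1 _ C1_map_subset[OF F]]) (auto simp: G_def in_U_iff)
    show "C1_map (epi - cball z \<rho>) G"
      by (rule C1_map_cong_open[OF open2 _ C1_map_const[of _ 0]]) (use epi0 G0 in auto)
  qed
  moreover have "epi \<subseteq> (epi \<inter> ball z r) \<union> (epi - cball z \<rho>)" using \<rho> by auto
  ultimately have G: "C1_map epi G" by (rule C1_map_subset)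
  have Gcont: "continuous_on (epi_from 0) G"
  proof -
    \<comment> \<open>An intermediate radius gives two closed pieces: \<open>G\<close> equals \<open>F\<close> on one and vanishes on the other.\<close>
    obtain \<rho>' where \<rho>': "\<rho> < \<rho>'" "\<rho>' < r" using dense[OF \<rho>] by blast
    have sub: "x \<in> closure U" if "x \<in> epi_from 0 \<inter> cball z \<rho>'" for x
      using that \<rho>' in_closure_iff[of x] by auto
    have "continuous_on ((epi_from 0 \<inter> cball z \<rho>') \<union> (epi_from 0 - ball z \<rho>')) G"
    proof (rule continuous_on_closed_Un)
      show "closed (epi_from 0 \<inter> cball z \<rho>')" using closed_epi_from by auto
      show "closed (epi_from 0 - ball z \<rho>')" using closed_epi_from by (auto intro: closed_Diff)
      have "continuous_on (epi_from 0 \<inter> cball z \<rho>') F"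
        by (rule continuous_on_subset[OF cont]) (use sub in blast)
      then show "continuous_on (epi_from 0 \<inter> cball z \<rho>') G"
        by (rule continuous_on_cong[THEN iffD1, rotated 2]) (use \<rho>' in \<open>auto simp: G_def\<close>)
      have "continuous_on (epi_from 0 - ball z \<rho>') (\<lambda>_. 0 :: 'a)" by simp
      then show "continuous_on (epi_from 0 - ball z \<rho>') G"
        by (rule continuous_on_cong[THEN iffD1, rotated 2]) (use \<rho>' G0 in auto)
    qed
    then show ?thesis by (rule continuous_on_subset) auto
  qed
  have divG: "divergence G x = divergence F x" if "x \<in> epi" "x \<in> ball z r" for x
    by (rule divergence_cong_open[of "ball z r"]) (use that in \<open>auto simp: G_def\<close>)
  have zero: "divergence (\<lambda>_. 0 :: 'a) x = 0" for x by (simp add: divergence_def)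
  have divG0: "divergence G x = 0" if "x \<in> epi" "x \<notin> ball z r" for x
    using divergence_cong_open[OF open2, of x G "\<lambda>_. 0"] that \<rho> epi0 G0 zero by auto
  have openF: "open (U - cball z \<rho>)" using open_U by auto
  have divF0: "divergence F x = 0" if "x \<in> U" "x \<notin> ball z r" for x
    using divergence_cong_open[OF openF, of x F "\<lambda>_. 0"] that \<rho> van U_subset_closure zero by auto
  have "(\<integral>x. indicator U x * divergence F x \<partial>lborel) = (\<integral>x. indicator epi x * divergence G x \<partial>lborel)"
  proof (intro Bochner_Integration.integral_cong refl)
    fix x show "indicator U x * divergence F x = indicator epi x * divergence G x"
      using divG[of x] divG0[of x] divF0[of x] in_U_iff[of x]
      by (cases "x \<in> ball z r") (auto simp: indicator_def)
  qed
  also have "\<dots> = (\<integral>x. indicator graph x * (G x \<bullet> normal x) \<partial>area)"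
  proof (rule divergence_theorem_epi[OF G Gcont, where R = "norm z + r" and C = "\<bar>C\<bar>"])
    fix x show "x \<in> epi_from 0 \<Longrightarrow> x \<notin> cball 0 (norm z + r) \<Longrightarrow> G x = 0"
      using norm_triangle_sub[of x z] by (auto simp: G_def dist_norm norm_minus_commute)
    show "x \<in> epi \<Longrightarrow> \<bar>divergence G x\<bar> \<le> \<bar>C\<bar>"
      using divG[of x] divG0[of x] bd[of x] in_U_iff[of x] by (cases "x \<in> ball z r") auto
  qed
  also have "\<dots> = (\<integral>x. indicator (frontier U \<inter> ball z r) x * (F x \<bullet> outward_normal U x) \<partial>area)"
  proof (intro Bochner_Integration.integral_cong refl)
    fix x show "indicator graph x * (G x \<bullet> normal x) =
        indicator (frontier U \<inter> ball z r) x * (F x \<bullet> outward_normal U x)"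
      using in_frontier_iff[of x] outward_normal_eq[of x]
      by (cases "x \<in> ball z r") (auto simp: indicator_def G_def)
  qed
  also have "\<dots> = (\<integral>x. indicator (frontier U \<inter> ball z r) x * (F x \<bullet> outward_normal U x) \<partial>surface_measure U)"
    by (rule integral_surface_chart[OF c, symmetric])
  also have "\<dots> = (\<integral>x. indicator (frontier U) x * (F x \<bullet> outward_normal U x) \<partial>surface_measure U)"
  proof (intro Bochner_Integration.integral_cong refl)
    fix x show "indicator (frontier U \<inter> ball z r) x * (F x \<bullet> outward_normal U x) =
        indicator (frontier U) x * (F x \<bullet> outward_normal U x)"
      using van[of x] \<rho> by (auto simp: indicator_def frontier_def)
  qed
  finally show ?thesis .
qed

lemma divergence_scaleR_bounded:
  assumes f: "C1_map V f" "closure U \<subseteq> V"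
    and F: "C1_map U F" "continuous_on (closure U) F"
    and bd: "\<And>x. x \<in> U \<Longrightarrow> \<bar>divergence F x\<bar> \<le> C"
  obtains K where "\<And>x. x \<in> U \<Longrightarrow> \<bar>divergence (\<lambda>y. f y *\<^sub>R F y) x\<bar> \<le> K"
proof -
  have "bounded (f ` closure U)" "bounded ((\<lambda>x. grad f x \<bullet> F x) ` closure U)"
    by (intro compact_imp_bounded compact_continuous_image compact_closure continuous_intros F(2)
        continuous_on_subset[OF C1_map_imp_continuous_on[OF f(1)] f(2)]
        continuous_on_subset[OF continuous_on_grad[OF f(1)] f(2)])+
  then obtain a b where a: "\<And>x. x \<in> closure U \<Longrightarrow> \<bar>f x\<bar> \<le> a"
      and b: "\<And>x. x \<in> closure U \<Longrightarrow> \<bar>grad f x \<bullet> F x\<bar> \<le> b"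
    unfolding bounded_iff by (metis imageI real_norm_def)
  show thesis
  proof (rule that)
    fix x assume x: "x \<in> U"
    then have xc: "x \<in> closure U" using U_subset_closure by blast
    have "divergence (\<lambda>y. f y *\<^sub>R F y) x = f x * divergence F x + grad f x \<bullet> F x"
      by (rule divergence_scaleR) (use xc x f C1_map_differentiable[OF f(1)] C1_map_differentiable[OF F(1)] in auto)
    moreover have "\<bar>f x * divergence F x\<bar> \<le> a * \<bar>C\<bar>"
      unfolding abs_mult by (rule mult_mono) (use a[OF xc] bd[OF x] in auto)
    ultimately show "\<bar>divergence (\<lambda>y. f y *\<^sub>R F y) x\<bar> \<le> a * \<bar>C\<bar> + b"
      using b[OF xc] by linarith
  qed
qed

text \<open>Finitely many balls of charts, shrunk by the factor \<open>2\<close>, cover the closure of \<open>U\<close>; let \<open>S\<close> be the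
  sum of their bump functions. Then \<open>F\<close> is the sum of the products of the bump functions with the field
  \<open>F / S\<close>, and each product is supported in one chart.\<close>

theorem divergence_theorem:
  fixes F :: "'a \<Rightarrow> 'a"
  assumes F: "C1_map U F" and cont: "continuous_on (closure U) F"
    and bd: "\<And>x. x \<in> U \<Longrightarrow> \<bar>divergence F x\<bar> \<le> C"
  shows "(\<integral>x. indicator U x * divergence F x \<partial>lborel) =
    (\<integral>x. indicator (frontier U) x * (F x \<bullet> outward_normal U x) \<partial>surface_measure U)"
proof -
  have "\<forall>z\<in>closure U. \<exists>r e \<gamma>. graph_chart U z r e \<gamma>"
    using ex_graph_chart[OF open_U C2_boundary_U] by blast
  then obtain r e \<gamma> where ch: "\<And>z. z \<in> closure U \<Longrightarrow> graph_chart U z (r z) (e z) (\<gamma> z)" by metis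
  have rpos: "r z > 0" if "z \<in> closure U" for z using ch[OF that] by (simp add: graph_chart_def)
  have "closure U \<subseteq> (\<Union>z\<in>closure U. ball z (r z / 2))"
    using rpos by force
  then obtain Z where Z: "Z \<subseteq> closure U" "finite Z" "closure U \<subseteq> (\<Union>z\<in>Z. ball z (r z / 2))"
    using compactE_image[OF compact_closure, of "closure U" "\<lambda>z. ball z (r z / 2)"] by auto
  have rZ: "r z / 2 > 0" if "z \<in> Z" for z using rpos Z(1) that by auto
  define S where "S x = (\<Sum>z\<in>Z. bump z (r z / 2) x)" for x
  define H where "H x = inverse (S x) *\<^sub>R F x" for x
  have S: "C1_map T S" for T unfolding S_def by (intro C1_map_sum C1_map_bump)
  have Spos: "S x > 0" if "x \<in> closure U" for x
  proof -
    obtain z where "z \<in> Z" "x \<in> ball z (r z / 2)" using Z(3) \<open>x \<in> closure U\<close> by blast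
    then show ?thesis
      unfolding S_def using bump_pos_iff[OF rZ] Z(2) by (intro sum_pos2[of Z z]) (auto simp: bump_nonneg)
  qed
  have iS: "C1_map (closure U) (\<lambda>x. inverse (S x))"
    by (intro C1_map_inverse S) (use Spos in force)
  have H: "C1_map U H" unfolding H_def by (intro C1_map_scaleR F C1_map_subset[OF iS U_subset_closure])
  have Hc: "continuous_on (closure U) H"
    unfolding H_def by (intro continuous_intros cont C1_map_imp_continuous_on[OF iS])
  obtain K where K: "\<And>x. x \<in> U \<Longrightarrow> \<bar>divergence H x\<bar> \<le> K"
    using divergence_scaleR_bounded[OF iS subset_refl F cont bd] unfolding H_def[abs_def] by blast
  define G where "G z x = bump z (r z / 2) x *\<^sub>R H x" for z x
  have GC1: "C1_map U (G z)" for z unfolding G_def by (intro C1_map_scaleR C1_map_bump H)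
  have Gc: "continuous_on (closure U) (G z)" for z
    unfolding G_def by (intro continuous_intros Hc C1_map_imp_continuous_on C1_map_bump)
  have "\<exists>K. \<forall>x\<in>U. \<bar>divergence (G z) x\<bar> \<le> K" for z
    using divergence_scaleR_bounded[OF C1_map_bump subset_UNIV H Hc K] unfolding G_def[abs_def] by metis
  then obtain L where L: "\<And>z x. x \<in> U \<Longrightarrow> \<bar>divergence (G z) x\<bar> \<le> L z" by metis
  have FG: "F x = (\<Sum>z\<in>Z. G z x)" if "x \<in> closure U" for x
    unfolding G_def H_def scaleR_sum_left[symmetric] using Spos[OF that] by (simp add: S_def[symmetric])
  have local: "(\<integral>x. indicator U x * divergence (G z) x \<partial>lborel) =
      (\<integral>x. indicator (frontier U) x * (G z x \<bullet> outward_normal U x) \<partial>surface_measure U)" if z: "z \<in> Z" for z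
  proof (rule divergence_theorem_chart[OF ch _ GC1 Gc])
    show "z \<in> closure U" using z Z(1) by blast
    show "r z / 2 < r z" using rZ[OF z] by simp
    show "G z x = 0" if "x \<notin> cball z (r z / 2)" for x
      using bump_eq_0[OF rZ[OF z], of x z] that by (auto simp: G_def)
  qed (rule L)
  have "(\<integral>x. indicator U x * divergence F x \<partial>lborel) =
      (\<integral>x. (\<Sum>z\<in>Z. indicator U x * divergence (G z) x) \<partial>lborel)"
  proof (intro Bochner_Integration.integral_cong refl)
    fix x show "indicator U x * divergence F x = (\<Sum>z\<in>Z. indicator U x * divergence (G z) x)"
    proof (cases "x \<in> U")
      case True
      then have "divergence F x = divergence (\<lambda>y. \<Sum>z\<in>Z. G z y) x"
        using FG U_subset_closure by (intro divergence_cong_open[OF open_U]) auto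
      also have "\<dots> = (\<Sum>z\<in>Z. divergence (G z) x)"
        by (rule divergence_sum) (rule C1_map_differentiable[OF GC1 True])
      finally show ?thesis using True by simp
    qed simp
  qed
  also have "\<dots> = (\<Sum>z\<in>Z. \<integral>x. indicator U x * divergence (G z) x \<partial>lborel)"
    by (rule Bochner_Integration.integral_sum)
      (rule integrable_on_U[OF continuous_on_divergence[OF GC1] L])
  also have "\<dots> = (\<Sum>z\<in>Z. \<integral>x. indicator (frontier U) x * (G z x \<bullet> outward_normal U x) \<partial>surface_measure U)"
    by (intro sum.cong refl local)
  also have "\<dots> = (\<integral>x. (\<Sum>z\<in>Z. indicator (frontier U) x * (G z x \<bullet> outward_normal U x)) \<partial>surface_measure U)"
    by (intro Bochner_Integration.integral_sum[symmetric] integrable_flux Gc)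
  also have "\<dots> = (\<integral>x. indicator (frontier U) x * (F x \<bullet> outward_normal U x) \<partial>surface_measure U)"
  proof (intro Bochner_Integration.integral_cong refl)
    fix x show "(\<Sum>z\<in>Z. indicator (frontier U) x * (G z x \<bullet> outward_normal U x)) =
        indicator (frontier U) x * (F x \<bullet> outward_normal U x)"
      using FG[of x] by (cases "x \<in> frontier U") (auto simp: frontier_def inner_sum_left)
  qed
  finally show ?thesis .
qed

text \<open>Since the derivative within the closure is unique at boundary points, any gradient found there by
  the chain rule is the one picked by \<open>gradient_within\<close>.\<close>

lemma gradient_within_closure_at_frontier:
  fixes f :: "'a \<Rightarrow> real"
  assumes x: "x \<in> frontier U" and f: "(f has_derivative (\<lambda>h. g \<bullet> h)) (at x within closure U)"
  shows "gradient_within (closure U) f x = g"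
proof (rule gradient_within_eqI[OF f])
  obtain r e \<gamma> where c: "graph_chart U x r e \<gamma>" using x C2_boundary_U C2_boundary_def by blast
  interpret chart e \<gamma> U x r by (rule chartI[OF c])
  fix g' assume "(f has_derivative (\<lambda>h. g' \<bullet> h)) (at x within closure U)"
  then have "(\<lambda>h. g' \<bullet> h) = (\<lambda>h. g \<bullet> h)"
    using derivative_unique_at_frontier[OF x _ _ f] r_pos by simp
  then show "g' = g" by (metis vector_eq_rdot)
qed

lemma gradient_within_closure_in_U:
  assumes "x \<in> U" "f differentiable at x"
  shows "gradient_within (closure U) f x = grad f x"
  by (rule gradient_within_interior)
    (use assms interior_maximal[OF U_subset_closure open_U] in auto)

lemma has_derivative_gradient_within_closure:
  fixes f :: "'a \<Rightarrow> real"
  assumes x: "x \<in> frontier U" and f: "f differentiable (at x within closure U)"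
  shows "(f has_derivative (\<lambda>h. gradient_within (closure U) f x \<bullet> h)) (at x within closure U)"
proof -
  obtain D where D: "(f has_derivative D) (at x within closure U)" using f differentiable_def by blast
  have lin: "linear D" by (rule has_derivative_linear[OF D])
  define g where "g = (\<Sum>b\<in>Basis. D b *\<^sub>R b)"
  have "D h = g \<bullet> h" for h
    unfolding g_def by (rule linear_eq_inner[OF lin])
  then have "(f has_derivative (\<lambda>h. g \<bullet> h)) (at x within closure U)"
    using D by (metis (no_types, lifting) ext has_derivative_transform)
  then show ?thesis using gradient_within_closure_at_frontier[OF x] by simp
qed

end

section \<open>The Forchheimer flux\<close>

lemma K2_denominator_pos:
  assumes "\<alpha> > 0" "\<beta> \<ge> 0" "\<xi> \<ge> 0"
  shows "\<alpha>\<^sup>2 + 4 * \<beta> * \<xi> > 0" "\<alpha> + sqrt (\<alpha>\<^sup>2 + 4 * \<beta> * \<xi>) > 0"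
  using assms by (auto intro!: add_pos_nonneg mult_nonneg_nonneg)

lemma K2_pos: "\<alpha> > 0 \<Longrightarrow> \<beta> \<ge> 0 \<Longrightarrow> \<xi> \<ge> 0 \<Longrightarrow> K2 \<alpha> \<beta> \<xi> > 0"
  unfolding K2_def using K2_denominator_pos(2) by simp

lemma K2_has_real_derivative:
  assumes "\<alpha> > 0" "\<beta> \<ge> 0" "\<xi> \<ge> 0"
  shows "(K2 \<alpha> \<beta> has_real_derivative
    - 4 * \<beta> / (sqrt (\<alpha>\<^sup>2 + 4 * \<beta> * \<xi>) * (\<alpha> + sqrt (\<alpha>\<^sup>2 + 4 * \<beta> * \<xi>))\<^sup>2)) (at \<xi>)"
  unfolding K2_def[abs_def] using K2_denominator_pos[OF assms]
  by (auto intro!: derivative_eq_intros simp: divide_simps power2_eq_square)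

text \<open>The norm is not differentiable at \<open>0\<close>, but the factor \<open>v\<close> compensates: the term of the derivative that
  contains \<open>sgn v\<close> tends to \<open>0\<close> there. With the convention \<open>sgn 0 = 0\<close> one formula covers all points.\<close>

lemma C1_map_flux:
  fixes \<alpha> \<beta> :: real
  assumes \<alpha>: "\<alpha> > 0" and \<beta>: "\<beta> \<ge> 0"
  shows "C1_map UNIV (\<lambda>v::'a::euclidean_space. K2 \<alpha> \<beta> (norm v) *\<^sub>R v)"
proof -
  define k' where "k' \<xi> = - 4 * \<beta> / (sqrt (\<alpha>\<^sup>2 + 4 * \<beta> * \<xi>) * (\<alpha> + sqrt (\<alpha>\<^sup>2 + 4 * \<beta> * \<xi>))\<^sup>2)" for \<xi>
  have der: "(K2 \<alpha> \<beta> has_real_derivative k' \<xi>) (at \<xi>)" if "\<xi> \<ge> 0" for \<xi>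
    unfolding k'_def by (rule K2_has_real_derivative[OF \<alpha> \<beta> that])
  have "continuous_on {0..} (K2 \<alpha> \<beta>)"
    using der by (auto intro!: continuous_at_imp_continuous_on DERIV_isCont)
  then have Kc: "continuous_on UNIV (\<lambda>v::'a. K2 \<alpha> \<beta> (norm v))"
    by (rule continuous_on_compose2) (auto intro!: continuous_intros)
  have "continuous_on {0..} k'"
    unfolding k'_def using K2_denominator_pos[OF \<alpha> \<beta>]
    by (intro continuous_intros) (force simp: less_le)+
  then have k'c: "continuous_on UNIV (\<lambda>v::'a. k' (norm v))"
    by (rule continuous_on_compose2) (auto intro!: continuous_intros)
  have cont0: "(f \<longlongrightarrow> f 0) (at 0)" if "continuous_on UNIV f" for f :: "'a \<Rightarrow> real"
    using that by (simp add: continuous_on_eq_continuous_at isCont_def)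
  show ?thesis
  proof (rule C1_mapI[where f' = "\<lambda>v h. K2 \<alpha> \<beta> (norm v) *\<^sub>R h + (k' (norm v) * (sgn v \<bullet> h)) *\<^sub>R v"])
    fix v :: 'a
    show "((\<lambda>v. K2 \<alpha> \<beta> (norm v) *\<^sub>R v) has_derivative
        (\<lambda>h. K2 \<alpha> \<beta> (norm v) *\<^sub>R h + (k' (norm v) * (sgn v \<bullet> h)) *\<^sub>R v)) (at v)"
    proof (cases "v = 0")
      case False
      have "((\<lambda>v. K2 \<alpha> \<beta> (norm v)) has_derivative (\<lambda>h. k' (norm v) * (sgn v \<bullet> h))) (at v)"
        using has_derivative_compose[OF has_derivative_norm[OF False]
            der[OF norm_ge_zero, unfolded has_field_derivative_def]]
        by (simp add: inner_commute)
      then show ?thesis by (intro has_derivative_scaleR has_derivative_ident)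
    next
      case True
      have "((\<lambda>y::'a. \<bar>K2 \<alpha> \<beta> (norm y) - K2 \<alpha> \<beta> (norm (0::'a))\<bar>) \<longlongrightarrow> \<bar>K2 \<alpha> \<beta> (norm (0::'a)) - K2 \<alpha> \<beta> (norm (0::'a))\<bar>) (at 0)"
        by (intro tendsto_intros cont0[OF Kc])
      then have "((\<lambda>y::'a. \<bar>K2 \<alpha> \<beta> (norm y) - K2 \<alpha> \<beta> 0\<bar>) \<longlongrightarrow> 0) (at 0)" by simp
      moreover have "\<forall>\<^sub>F y in at (0::'a). \<bar>K2 \<alpha> \<beta> (norm y) - K2 \<alpha> \<beta> 0\<bar> =
          norm (K2 \<alpha> \<beta> (norm y) *\<^sub>R y - K2 \<alpha> \<beta> 0 *\<^sub>R y) / norm y"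
        by (rule eventually_at_filter[THEN iffD2], rule always_eventually)
          (auto simp: scaleR_left_diff_distrib[symmetric])
      ultimately have "((\<lambda>y::'a. norm (K2 \<alpha> \<beta> (norm y) *\<^sub>R y - K2 \<alpha> \<beta> 0 *\<^sub>R y) / norm y) \<longlongrightarrow> 0) (at 0)"
        by (rule Lim_transform_eventually)
      then show ?thesis
        using True by (simp add: has_derivative_iff_norm bounded_linear_scaleR_right)
    qed
  next
    fix h :: 'a
    have "isCont (\<lambda>v. (k' (norm v) * (sgn v \<bullet> h)) *\<^sub>R v) v" for v :: 'a
    proof (cases "v = 0")
      case False
      have "isCont (\<lambda>v::'a. k' (norm v)) v" using k'c by (simp add: continuous_on_eq_continuous_at)
      then show ?thesis using False
        by (intro continuous_intros isCont_sgn) (auto intro!: continuous_intros)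
    next
      case True
      have "((\<lambda>v. (k' (norm v) * (sgn v \<bullet> h)) *\<^sub>R v) \<longlongrightarrow> 0) (at (0::'a))"
      proof (rule Lim_null_comparison)
        show "\<forall>\<^sub>F v in at (0::'a). norm ((k' (norm v) * (sgn v \<bullet> h)) *\<^sub>R v) \<le> \<bar>k' (norm v)\<bar> * norm h * norm v"
        proof (rule always_eventually, rule allI)
          fix v :: 'a
          have "\<bar>sgn v \<bullet> h\<bar> \<le> norm (sgn v) * norm h" by (rule Cauchy_Schwarz_ineq2)
          also have "\<dots> \<le> 1 * norm h" by (intro mult_right_mono) (auto simp: norm_sgn)
          finally show "norm ((k' (norm v) * (sgn v \<bullet> h)) *\<^sub>R v) \<le> \<bar>k' (norm v)\<bar> * norm h * norm v"
            by (simp add: abs_mult mult_left_mono mult_right_mono)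
        qed
        have "((\<lambda>v::'a. \<bar>k' (norm v)\<bar> * norm h * norm v) \<longlongrightarrow> \<bar>k' (norm (0::'a))\<bar> * norm h * norm (0::'a)) (at 0)"
          by (intro tendsto_intros cont0[OF k'c])
        then show "((\<lambda>v::'a. \<bar>k' (norm v)\<bar> * norm h * norm v) \<longlongrightarrow> 0) (at 0)" by simp
      qed
      then show ?thesis using True by (simp add: isCont_def)
    qed
    then have "continuous_on UNIV (\<lambda>v. (k' (norm v) * (sgn v \<bullet> h)) *\<^sub>R v)"
      by (simp add: continuous_on_eq_continuous_at)
    then show "continuous_on UNIV (\<lambda>v. K2 \<alpha> \<beta> (norm v) *\<^sub>R h + (k' (norm v) * (sgn v \<bullet> h)) *\<^sub>R v)"
      by (rule continuous_on_add[OF continuous_on_scaleR[OF Kc continuous_on_const]])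
  qed
qed

section \<open>The steady problem\<close>

text \<open>This turns an inequality that holds almost everywhere into one that holds everywhere.\<close>

lemma open_imp_not_null_lborel:
  fixes S :: "'a::euclidean_space set"
  assumes "open S" "S \<in> null_sets lborel" shows "S = {}"
  using assms open_not_negligible negligible_iff_null_sets null_sets_completionI by blast

locale steady_problem = C2_domain U for U :: "'a::euclidean_space set" +
  fixes \<alpha> \<beta> A :: real and \<Gamma>e \<Gamma>i :: "'a set" and W :: "'a \<Rightarrow> real"
  assumes \<alpha>: "\<alpha> > 0" and \<beta>: "\<beta> \<ge> 0" and A: "A > 0" and U_nonempty: "U \<noteq> {}"
    and frontier_eq: "frontier U = \<Gamma>e \<union> \<Gamma>i" and \<Gamma>i_borel [measurable]: "\<Gamma>i \<in> sets borel"
    and solution: "classical_solution \<alpha> \<beta> A U \<Gamma>e \<Gamma>i W"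
begin

definition g :: "'a \<Rightarrow> 'a" where "g = gradient_within (closure U) W"
definition flux :: "'a \<Rightarrow> 'a" where "flux x = K2 \<alpha> \<beta> (norm (g x)) *\<^sub>R g x"

lemma C1_map_W: "C1_map U W" and C1_map_grad_W: "C1_map U (grad W)"
  using solution C1_map_grad unfolding classical_solution_def
  by (auto simp: C2_on_def C1_on_iff_C1_map)

lemma W_has_derivative: "x \<in> closure U \<Longrightarrow> W differentiable (at x within closure U)"
  using solution unfolding classical_solution_def C1_upto_boundary_def differentiable_on_def by blast

lemma continuous_on_W: "continuous_on (closure U) W"
  using W_has_derivative by (simp add: differentiable_imp_continuous_on differentiable_on_def)

lemma continuous_on_g: "continuous_on (closure U) g"
  using solution unfolding classical_solution_def C1_upto_boundary_def g_def by blast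

lemma g_eq: "x \<in> U \<Longrightarrow> g x = grad W x"
  unfolding g_def by (rule gradient_within_closure_in_U[OF _ C1_map_differentiable[OF C1_map_W]])

lemma C1_map_flux_field: "C1_map U flux"
proof -
  have "C1_map U (\<lambda>x. K2 \<alpha> \<beta> (norm (grad W x)) *\<^sub>R grad W x)"
    by (rule C1_map_compose[OF C1_map_flux[OF \<alpha> \<beta>] C1_map_grad_W]) simp
  then show ?thesis
    by (rule C1_map_cong_open[OF open_U, rotated]) (simp add: flux_def g_eq)
qed

lemma continuous_on_flux: "continuous_on (closure U) flux"
  unfolding flux_def
  by (rule continuous_on_compose2[OF C1_map_imp_continuous_on[OF C1_map_flux[OF \<alpha> \<beta>]] continuous_on_g]) simp

lemma divergence_flux: "x \<in> U \<Longrightarrow> divergence flux x = - A"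
  using solution unfolding classical_solution_def flux_def[abs_def] g_def by fastforce

lemma W_\<Gamma>i: "x \<in> \<Gamma>i \<Longrightarrow> W x = 0"
  using solution unfolding classical_solution_def by blast

lemma flux_\<Gamma>e: "x \<in> \<Gamma>e \<Longrightarrow> flux x \<bullet> outward_normal U x = 0"
  using solution unfolding classical_solution_def flux_def g_def by simp

lemma measure_U_pos: "measure lborel U > 0"
proof -
  have "emeasure lborel U < \<infinity>" using bounded_U by (rule emeasure_bounded_finite)
  moreover have "emeasure lborel U \<noteq> 0"
    using open_imp_not_null_lborel[OF open_U] U_nonempty by (auto simp: null_sets_def)
  ultimately show ?thesis
    by (metis emeasure_eq_ennreal_measure ennreal_0 infinity_ennreal_def less_irrefl measure_nonneg order_le_less)
qed

text \<open>The flux through \<open>\<Gamma>e\<close> vanishes, and the divergence is the constant \<open>- A\<close>.\<close>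

theorem total_flux:
  "(\<integral>x. indicator \<Gamma>i x * (flux x \<bullet> outward_normal U x) \<partial>surface_measure U) = - A * measure lborel U"
proof -
  have "(\<integral>x. indicator \<Gamma>i x * (flux x \<bullet> outward_normal U x) \<partial>surface_measure U) =
      (\<integral>x. indicator (frontier U) x * (flux x \<bullet> outward_normal U x) \<partial>surface_measure U)"
    using flux_\<Gamma>e frontier_eq by (intro Bochner_Integration.integral_cong) (auto simp: indicator_def)
  also have "\<dots> = (\<integral>x. indicator U x * divergence flux x \<partial>lborel)"
    by (rule divergence_theorem[symmetric, OF C1_map_flux_field continuous_on_flux, where C = "\<bar>A\<bar>"])
      (simp add: divergence_flux)
  also have "\<dots> = (\<integral>x. - A * indicator U x \<partial>lborel)"
    by (intro Bochner_Integration.integral_cong) (auto simp: indicator_def divergence_flux)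
  finally show ?thesis by simp
qed

text \<open>If \<open>\<Gamma>i\<close> had no area, nothing could balance the source \<open>A\<close>.\<close>

lemma surface_\<Gamma>i_pos: "measure (surface_measure U) \<Gamma>i > 0"
proof (rule ccontr)
  interpret finite_measure "surface_measure U" by (rule finite_measure_surface)
  assume "\<not> ?thesis"
  then have "measure (surface_measure U) \<Gamma>i = 0" using measure_nonneg[of "surface_measure U" \<Gamma>i] by linarith
  then have "\<Gamma>i \<in> null_sets (surface_measure U)"
    by (auto simp: null_sets_def emeasure_eq_measure)
  then have "AE x in surface_measure U. indicator \<Gamma>i x * (flux x \<bullet> outward_normal U x) = 0"
    by (auto dest!: AE_not_in elim!: eventually_mono)
  then have "(\<integral>x. indicator \<Gamma>i x * (flux x \<bullet> outward_normal U x) \<partial>surface_measure U) = 0"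
    by (rule integral_eq_zero_AE)
  then show False using total_flux A measure_U_pos by simp
qed

text \<open>The maximum principle, in the weak form: the field \<open>- (max 0 (- W))\<^sup>2 *\<^sub>R flux\<close> has no flux through
  the boundary, while its divergence is nonnegative, and positive where \<open>W < 0\<close>.\<close>

theorem W_nonneg:
  assumes "x \<in> U" shows "W x \<ge> 0"
proof -
  define f where "f x = - ((max 0 (- W x))\<^sup>2)" for x
  define q where "q x = A * (max 0 (- W x))\<^sup>2 + (2 * max 0 (- W x)) * (g x \<bullet> flux x)" for x
  have f: "C1_map U f"
  proof -
    have "C1_map U (\<lambda>x. 0 - (max 0 (0 - W x))\<^sup>2)"
      by (intro C1_map_diff C1_map_const C1_map_compose[OF C1_map_pos_part_sq[of UNIV]] C1_map_W) simp
    then show ?thesis unfolding f_def by simp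
  qed
  have gf: "grad f x = (2 * max 0 (- W x)) *\<^sub>R grad W x" if x: "x \<in> U" for x
  proof -
    have "((\<lambda>x. - W x) has_derivative (\<lambda>h. - (grad W x \<bullet> h))) (at x)"
      by (intro has_derivative_minus has_derivative_grad C1_map_differentiable[OF C1_map_W x])
    from has_derivative_compose[OF this has_real_derivative_pos_part_sq[unfolded has_field_derivative_def]]
    have "(f has_derivative (\<lambda>h. - (2 * max 0 (- W x) * - (grad W x \<bullet> h)))) (at x)"
      unfolding f_def[abs_def] by (intro has_derivative_minus)
    moreover have "(f has_derivative (\<lambda>h. grad f x \<bullet> h)) (at x)"
      by (rule has_derivative_grad[OF C1_map_differentiable[OF f x]])
    ultimately have "(\<lambda>h. grad f x \<bullet> h) = (\<lambda>h. - (2 * max 0 (- W x) * - (grad W x \<bullet> h)))"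
      using has_derivative_unique by blast
    then have "(\<lambda>h. grad f x \<bullet> h) = (\<lambda>h. ((2 * max 0 (- W x)) *\<^sub>R grad W x) \<bullet> h)" by simp
    then show ?thesis by (metis vector_eq_rdot)
  qed
  have div: "divergence (\<lambda>y. f y *\<^sub>R flux y) x = q x" if "x \<in> U" for x
    by (subst divergence_scaleR)
      (use that C1_map_differentiable[OF f] C1_map_differentiable[OF C1_map_flux_field] in
        \<open>auto simp: gf divergence_flux f_def q_def g_eq\<close>)
  have qc: "continuous_on (closure U) q"
    unfolding q_def by (intro continuous_intros continuous_on_W continuous_on_g continuous_on_flux)
  then have "bounded (q ` closure U)"
    by (intro compact_imp_bounded compact_continuous_image compact_closure)
  then obtain C where C: "\<And>x. x \<in> U \<Longrightarrow> \<bar>q x\<bar> \<le> C"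
    unfolding bounded_iff using U_subset_closure by (metis imageI real_norm_def subsetD)
  have "(\<integral>x. indicator U x * q x \<partial>lborel) = (\<integral>x. indicator U x * divergence (\<lambda>y. f y *\<^sub>R flux y) x \<partial>lborel)"
    by (intro Bochner_Integration.integral_cong) (auto simp: indicator_def div)
  also have "\<dots> = (\<integral>x. indicator (frontier U) x * (f x *\<^sub>R flux x \<bullet> outward_normal U x) \<partial>surface_measure U)"
  proof (rule divergence_theorem)
    show "C1_map U (\<lambda>y. f y *\<^sub>R flux y)" by (intro C1_map_scaleR f C1_map_flux_field)
    show "continuous_on (closure U) (\<lambda>y. f y *\<^sub>R flux y)"
      unfolding f_def by (intro continuous_intros continuous_on_W continuous_on_flux)
    show "\<bar>divergence (\<lambda>y. f y *\<^sub>R flux y) x\<bar> \<le> C" if "x \<in> U" for x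
      using C[OF that] by (simp add: div[OF that])
  qed
  also have "\<dots> = (\<integral>x. 0 \<partial>surface_measure U)"
    using frontier_eq W_\<Gamma>i flux_\<Gamma>e
    by (intro Bochner_Integration.integral_cong) (auto simp: indicator_def f_def)
  finally have int0: "(\<integral>x. indicator U x * q x \<partial>lborel) = 0" by simp
  have gflux: "g x \<bullet> flux x \<ge> 0" for x
    unfolding flux_def using K2_pos[OF \<alpha> \<beta>, of "norm (g x)"] by simp
  have q0: "q x \<ge> 0" for x
    unfolding q_def using A gflux by (intro add_nonneg_nonneg mult_nonneg_nonneg) auto
  have "AE x in lborel. indicator U x * q x = 0"
    using int0 q0 integrable_on_U[OF continuous_on_subset[OF qc U_subset_closure] C]
    by (subst (asm) integral_nonneg_eq_0_iff_AE) auto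
  then have "AE x in lborel. x \<notin> {x \<in> U. W x < 0}"
  proof (rule eventually_mono)
    fix x assume x: "indicator U x * q x = 0"
    show "x \<notin> {x \<in> U. W x < 0}"
    proof
      assume "x \<in> {x \<in> U. W x < 0}"
      then have x': "x \<in> U" "W x < 0" by auto
      have "q x > 0"
        unfolding q_def using A x'(2) gflux[of x] by (intro add_pos_nonneg mult_nonneg_nonneg mult_pos_pos) auto
      then show False using x x'(1) by simp
    qed
  qed
  moreover have op: "open {x \<in> U. W x < 0}"
  proof -
    have "open (U \<inter> W -` {..<0})"
      by (intro continuous_open_preimage continuous_on_subset[OF continuous_on_W U_subset_closure] open_U) simp
    also have "U \<inter> W -` {..<0} = {x \<in> U. W x < 0}" by auto
    finally show ?thesis .
  qed
  ultimately have "{x \<in> U. W x < 0} \<in> null_sets lborel"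
    by (subst AE_iff_null_sets) auto
  then have "{x \<in> U. W x < 0} = {}" by (rule open_imp_not_null_lborel[OF op])
  then show ?thesis using assms by (metis (mono_tags, lifting) empty_iff mem_Collect_eq not_le)
qed

section \<open>The auxiliary pressure\<close>

text \<open>On \<open>\<Gamma>i\<close> the radicand is \<open>(B - A * t)\<^sup>2 > 0\<close>, so the root is differentiable there and \<open>p \<nabla>p = \<nabla>W\<close>.\<close>

lemma aux_pressure_flux:
  assumes c: "B - A * t > 0" and x: "x \<in> \<Gamma>i"
  defines "p \<equiv> \<lambda>y. aux_pressure A B W y t"
  shows "K2 \<alpha> \<beta> (p x * norm (gradient_within (closure U) p x)) * p x *
      (gradient_within (closure U) p x \<bullet> outward_normal U x) = flux x \<bullet> outward_normal U x"
proof -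
  define c where "c = B - A * t"
  have c0: "c > 0" using c by (simp add: c_def)
  have xf: "x \<in> frontier U" using x frontier_eq by blast
  then have xc: "x \<in> closure U" by (simp add: frontier_def)
  have px: "p x = c" using W_\<Gamma>i[OF x] c0 by (simp add: p_def aux_pressure_def c_def)
  have "(W has_derivative (\<lambda>h. g x \<bullet> h)) (at x within closure U)"
    unfolding g_def by (rule has_derivative_gradient_within_closure[OF xf W_has_derivative[OF xc]])
  then have "((\<lambda>y. c\<^sup>2 + 2 * W y) has_derivative (\<lambda>h. 2 * (g x \<bullet> h))) (at x within closure U)"
    by (auto intro!: derivative_eq_intros)
  moreover have "(sqrt has_derivative (*) (inverse (sqrt (c\<^sup>2 + 2 * W x)) / 2)) (at (c\<^sup>2 + 2 * W x))"
    using DERIV_real_sqrt[of "c\<^sup>2 + 2 * W x"] c0 W_\<Gamma>i[OF x] by (simp add: has_field_derivative_def)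
  ultimately have "((\<lambda>y. sqrt (c\<^sup>2 + 2 * W y)) has_derivative
      (\<lambda>h. inverse (sqrt (c\<^sup>2 + 2 * W x)) / 2 * (2 * (g x \<bullet> h)))) (at x within closure U)"
    by (rule has_derivative_compose)
  then have "(p has_derivative (\<lambda>h. (inverse c *\<^sub>R g x) \<bullet> h)) (at x within closure U)"
    using c0 W_\<Gamma>i[OF x] by (simp add: p_def aux_pressure_def c_def)
  then have gp: "gradient_within (closure U) p x = inverse c *\<^sub>R g x"
    by (rule gradient_within_closure_at_frontier[OF xf])
  have "c * norm (inverse c *\<^sub>R g x) = norm (g x)" using c0 by (simp add: mult.assoc[symmetric])
  then have "K2 \<alpha> \<beta> (c * norm (inverse c *\<^sub>R g x)) = K2 \<alpha> \<beta> (norm (g x))" by (rule arg_cong)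
  then show ?thesis unfolding gp px flux_def by (simp only:) (use c0 in simp)
qed

lemma mass_flow_aux_pressure:
  assumes c: "B - A * t > 0"
  shows "mass_flow \<alpha> \<beta> U \<Gamma>i (aux_pressure A B W) t = A * measure lborel U"
proof -
  have "mass_flow \<alpha> \<beta> U \<Gamma>i (aux_pressure A B W) t =
      - (\<integral>x. indicator \<Gamma>i x * (flux x \<bullet> outward_normal U x) \<partial>surface_measure U)"
    unfolding mass_flow_def set_lebesgue_integral_def
    by (intro arg_cong[where f = uminus] Bochner_Integration.integral_cong refl)
      (simp add: indicator_def aux_pressure_flux[OF c])
  then show ?thesis by (simp add: total_flux)
qed

text \<open>As \<open>W \<ge> 0\<close> in \<open>U\<close>, the square of the root is its radicand, and the term \<open>(B - A * t)\<^sup>2\<close> has the same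
  mean over \<open>U\<close> and over \<open>\<Gamma>i\<close>.\<close>

lemma productivity_index_aux_pressure:
  assumes c: "B - A * t > 0"
  shows "productivity_index \<alpha> \<beta> U \<Gamma>i (aux_pressure A B W) t =
    A * measure lborel U / (1 / measure lborel U * (LINT x:U|lborel. 2 * W x))"
proof -
  interpret \<sigma>: finite_measure "surface_measure U" by (rule finite_measure_surface)
  have "bounded (W ` closure U)"
    by (intro compact_imp_bounded compact_continuous_image compact_closure continuous_on_W)
  then obtain C where C: "\<And>x. x \<in> U \<Longrightarrow> \<bar>W x\<bar> \<le> C"
    unfolding bounded_iff using U_subset_closure by (metis imageI real_norm_def subsetD)
  have intW: "integrable lborel (\<lambda>x. indicator U x * (2 * W x))"
    by (rule integrable_on_U[where C = "2 * C"])
      (use C in \<open>auto intro!: continuous_intros continuous_on_subset[OF continuous_on_W U_subset_closure]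
        simp: abs_mult\<close>)
  have int1: "integrable lborel (\<lambda>x. indicator U x * (B - A * t)\<^sup>2)"
    by (rule integrable_on_U) auto
  have "(LINT x:U|lborel. (aux_pressure A B W x t)\<^sup>2) =
      (\<integral>x. indicator U x * (B - A * t)\<^sup>2 + indicator U x * (2 * W x) \<partial>lborel)"
    unfolding set_lebesgue_integral_def aux_pressure_def using W_nonneg
    by (intro Bochner_Integration.integral_cong) (auto simp: indicator_def)
  also have "\<dots> = (B - A * t)\<^sup>2 * measure lborel U + (LINT x:U|lborel. 2 * W x)"
    unfolding set_lebesgue_integral_def Bochner_Integration.integral_add[OF int1 intW] by simp
  finally have 1: "(LINT x:U|lborel. (aux_pressure A B W x t)\<^sup>2) =
      (B - A * t)\<^sup>2 * measure lborel U + (LINT x:U|lborel. 2 * W x)" .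
  have "(LINT x:\<Gamma>i|surface_measure U. (aux_pressure A B W x t)\<^sup>2) =
      (\<integral>x. indicator \<Gamma>i x * (B - A * t)\<^sup>2 \<partial>surface_measure U)"
    unfolding set_lebesgue_integral_def aux_pressure_def using W_\<Gamma>i
    by (intro Bochner_Integration.integral_cong) (auto simp: indicator_def)
  then have 2: "(LINT x:\<Gamma>i|surface_measure U. (aux_pressure A B W x t)\<^sup>2) =
      (B - A * t)\<^sup>2 * measure (surface_measure U) \<Gamma>i"
    by simp
  show ?thesis
    unfolding productivity_index_def mass_flow_aux_pressure[OF c] 1 2
    using measure_U_pos surface_\<Gamma>i_pos by (simp add: distrib_left)
qed

end

theorem proposition6p3:
  fixes U \<Gamma>e \<Gamma>i :: "'a::euclidean_space set" and W :: "'a \<Rightarrow> real"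
    and \<alpha> \<beta> A B Q0 :: real
  assumes "open U" and "connected U" and "U \<noteq> {}" and "bounded U"
    and "C2_boundary U"
    and "frontier U = \<Gamma>e \<union> \<Gamma>i" and "\<Gamma>i \<in> sets borel"
    and "\<alpha> > 0" and "\<beta> \<ge> 0" and "A > 0" and "B > 0"
    and "Q0 = A * measure lborel U"
    and "classical_solution \<alpha> \<beta> A U \<Gamma>e \<Gamma>i W"
  shows "\<forall>t. 0 \<le> t \<and> t < B / A \<longrightarrow>
           productivity_index \<alpha> \<beta> U \<Gamma>i (aux_pressure A B W) t =
             Q0 / (1 / measure lborel U * (LINT x:U|lborel. 2 * W x))"
proof (intro allI impI)
  interpret steady_problem U \<alpha> \<beta> A \<Gamma>e \<Gamma>i W
    by unfold_locales (use assms in auto)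
  fix t assume "0 \<le> t \<and> t < B / A"
  then have "B - A * t > 0" using \<open>A > 0\<close> by (simp add: field_simps)
  then show "productivity_index \<alpha> \<beta> U \<Gamma>i (aux_pressure A B W) t =
      Q0 / (1 / measure lborel U * (LINT x:U|lborel. 2 * W x))"
    unfolding \<open>Q0 = A * measure lborel U\<close> by (rule productivity_index_aux_pressure)
qed

end
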